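(* Let $(M,F)$ be a Finsler manifold of dimension $n\geq 2$. Assume that $\mathrm{Ric}=\rho F^2$ on $TM\setminus\mathbf{0}$ for some smooth function $\rho\colon M\to\mathbb{R}$. Let $\omega$ be the Hilbert $1$-form, with components $\omega_i=y_i/F$, and let $\mathfrak{P}\colon TM\setminus\mathbf{0}\to\mathbb{R}$ be the function $\mathfrak{P}=g^{ij}\left(P_{i|j}-P_iP_j+P_{i|0\cdot j}\right)$ built from the mean Landsberg tensor $P_i\,dx^i$. Then $$(n-2)\,d\rho=-2n\,\langle \mathfrak{P}_{|0}\,\omega\rangle,$$ where $\langle\cdot\rangle$ denotes the fiberwise average. Equivalently, in coordinates around each $x\in M$, $$(n-2)\,\partial_i\rho(x)=-2n\,\frac{\int_{(T_xM)^+}F(x,y)^{-2}\,\mathfrak{P}_{|0}(x,y)\,y_i\,d\Sigma^+_x(y)}{\int_{(T_xM)^+}d\Sigma^+_x(y)}.$$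
   Context: Notation. $M$ is a smooth manifold of dimension $n\ge 2$, $(x^i)$ are local coordinates on $M$ and $(x^i,y^i)$ the induced natural coordinates on $TM$; $\partial_i=\partial/\partial x^i$, $\dot\partial_i=\partial/\partial y^i$; the Einstein summation convention is used. "$r$-homogeneous" means positively homogeneous of degree $r$ in $y$: $f(x,\mu y)=\mu^r f(x,y)$ for $\mu>0$. A Finsler metric on $M$ is a positive smooth $1$-homogeneous function $F$ on $TM\setminus\mathbf{0}$ (slit tangent bundle) such that $g_{ij}(x,y)=\frac12\frac{\partial^2F^2}{\partial y^i\partial y^j}(x,y)$ is positive definite at every $(x,y)\in TM\setminus\mathbf{0}$. $(g^{ij})$ is the inverse matrix and $y_i:=g_{ij}y^j$. An anisotropic tensor has components in natural coordinates that are smooth functions of $(x,y)\in TM\setminus\mathbf{0}$ and that transform as those of a tensor on $M$. An index after a dot denotes vertical derivative: $f_{\cdot j}=\dot\partial_jf$, $\theta_{i\cdot j}=\dot\partial_j\theta_i$, etc. Spray coefficients: $G^i=\frac14 g^{ic}\left(\partial_a g_{cb}+\partial_b g_{ac}-\partial_c g_{ab}\right)y^ay^b$. Horizontal frame: $\delta_i=\partial_i-G^a_{\cdot i}\dot\partial_a$. Chern–Rund Christoffel symbols: $\Gamma^i_{jk}=\frac12g^{il}(\delta_jg_{lk}+\delta_kg_{lj}-\delta_lg_{jk})$. The associated covariant derivative of anisotropic tensors is denoted by a vertical bar: $f_{|j}=\delta_jf$, $\theta_{i|j}=\delta_j\theta_i-\Gamma^k_{ji}\theta_k$, and similarly for other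 tensor types; $_{|0}$ denotes contraction of the new index with $y$: $f_{|0}=y^j\delta_jf$, $\theta_{i|0}=\theta_{i|j}y^j$, etc. $P_{i|0\cdot j}$ means $\dot\partial_j(P_{i|0})$. Mean Landsberg tensor: $P_i=G^a_{\cdot a\cdot i}-\Gamma^a_{ai}$ (it is $0$-homogeneous). Ricci scalar ($2$-homogeneous): $\mathrm{Ric}=2\frac{\partial G^i}{\partial x^i}-y^j\frac{\partial^2G^i}{\partial x^j\partial y^i}+2G^j\frac{\partial^2G^i}{\partial y^j\partial y^i}-\frac{\partial G^i}{\partial y^j}\frac{\partial G^j}{\partial y^i}$. Fiber integrals. $(TM)^+$ is the quotient of $TM\setminus\mathbf{0}$ by $(x,y)\sim(x,\mu y)$, $\mu>0$, with fibers $(T_xM)^+$; $0$-homogeneous functions on $TM\setminus\mathbf{0}$ are identified with functions on $(TM)^+$. In a chart, $d\Sigma^+_x$ is the $(n-1)$-form on $(T_xM)^+$ whose pullback to $T_xM\setminus 0$ is $\frac{\det(g_{ab})}{F^n}\sum_{i=1}^n(-1)^{i-1}y^i\,dy^1\wedge\dots\wedge\widehat{dy^i}\wedge\dots\wedge dy^n$ (with the fiber oriented so that this is a positive volume form). For an $r$-homogeneous anisotropic $1$-form $\theta=\theta_i\,dx^i$ on $TM\setminus\mathbf{0}$, its fiberwise average is the (globally well-defined) $1$-form $\langle\theta\rangle=\langle\theta\rangle_i\,dx^i$ on $M$ with $$\langle\theta\rangle_i(x)=\frac{\int_{(T_xM)^+}F(x,y)^{-r}\theta_i(x,y)\,d\Sigma^+_x(y)}{\int_{(T_xM)^+}d\Sigma^+_x(y)}.$$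 The $1$-form $\mathfrak{P}_{|0}\,\omega$ is homogeneous of degree $r=1$. *)

theory Defs
  imports "HOL-Analysis.Analysis"
begin

section \<open>Smooth maps\<close>

primrec Ck_on :: "nat \<Rightarrow> ('a::euclidean_space \<Rightarrow> 'b::real_normed_vector) \<Rightarrow> 'a set \<Rightarrow> bool" where
  "Ck_on 0 f S \<longleftrightarrow> continuous_on S f"
| "Ck_on (Suc k) f S \<longleftrightarrow>
     (\<forall>x\<in>S. f differentiable (at x)) \<and> (\<forall>v. Ck_on k (\<lambda>x. frechet_derivative f (at x) v) S)"

text \<open>Meant for open sets only.\<close>

definition smooth_on :: "('a::euclidean_space \<Rightarrow> 'b::real_normed_vector) \<Rightarrow> 'a set \<Rightarrow> bool" where
  "smooth_on f S \<longleftrightarrow> (\<forall>k. Ck_on k f S)"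


section \<open>Smooth manifolds and their tangent vectors\<close>

type_synonym ('m, 'n) chart = "'m set \<times> ('m \<Rightarrow> real ^ 'n)"

definition chart_img :: "('m, 'n) chart \<Rightarrow> (real ^ 'n) set" where
  "chart_img c = snd c ` fst c"

definition chart_inv :: "('m, 'n) chart \<Rightarrow> real ^ 'n \<Rightarrow> 'm" where
  "chart_inv c = inv_into (fst c) (snd c)"

definition transition :: "('m, 'n) chart \<Rightarrow> ('m, 'n) chart \<Rightarrow> real ^ 'n \<Rightarrow> real ^ 'n" where
  "transition c c' = snd c' \<circ> chart_inv c"

definition second_countable_space :: "'m topology \<Rightarrow> bool" where
  "second_countable_space X \<longleftrightarrow>
     (\<exists>B. countable B \<and> (\<forall>V\<in>B. openin X V) \<and>
          (\<forall>U p. openin X U \<and> p \<in> U \<longrightarrow> (\<exists>V\<in>B. p \<in> V \<and> V \<subseteq> U)))"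

text \<open>The atlas \<open>A\<close> need not be maximal; the maximal one is admitted.
  The manifold has dimension \<open>CARD('n)\<close>.\<close>

definition smooth_manifold :: "'m topology \<Rightarrow> ('m, 'n::finite) chart set \<Rightarrow> bool" where
  "smooth_manifold X A \<longleftrightarrow>
     Hausdorff_space X \<and> second_countable_space X \<and>
     (\<Union>c\<in>A. fst c) = topspace X \<and>
     (\<forall>c\<in>A. openin X (fst c) \<and> open (chart_img c) \<and>
        homeomorphic_map (subtopology X (fst c)) (top_of_set (chart_img c)) (snd c)) \<and>
     (\<forall>c\<in>A. \<forall>c'\<in>A. smooth_on (transition c c') (snd c ` (fst c \<inter> fst c')))"

text \<open>A tangent vector at \<open>p\<close> is the family of its component vectors in all charts around \<open>p\<close>,
  which are related by the Jacobians of the transition maps; at other charts the family is \<open>0\<close>.\<close>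

definition tangent_space :: "('m, 'n::finite) chart set \<Rightarrow> 'm \<Rightarrow> (('m, 'n) chart \<Rightarrow> real ^ 'n) set" where
  "tangent_space A p =
     {v. (\<forall>c\<in>A. \<forall>c'\<in>A. p \<in> fst c \<and> p \<in> fst c' \<longrightarrow>
             v c' = frechet_derivative (transition c c') (at (snd c p)) (v c)) \<and>
         (\<forall>c. \<not> (c \<in> A \<and> p \<in> fst c) \<longrightarrow> v c = 0)}"

text \<open>The tangent vector with natural coordinates \<open>(x, y)\<close> with respect to the chart \<open>c\<close>.\<close>

definition coord_vector ::
  "('m, 'n::finite) chart set \<Rightarrow> ('m, 'n) chart \<Rightarrow> real ^ 'n \<Rightarrow> real ^ 'n \<Rightarrow> (('m, 'n) chart \<Rightarrow> real ^ 'n)" where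
  "coord_vector A c x y =
     (\<lambda>c'. if c' \<in> A \<and> chart_inv c x \<in> fst c'
           then frechet_derivative (transition c c') (at x) y else 0)"

text \<open>Functions on \<open>TM\<close> take a point and a tangent vector at that point. The coordinate
  expression of such a function in the natural coordinates \<open>(x, y)\<close> of \<open>c\<close>:\<close>

definition in_chart ::
  "('m, 'n::finite) chart set \<Rightarrow> ('m \<Rightarrow> (('m, 'n) chart \<Rightarrow> real ^ 'n) \<Rightarrow> real) \<Rightarrow> ('m, 'n) chart
     \<Rightarrow> real ^ 'n \<Rightarrow> real ^ 'n \<Rightarrow> real" where
  "in_chart A F c x y = F (chart_inv c x) (coord_vector A c x y)"

definition smooth_function :: "('m, 'n::finite) chart set \<Rightarrow> ('m \<Rightarrow> real) \<Rightarrow> bool" where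
  "smooth_function A \<rho> \<longleftrightarrow> (\<forall>c\<in>A. smooth_on (\<lambda>x. \<rho> (chart_inv c x)) (chart_img c))"


section \<open>Coordinate calculus on the slit tangent bundle\<close>

text \<open>\<open>pd i\<close> is the partial derivative in direction \<open>i\<close>. For functions of natural coordinates
  \<open>(x, y)\<close>, \<open>dx i\<close> and \<open>dy i\<close> are the partial derivatives with respect to \<open>x\<^sup>i\<close> and \<open>y\<^sup>i\<close>.
  In what follows, \<open>L\<close> is the expression of a Finsler metric in natural coordinates.\<close>

definition pd :: "'n::finite \<Rightarrow> (real ^ 'n \<Rightarrow> real) \<Rightarrow> real ^ 'n \<Rightarrow> real" where
  "pd i f x = deriv (\<lambda>t. f (x + t *\<^sub>R axis i 1)) 0"

type_synonym 'n tfun = "real ^ 'n \<Rightarrow> real ^ 'n \<Rightarrow> real"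

definition dx :: "'n::finite \<Rightarrow> 'n tfun \<Rightarrow> 'n tfun" where
  "dx i f x y = pd i (\<lambda>x'. f x' y) x"

definition dy :: "'n::finite \<Rightarrow> 'n tfun \<Rightarrow> 'n tfun" where
  "dy i f x y = pd i (\<lambda>y'. f x y') y"

definition fund_tensor :: "'n::finite tfun \<Rightarrow> 'n \<Rightarrow> 'n \<Rightarrow> 'n tfun" where
  "fund_tensor L i j x y = 1/2 * dy i (dy j (\<lambda>x y. (L x y)\<^sup>2)) x y"

definition fund_matrix :: "'n::finite tfun \<Rightarrow> real ^ 'n \<Rightarrow> real ^ 'n \<Rightarrow> real ^ 'n ^ 'n" where
  "fund_matrix L x y = (\<chi> i j. fund_tensor L i j x y)"

definition fund_inv :: "'n::finite tfun \<Rightarrow> 'n \<Rightarrow> 'n \<Rightarrow> 'n tfun" where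
  "fund_inv L i j x y = matrix_inv (fund_matrix L x y) $ i $ j"

definition y_low :: "'n::finite tfun \<Rightarrow> 'n \<Rightarrow> 'n tfun" where
  "y_low L i x y = (\<Sum>j\<in>UNIV. fund_tensor L i j x y * y $ j)"

definition hilbert_form :: "'n::finite tfun \<Rightarrow> 'n \<Rightarrow> 'n tfun" where
  "hilbert_form L i x y = y_low L i x y / L x y"

definition spray :: "'n::finite tfun \<Rightarrow> 'n \<Rightarrow> 'n tfun" where
  "spray L i x y =
     1/4 * (\<Sum>a\<in>UNIV. \<Sum>b\<in>UNIV. \<Sum>c\<in>UNIV. fund_inv L i c x y *
              (dx a (fund_tensor L c b) x y + dx b (fund_tensor L a c) x y
                - dx c (fund_tensor L a b) x y) * y $ a * y $ b)"

definition hor :: "'n::finite tfun \<Rightarrow> 'n \<Rightarrow> 'n tfun \<Rightarrow> 'n tfun" where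
  "hor L i f x y = dx i f x y - (\<Sum>a\<in>UNIV. dy i (spray L a) x y * dy a f x y)"

definition chern :: "'n::finite tfun \<Rightarrow> 'n \<Rightarrow> 'n \<Rightarrow> 'n \<Rightarrow> 'n tfun" where
  "chern L i j k x y =
     1/2 * (\<Sum>l\<in>UNIV. fund_inv L i l x y *
              (hor L j (fund_tensor L l k) x y + hor L k (fund_tensor L l j) x y
                - hor L l (fund_tensor L j k) x y))"

text \<open>\<open>cov1 L \<theta> i j\<close> is \<open>\<theta>\<^bsub>i|j\<^esub>\<close>; \<open>cov1_0 L \<theta> i\<close> and \<open>cov0_0 L f\<close> are \<open>\<theta>\<^bsub>i|0\<^esub>\<close> and \<open>f\<^bsub>|0\<^esub>\<close>.\<close>

definition cov1 :: "'n::finite tfun \<Rightarrow> ('n \<Rightarrow> 'n tfun) \<Rightarrow> 'n \<Rightarrow> 'n \<Rightarrow> 'n tfun" where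
  "cov1 L \<theta> i j x y = hor L j (\<theta> i) x y - (\<Sum>k\<in>UNIV. chern L k j i x y * \<theta> k x y)"

definition cov1_0 :: "'n::finite tfun \<Rightarrow> ('n \<Rightarrow> 'n tfun) \<Rightarrow> 'n \<Rightarrow> 'n tfun" where
  "cov1_0 L \<theta> i x y = (\<Sum>j\<in>UNIV. cov1 L \<theta> i j x y * y $ j)"

definition cov0_0 :: "'n::finite tfun \<Rightarrow> 'n tfun \<Rightarrow> 'n tfun" where
  "cov0_0 L f x y = (\<Sum>j\<in>UNIV. y $ j * hor L j f x y)"

definition mean_landsberg :: "'n::finite tfun \<Rightarrow> 'n \<Rightarrow> 'n tfun" where
  "mean_landsberg L i x y =
     (\<Sum>a\<in>UNIV. dy i (dy a (spray L a)) x y - chern L a a i x y)"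

definition Ric :: "'n::finite tfun \<Rightarrow> 'n tfun" where
  "Ric L x y =
     2 * (\<Sum>i\<in>UNIV. dx i (spray L i) x y)
     - (\<Sum>i\<in>UNIV. \<Sum>j\<in>UNIV. y $ j * dx j (dy i (spray L i)) x y)
     + 2 * (\<Sum>i\<in>UNIV. \<Sum>j\<in>UNIV. spray L j x y * dy j (dy i (spray L i)) x y)
     - (\<Sum>i\<in>UNIV. \<Sum>j\<in>UNIV. dy j (spray L i) x y * dy i (spray L j) x y)"

definition frakP :: "'n::finite tfun \<Rightarrow> 'n tfun" where
  "frakP L x y =
     (\<Sum>i\<in>UNIV. \<Sum>j\<in>UNIV. fund_inv L i j x y *
        (cov1 L (mean_landsberg L) i j x y
          - mean_landsberg L i x y * mean_landsberg L j x y
          + dy j (cov1_0 L (mean_landsberg L) i) x y))"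


section \<open>Finsler metrics\<close>

definition finsler_metric ::
  "'m topology \<Rightarrow> ('m, 'n::finite) chart set \<Rightarrow> ('m \<Rightarrow> (('m, 'n) chart \<Rightarrow> real ^ 'n) \<Rightarrow> real) \<Rightarrow> bool" where
  "finsler_metric X A F \<longleftrightarrow>
     (\<forall>p\<in>topspace X. \<forall>v\<in>tangent_space A p - {\<lambda>_. 0}.
        F p v > 0 \<and> (\<forall>\<mu>>0. F p (\<lambda>c. \<mu> *\<^sub>R v c) = \<mu> * F p v)) \<and>
     (\<forall>c\<in>A. smooth_on (\<lambda>(x, y). in_chart A F c x y) (chart_img c \<times> (UNIV - {0}))) \<and>
     (\<forall>c\<in>A. \<forall>x\<in>chart_img c. \<forall>y. y \<noteq> 0 \<longrightarrow>
        (\<forall>z. z \<noteq> 0 \<longrightarrow>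
           (\<Sum>i\<in>UNIV. \<Sum>j\<in>UNIV. fund_tensor (in_chart A F c) i j x y * z $ i * z $ j) > 0))"


section \<open>Fiber integrals\<close>

text \<open>\<open>fiber_integral L x f\<close> is the integral over the fiber \<open>(T\<^sub>xM)\<^sup>+\<close> of \<open>f d\<Sigma>\<^sup>+\<^sub>x\<close> for a
  \<open>0\<close>-homogeneous function \<open>f\<close> of \<open>y\<close>. Every ray meets the boundary of the cube \<open>[-1,1]\<^sup>n\<close> exactly
  once, so the faces \<open>{y. y\<^sup>k = \<epsilon>, \<bar>y\<^sup>j\<bar> \<le> 1 for j \<noteq> k}\<close>, with \<open>\<epsilon> = 1\<close> or \<open>\<epsilon> = -1\<close>, parametrize
  the compact pieces of a subdivision of the fiber whose members overlap in null sets only. On such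
  a face \<open>dy\<^sup>k = 0\<close>, so the \<open>(n-1)\<close>-form that represents \<open>d\<Sigma>\<^sup>+\<^sub>x\<close> pulls back to its \<open>k\<close>-th term
  \<open>(det g / F\<^sup>n) (-1)\<^bsup>k-1\<^esup> \<epsilon> dy\<^sup>1 \<and> \<dots> \<and> dy\<^sup>n\<close> (without \<open>dy\<^sup>k\<close>); in the orientation that makes it
  positive, its integral is the Lebesgue integral of \<open>det g / F\<^sup>n\<close> in the coordinates \<open>y\<^sup>j\<close>, \<open>j \<noteq> k\<close>.\<close>

definition face_point :: "'n::finite \<Rightarrow> real \<Rightarrow> ('n \<Rightarrow> real) \<Rightarrow> real ^ 'n" where
  "face_point k \<epsilon> u = (\<chi> j. if j = k then \<epsilon> else u j)"

definition fiber_density :: "'n::finite tfun \<Rightarrow> 'n tfun" where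
  "fiber_density L x y = det (fund_matrix L x y) / L x y ^ CARD('n)"

definition fiber_integral :: "'n::finite tfun \<Rightarrow> real ^ 'n \<Rightarrow> (real ^ 'n \<Rightarrow> real) \<Rightarrow> real" where
  "fiber_integral L x f =
     (\<Sum>k\<in>UNIV. \<Sum>\<epsilon>\<in>{-1, 1}.
        LINT u : (UNIV - {k}) \<rightarrow>\<^sub>E {-1..1} | PiM (UNIV - {k}) (\<lambda>_. lborel).
          f (face_point k \<epsilon> u) * fiber_density L x (face_point k \<epsilon> u))"

text \<open>Components of the average of an \<open>r\<close>-homogeneous anisotropic 1-form \<open>\<theta>\<close>.\<close>

definition fiber_average :: "'n::finite tfun \<Rightarrow> real \<Rightarrow> ('n \<Rightarrow> 'n tfun) \<Rightarrow> real ^ 'n \<Rightarrow> real ^ 'n" where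
  "fiber_average L r \<theta> x =
     (\<chi> i. fiber_integral L x (\<lambda>y. L x y powr (- r) * \<theta> i x y) / fiber_integral L x (\<lambda>y. 1))"

text \<open>Components of \<open>d\<rho>\<close> in the chart \<open>c\<close>.\<close>

definition differential :: "('m \<Rightarrow> real) \<Rightarrow> ('m, 'n::finite) chart \<Rightarrow> real ^ 'n \<Rightarrow> real ^ 'n" where
  "differential \<rho> c x = (\<chi> i. pd i (\<lambda>x'. \<rho> (chart_inv c x')) x)"

end

theory Submission
  imports Defs
begin

text \<open>The identity is obtained at one point \<open>x\<close> of a chart at a time: the integrand differs from a
  multiple of the density of the fiber volume by a vertical divergence, and this divergence integrates
  to zero over the fiber.

  Let \<open>S = y\<^sup>i \<partial>\<^sub>i - 2 G\<^sup>a \<partial>'\<^sub>a\<close> be the geodesic spray, where \<open>\<partial>'\<^sub>a = \<partial>/\<partial>y\<^sup>a\<close>, so that \<open>f\<^bsub>|0\<^esub> = S f\<close>, and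
  let \<open>div\<close> be the divergence with respect to \<open>det g dx dy\<close>. The spray is divergence free; with
  \<open>\<sigma> = 1/2 ln (det g)\<close> this says \<open>S \<sigma> = \<partial>'\<^sub>a G\<^sup>a\<close> (\<open>S_log_density\<close>).

  First, the function \<open>\<PP>\<close> (the German P of the theorem) is a divergence: raising the index of the mean
  Landsberg tensor and taking the complete lift \<open>P\<^sup>c = P\<^sup>i \<partial>\<^sub>i + S(P\<^sup>i) \<partial>'\<^sub>i\<close>, one has
  \<open>\<PP> = div P\<^sup>c\<close> (\<open>frakP_eq\<close>). Since \<open>S\<close> is divergence free, \<open>S \<PP> = div [S, P\<^sup>c]\<close>, and the commutator
  is the vertical field with components \<open>Z = D D P + R P\<close>, the Jacobi operator of the spray, where
  \<open>D\<close> is the covariant derivative along \<open>S\<close> and \<open>R\<close> the curvature (\<open>S_lift_div\<close>, \<open>jacobi_eq\<close>). So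
  \<open>\<PP>\<^bsub>|0\<^esub>\<close> is the vertical divergence of \<open>Z\<close>.

  Second, \<open>P = D I\<close> with \<open>I\<^sub>a = \<partial>'\<^sub>a \<sigma>\<close>. Commuting \<open>S\<close> past the vertical and horizontal derivatives
  and using a traced Bianchi identity of sprays (\<open>trace_curvature_identity\<close>) gives
  \<open>2 Z\<^sub>k = \<partial>\<^sub>k Ric - S(\<partial>'\<^sub>k Ric) - div (D R\<^sub>k)\<close> for the vertical fields \<open>D R\<^sub>k\<close> (\<open>D_D_P_ric\<close>). If
  \<open>Ric = \<rho> F\<^sup>2\<close>, then the first two terms are the Euler-Lagrange expression
  \<open>F\<^sup>2 \<partial>\<^sub>k\<rho> - 2 y\<^sub>k y\<^sup>j \<partial>\<^sub>j\<rho>\<close> (\<open>ric_variation\<close>), because the geodesics are the extremals of \<open>F\<^sup>2\<close>.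

  Third, \<open>y\<^sub>a Z\<^sup>a = 0\<close> and \<open>y\<^sub>a (D R)\<^sup>a\<^sub>k = 0\<close>, so multiplication by powers of \<open>F\<close> and by \<open>y\<^sub>k\<close> does not
  disturb these divergences except for the term \<open>g\<^sub>k\<^sub>a Z\<^sup>a\<close>. The fields \<open>g\<^sup>a\<^sup>j \<partial>'\<^sub>a\<close> are divergence free
  as well, hence \<open>F\<^bsup>-n-2\<^esup> y\<^sub>k y\<^sup>j\<close> and \<open>F\<^bsup>-n\<^esup> \<delta>\<^sup>j\<^sub>k / n\<close> differ by a vertical divergence. Altogether
  \<open>F\<^bsup>-n-2\<^esup> y\<^sub>k \<PP>\<^bsub>|0\<^esub>\<close> equals \<open>- (1/2 - 1/n) F\<^bsup>-n\<^esup> \<partial>\<^sub>k\<rho>\<close> plus the divergence of an explicit vertical field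
  (\<open>vdiv_flux\<close>).

  Finally, that field multiplied by \<open>det g\<close> is homogeneous of degree \<open>1 - n\<close> in \<open>y\<close>, and the
  divergence of such a field integrates to zero over the boundary of the cube that represents the
  fiber (\<open>homogeneous_divergence_theorem\<close>).\<close>

text \<open>Indices range over their whole type; sums over them are written in a form that comes close to
  the summation convention.\<close>

abbreviation (input) contraction :: "('i \<Rightarrow> 'a::comm_monoid_add) \<Rightarrow> 'a" (binder "\<Sum>!" 10) where
  "contraction f \<equiv> sum f UNIV"

section \<open>Calculus of \<open>C\<^sup>k\<close> functions\<close>

lemma Ck_on_Suc_has_derivative:
  assumes "Ck_on (Suc k) f S" "x \<in> S"
  shows "(f has_derivative frechet_derivative f (at x)) (at x)"
proof -
  have "f differentiable (at x)" using assms unfolding Ck_on.simps by blast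
  then show ?thesis by (rule frechet_derivative_works[THEN iffD1])
qed

text \<open>The definition mentions the values of a function on all of the space through its derivatives; on
  an open set only the values there matter.\<close>

lemma Ck_on_cong:
  assumes "open S" "\<And>x. x \<in> S \<Longrightarrow> f x = g x" "Ck_on k f S"
  shows "Ck_on k g S"
  using assms(2,3)
proof (induction k arbitrary: f g)
  case 0
  then show ?case using continuous_on_cong[of S S f g] by simp
next
  case (Suc k)
  have d: "(g has_derivative frechet_derivative f (at x)) (at x)" if "x \<in> S" for x
  proof -
    have "(f has_derivative frechet_derivative f (at x)) (at x)"
      by (rule Ck_on_Suc_has_derivative[OF Suc.prems(2) that])
    then show ?thesis
      by (rule has_derivative_transform_within_open[OF _ assms(1) that]) (rule Suc.prems(1))
  qed
  have "frechet_derivative g (at x) = frechet_derivative f (at x)" if "x \<in> S" for x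
    using frechet_derivative_at[OF d[OF that]] by simp
  moreover have "Ck_on k (\<lambda>x. frechet_derivative f (at x) v) S" for v
    using Suc.prems(2) unfolding Ck_on.simps by blast
  ultimately have "Ck_on k (\<lambda>x. frechet_derivative g (at x) v) S" for v
    by - (rule Suc.IH[rotated], assumption, simp)
  moreover have "\<forall>x\<in>S. g differentiable (at x)"
    using differentiableI[OF d] by blast
  ultimately show ?case unfolding Ck_on.simps by blast
qed

lemma Ck_on_SucI:
  assumes "open S" "\<And>x. x \<in> S \<Longrightarrow> (f has_derivative f' x) (at x)" "\<And>v. Ck_on k (\<lambda>x. f' x v) S"
  shows "Ck_on (Suc k) f S"
proof -
  have "f' x = frechet_derivative f (at x)" if "x \<in> S" for x
    using frechet_derivative_at[OF assms(2)[OF that]] by simp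
  then have "Ck_on k (\<lambda>x. frechet_derivative f (at x) v) S" for v
    by - (rule Ck_on_cong[OF assms(1) _ assms(3)[of v]], simp)
  moreover have "\<forall>x\<in>S. f differentiable (at x)"
    using differentiableI[OF assms(2)] by blast
  ultimately show ?thesis unfolding Ck_on.simps by blast
qed

lemma Ck_on_lower: "Ck_on (Suc k) f S \<Longrightarrow> Ck_on k f S"
proof (induction k arbitrary: f)
  case 0
  then show ?case
    by (auto intro!: continuous_at_imp_continuous_on differentiable_imp_continuous_within)
next
  case (Suc k)
  have "Ck_on k (\<lambda>x. frechet_derivative f (at x) v) S" for v
    by (rule Suc.IH) (use Suc.prems in \<open>unfold Ck_on.simps(2)[of "Suc k"], blast\<close>)
  moreover have "\<forall>x\<in>S. f differentiable (at x)"
    using Suc.prems unfolding Ck_on.simps(2)[of "Suc k"] by blast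
  ultimately show ?case unfolding Ck_on.simps by blast
qed

lemma Ck_on_const: "open S \<Longrightarrow> Ck_on k (\<lambda>x. c) S"
proof (induction k arbitrary: c)
  case (Suc k)
  then show ?case by (intro Ck_on_SucI[where f' = "\<lambda>x v. 0"]) auto
qed simp

lemma Ck_on_bounded_linear: "open S \<Longrightarrow> bounded_linear f \<Longrightarrow> Ck_on k f S"
proof (cases k)
  case (Suc j)
  assume "open S" "bounded_linear f"
  then show ?thesis unfolding Suc
    by (intro Ck_on_SucI[where f' = "\<lambda>x. f"] Ck_on_const) (auto intro: bounded_linear_imp_has_derivative)
qed (simp add: linear_continuous_on)

lemma Ck_on_add:
  assumes "open S" "Ck_on k f S" "Ck_on k g S"
  shows "Ck_on k (\<lambda>x. f x + g x) S"
  using assms(2,3)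
proof (induction k arbitrary: f g)
  case 0
  then show ?case by (auto intro: continuous_on_add)
next
  case (Suc k)
  show ?case
    using Suc.prems
    by (intro Ck_on_SucI[OF assms(1) has_derivative_add[OF Ck_on_Suc_has_derivative Ck_on_Suc_has_derivative]] Suc.IH) auto
qed

lemma Ck_on_mult:
  fixes f g :: "'a::euclidean_space \<Rightarrow> real"
  assumes "open S" "Ck_on k f S" "Ck_on k g S"
  shows "Ck_on k (\<lambda>x. f x * g x) S"
  using assms(2,3)
proof (induction k arbitrary: f g)
  case 0
  then show ?case by (auto intro: continuous_on_mult)
next
  case (Suc k)
  show ?case
    using Suc.prems
    by (intro Ck_on_SucI[OF assms(1) has_derivative_mult[OF Ck_on_Suc_has_derivative Ck_on_Suc_has_derivative]]
        Ck_on_add Suc.IH Ck_on_lower[of k f] Ck_on_lower[of k g] assms(1)) auto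
qed

lemma Ck_on_inverse:
  fixes f :: "'a::euclidean_space \<Rightarrow> real"
  assumes "open S" "Ck_on k f S" "\<And>x. x \<in> S \<Longrightarrow> f x \<noteq> 0"
  shows "Ck_on k (\<lambda>x. inverse (f x)) S"
  using assms(2)
proof (induction k)
  case 0
  then show ?case using assms(3) by (auto intro: continuous_on_inverse)
next
  case (Suc k)
  have i: "Ck_on k (\<lambda>x. inverse (f x)) S"
    by (rule Suc.IH[OF Ck_on_lower[OF Suc.prems]])
  have "Ck_on k (\<lambda>x. frechet_derivative f (at x) v) S" for v
    using Suc.prems by simp
  then have "Ck_on k (\<lambda>x. (- 1) * (inverse (f x) * frechet_derivative f (at x) v * inverse (f x))) S" for v
    by (intro Ck_on_mult Ck_on_const i assms(1))
  then show ?case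
    using assms(3) Suc.prems
    by (intro Ck_on_SucI[OF assms(1) Deriv.has_derivative_inverse[OF _ Ck_on_Suc_has_derivative]]) auto
qed

lemma Ck_on_ln:
  fixes f :: "'a::euclidean_space \<Rightarrow> real"
  assumes "open S" "Ck_on k f S" "\<And>x. x \<in> S \<Longrightarrow> f x > 0"
  shows "Ck_on k (\<lambda>x. ln (f x)) S"
proof (cases k)
  case 0
  with assms show ?thesis by (auto intro!: continuous_on_ln simp: less_imp_neq[THEN not_sym])
next
  case (Suc j)
  have "Ck_on j (\<lambda>x. frechet_derivative f (at x) v) S" for v
    using assms(2) Suc by simp
  then have "Ck_on j (\<lambda>x. frechet_derivative f (at x) v * inverse (f x)) S" for v
    using assms(3) Ck_on_lower[of j f] assms(2) Suc
    by (intro Ck_on_mult Ck_on_inverse assms(1)) (auto simp: less_imp_neq[THEN not_sym])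
  then show ?thesis
    unfolding Suc using assms(3) assms(2) Suc
    by (intro Ck_on_SucI[OF assms(1), where f' = "\<lambda>x v. frechet_derivative f (at x) v * inverse (f x)"])
      (auto intro!: derivative_eq_intros Ck_on_Suc_has_derivative[of j] simp: fun_eq_iff field_simps)
qed

lemma smooth_on_frechet: "smooth_on f S \<Longrightarrow> smooth_on (\<lambda>x. frechet_derivative f (at x) v) S"
  unfolding smooth_on_def by (metis Ck_on.simps(2))

lemma smooth_on_has_derivative:
  "smooth_on f S \<Longrightarrow> x \<in> S \<Longrightarrow> (f has_derivative frechet_derivative f (at x)) (at x)"
  unfolding smooth_on_def using Ck_on_Suc_has_derivative by blast

text \<open>The mean value theorem applied twice, first in direction \<open>u\<close> and then in direction \<open>v\<close>. The second
  difference on the left is symmetric in \<open>u\<close> and \<open>v\<close>, which is why mixed derivatives commute.\<close>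

lemma second_difference_mean_value:
  fixes F :: "'a::euclidean_space \<Rightarrow> real"
  assumes F: "smooth_on F S" and h: "h > 0"
    and sub: "\<And>s t. 0 \<le> s \<Longrightarrow> s \<le> h \<Longrightarrow> 0 \<le> t \<Longrightarrow> t \<le> h \<Longrightarrow> x + s *\<^sub>R u + t *\<^sub>R v \<in> S"
  obtains s t where "0 \<le> s" "s \<le> h" "0 \<le> t" "t \<le> h"
    "F (x + h *\<^sub>R u + h *\<^sub>R v) - F (x + h *\<^sub>R u) - F (x + h *\<^sub>R v) + F x
      = h * h * frechet_derivative (\<lambda>z. frechet_derivative F (at z) u) (at (x + s *\<^sub>R u + t *\<^sub>R v)) v"
proof -
  define D :: "('a \<Rightarrow> real) \<Rightarrow> 'a \<Rightarrow> 'a \<Rightarrow> real" where "D = (\<lambda>F z. frechet_derivative F (at z))"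
  have du: "((\<lambda>s. F (x + s *\<^sub>R u + t *\<^sub>R v)) has_real_derivative D F (x + s *\<^sub>R u + t *\<^sub>R v) u) (at s)"
    if "0 \<le> s" "s \<le> h" "0 \<le> t" "t \<le> h" for s t
  proof -
    have "((\<lambda>s. F (x + s *\<^sub>R u + t *\<^sub>R v)) has_derivative (\<lambda>r. D F (x + s *\<^sub>R u + t *\<^sub>R v) (r *\<^sub>R u))) (at s)"
      unfolding D_def
      by (rule has_derivative_compose[of "\<lambda>s. x + s *\<^sub>R u + t *\<^sub>R v"  "\<lambda>r. r *\<^sub>R u" _ _ F])
        (auto intro!: derivative_eq_intros smooth_on_has_derivative[OF F] sub that)
    then show ?thesis
      using linear_cmul[OF has_derivative_linear[OF smooth_on_has_derivative[OF F sub[OF that]]]]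
      by (simp add: has_field_derivative_def D_def mult_commute_abs)
  qed
  have dv: "((\<lambda>t. D F (x + s *\<^sub>R u + t *\<^sub>R v) u) has_real_derivative
        D (\<lambda>z. D F z u) (x + s *\<^sub>R u + t *\<^sub>R v) v) (at t)"
    if "0 \<le> s" "s \<le> h" "0 \<le> t" "t \<le> h" for s t
  proof -
    have F': "smooth_on (\<lambda>z. D F z u) S"
      using smooth_on_frechet[OF F] by (simp add: D_def)
    have "((\<lambda>t. (\<lambda>z. D F z u) (x + s *\<^sub>R u + t *\<^sub>R v)) has_derivative
        (\<lambda>r. D (\<lambda>z. D F z u) (x + s *\<^sub>R u + t *\<^sub>R v) (r *\<^sub>R v))) (at t)"
      unfolding D_def
      by (rule has_derivative_compose[of "\<lambda>t. x + s *\<^sub>R u + t *\<^sub>R v" "\<lambda>r. r *\<^sub>R v" _ _ "\<lambda>z. frechet_derivative F (at z) u"])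
        (auto intro!: derivative_eq_intros smooth_on_has_derivative[OF F'[unfolded D_def]] sub that)
    then show ?thesis
      using linear_cmul[OF has_derivative_linear[OF smooth_on_has_derivative[OF F' sub[OF that]]]]
      by (simp add: has_field_derivative_def D_def mult_commute_abs)
  qed
  let ?\<phi> = "\<lambda>s. F (x + s *\<^sub>R u + h *\<^sub>R v) - F (x + s *\<^sub>R u + 0 *\<^sub>R v)"
  let ?\<phi>' = "\<lambda>s. D F (x + s *\<^sub>R u + h *\<^sub>R v) u - D F (x + s *\<^sub>R u + 0 *\<^sub>R v) u"
  have "\<exists>s>0. s < h \<and> ?\<phi> h - ?\<phi> 0 = (h - 0) * ?\<phi>' s"
    using h by (intro MVT2 DERIV_diff du) auto
  then obtain s where s: "0 < s" "s < h" "?\<phi> h - ?\<phi> 0 = h * ?\<phi>' s" by auto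
  have "\<exists>t>0. t < h \<and> D F (x + s *\<^sub>R u + h *\<^sub>R v) u - D F (x + s *\<^sub>R u + 0 *\<^sub>R v) u
      = (h - 0) * D (\<lambda>z. D F z u) (x + s *\<^sub>R u + t *\<^sub>R v) v"
    using h s(1,2) by (intro MVT2 dv) auto
  then obtain t where t: "0 < t" "t < h" "?\<phi>' s = h * D (\<lambda>z. D F z u) (x + s *\<^sub>R u + t *\<^sub>R v) v" by auto
  show ?thesis
    using s t by (intro that[of s t]) (auto simp: D_def)
qed

lemma frechet_derivative_commute:
  fixes F :: "'a::euclidean_space \<Rightarrow> real"
  assumes S: "open S" "x \<in> S" and F: "smooth_on F S"
  shows "frechet_derivative (\<lambda>z. frechet_derivative F (at z) u) (at x) v
    = frechet_derivative (\<lambda>z. frechet_derivative F (at z) v) (at x) u" (is "?A x = ?B x")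
proof (rule ccontr)
  assume "?A x \<noteq> ?B x"
  define e where "e = \<bar>?A x - ?B x\<bar> / 2"
  have e: "e > 0" using \<open>?A x \<noteq> ?B x\<close> by (simp add: e_def)
  have "continuous_on S ?A" "continuous_on S ?B"
    using smooth_on_frechet[OF smooth_on_frechet[OF F]] unfolding smooth_on_def by (metis Ck_on.simps(1))+
  then have "continuous (at x) ?A" "continuous (at x) ?B"
    using S by (auto simp: continuous_on_eq_continuous_at)
  then obtain d1 d2 where d: "d1 > 0" "\<And>z. dist z x < d1 \<Longrightarrow> dist (?A z) (?A x) < e"
    "d2 > 0" "\<And>z. dist z x < d2 \<Longrightarrow> dist (?B z) (?B x) < e"
    using e unfolding continuous_at_eps_delta by metis
  obtain d3 where d3: "d3 > 0" "ball x d3 \<subseteq> S" using S open_contains_ball by blast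
  \<comment> \<open>A square with sides \<open>h u\<close> and \<open>h v\<close> that fits into all three balls.\<close>
  define r where "r = min d1 (min d2 d3)"
  have r: "r > 0" using d d3 by (auto simp: r_def)
  define h where "h = r / (norm u + norm v + 1)"
  have pos: "norm u + norm v + 1 > 0"
    using norm_ge_zero[of u] norm_ge_zero[of v] by linarith
  have h: "h > 0" using r pos by (simp add: h_def)
  have near: "dist (x + s *\<^sub>R u + t *\<^sub>R v) x < r" if "0 \<le> s" "s \<le> h" "0 \<le> t" "t \<le> h" for s t
  proof -
    have "dist (x + s *\<^sub>R u + t *\<^sub>R v) x = norm (s *\<^sub>R u + t *\<^sub>R v)" by (simp add: dist_norm add.assoc)
    also have "\<dots> \<le> s * norm u + t * norm v" using norm_triangle_ineq[of "s *\<^sub>R u" "t *\<^sub>R v"] that by simp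
    also have "\<dots> \<le> h * norm u + h * norm v" using that by (intro add_mono mult_right_mono) auto
    also have "\<dots> < h * (norm u + norm v + 1)" using h by (simp add: algebra_simps)
    also have "\<dots> = r" using pos by (simp add: h_def)
    finally show ?thesis .
  qed
  have inS: "x + s *\<^sub>R u + t *\<^sub>R v \<in> S" if "0 \<le> s" "s \<le> h" "0 \<le> t" "t \<le> h" for s t
    using near[OF that] d3 by (auto simp: r_def dist_commute)
  have inS': "x + s *\<^sub>R v + t *\<^sub>R u \<in> S" if "0 \<le> s" "s \<le> h" "0 \<le> t" "t \<le> h" for s t
    using inS[OF that(3,4,1,2)] by (simp add: algebra_simps)
  obtain s t where st: "0 \<le> s" "s \<le> h" "0 \<le> t" "t \<le> h"
    "F (x + h *\<^sub>R u + h *\<^sub>R v) - F (x + h *\<^sub>R u) - F (x + h *\<^sub>R v) + F x = h * h * ?A (x + s *\<^sub>R u + t *\<^sub>R v)"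
    using second_difference_mean_value[OF F h inS] by blast
  obtain s' t' where st': "0 \<le> s'" "s' \<le> h" "0 \<le> t'" "t' \<le> h"
    "F (x + h *\<^sub>R v + h *\<^sub>R u) - F (x + h *\<^sub>R v) - F (x + h *\<^sub>R u) + F x = h * h * ?B (x + s' *\<^sub>R v + t' *\<^sub>R u)"
    using second_difference_mean_value[OF F h inS'] by blast
  have "h * h * ?A (x + s *\<^sub>R u + t *\<^sub>R v) = h * h * ?B (x + s' *\<^sub>R v + t' *\<^sub>R u)"
    using st(5) st'(5) by (simp add: algebra_simps)
  then have eq: "?A (x + s *\<^sub>R u + t *\<^sub>R v) = ?B (x + s' *\<^sub>R v + t' *\<^sub>R u)" using h by simp
  have "dist (?A (x + s *\<^sub>R u + t *\<^sub>R v)) (?A x) < e"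
    using near[OF st(1-4)] by (intro d) (auto simp: r_def)
  moreover have "dist (?B (x + s' *\<^sub>R v + t' *\<^sub>R u)) (?B x) < e"
    using near[OF st'(3,4,1,2)] by (intro d) (auto simp: r_def algebra_simps)
  ultimately show False using eq by (auto simp: dist_real_def e_def abs_if split: if_splits)
qed

section \<open>Derivations of smooth functions on the slit tangent bundle\<close>

text \<open>\<open>\<Omega>\<close> is the image of a chart. Identities are claimed, and smoothness (the predicate \<open>sm\<close>) is
  required, only for \<open>x \<in> \<Omega>\<close> and \<open>y \<noteq> 0\<close>.\<close>

locale slit_domain =
  fixes \<Omega> :: "(real ^ 'n::finite) set"
  assumes open_base: "open \<Omega>"
begin

definition sm :: "'n tfun \<Rightarrow> bool" where
  "sm f \<longleftrightarrow> smooth_on (\<lambda>(x, y). f x y) (\<Omega> \<times> (UNIV - {0}))"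

lemma open_slit: "open (\<Omega> \<times> (UNIV - {0 :: real ^ 'n}))"
  by (intro open_Times open_base) auto

lemma sm_iff: "sm f \<longleftrightarrow> smooth_on (\<lambda>p. f (fst p) (snd p)) (\<Omega> \<times> (UNIV - {0}))"
  by (simp only: sm_def case_prod_beta')

lemma sm_cong:
  assumes "sm f" "\<And>x y. x \<in> \<Omega> \<Longrightarrow> y \<noteq> 0 \<Longrightarrow> f x y = g x y"
  shows "sm g"
  unfolding sm_iff smooth_on_def
proof
  fix k
  show "Ck_on k (\<lambda>p. g (fst p) (snd p)) (\<Omega> \<times> (UNIV - {0}))"
  proof (rule Ck_on_cong[OF open_slit, of "\<lambda>p. f (fst p) (snd p)"])
    show "Ck_on k (\<lambda>p. f (fst p) (snd p)) (\<Omega> \<times> (UNIV - {0}))"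
      using assms(1) by (simp add: sm_iff smooth_on_def)
  qed (auto intro!: assms(2))
qed

lemma sm_const [simp]: "sm (\<lambda>x y. c)"
  using Ck_on_const[OF open_slit, of _ c] by (simp add: sm_iff smooth_on_def)

lemma sm_fiber_coord [simp]: "sm (\<lambda>x y. y $ j)"
  using Ck_on_bounded_linear[OF open_slit, of "\<lambda>p. snd p $ j"]
  by (simp add: sm_iff smooth_on_def bounded_linear_vec_nth bounded_linear_compose[OF bounded_linear_vec_nth bounded_linear_snd, unfolded o_def])

lemma sm_add [simp]: "sm f \<Longrightarrow> sm g \<Longrightarrow> sm (\<lambda>x y. f x y + g x y)"
  using Ck_on_add[OF open_slit, of _ "\<lambda>p. f (fst p) (snd p)" "\<lambda>p. g (fst p) (snd p)"]
  by (simp add: sm_iff smooth_on_def)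

lemma sm_mult [simp]: "sm f \<Longrightarrow> sm g \<Longrightarrow> sm (\<lambda>x y. f x y * g x y)"
  using Ck_on_mult[OF open_slit, of _ "\<lambda>p. f (fst p) (snd p)" "\<lambda>p. g (fst p) (snd p)"]
  by (simp add: sm_iff smooth_on_def)

lemma sm_inverse: "sm f \<Longrightarrow> (\<And>x y. x \<in> \<Omega> \<Longrightarrow> y \<noteq> 0 \<Longrightarrow> f x y \<noteq> 0) \<Longrightarrow> sm (\<lambda>x y. inverse (f x y))"
  using Ck_on_inverse[OF open_slit, of _ "\<lambda>p. f (fst p) (snd p)"]
  by (auto simp add: sm_iff smooth_on_def)

lemma sm_ln: "sm f \<Longrightarrow> (\<And>x y. x \<in> \<Omega> \<Longrightarrow> y \<noteq> 0 \<Longrightarrow> f x y > 0) \<Longrightarrow> sm (\<lambda>x y. ln (f x y))"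
  using Ck_on_ln[OF open_slit, of _ "\<lambda>p. f (fst p) (snd p)"]
  by (auto simp add: sm_iff smooth_on_def)

lemma sm_minus [simp]: "sm f \<Longrightarrow> sm (\<lambda>x y. - f x y)"
  using sm_mult[OF sm_const[of "-1"], of f] by simp

lemma sm_diff [simp]: "sm f \<Longrightarrow> sm g \<Longrightarrow> sm (\<lambda>x y. f x y - g x y)"
  using sm_add[OF _ sm_minus, of f g] by simp

lemma sm_divide_const [simp]: "sm f \<Longrightarrow> sm (\<lambda>x y. f x y / c)"
  using sm_mult[OF _ sm_const[of "inverse c"], of f] by (simp add: divide_inverse)

lemma sm_sum [simp]: "(\<And>i. i \<in> I \<Longrightarrow> sm (f i)) \<Longrightarrow> sm (\<lambda>x y. \<Sum>i\<in>I. f i x y)"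
  by (induction I rule: infinite_finite_induct) auto

lemma sm_prod: "(\<And>i. i \<in> I \<Longrightarrow> sm (f i)) \<Longrightarrow> sm (\<lambda>x y. \<Prod>i\<in>I. f i x y)"
  by (induction I rule: infinite_finite_induct) auto

lemma sm_power [simp]: "sm f \<Longrightarrow> sm (\<lambda>x y. f x y ^ k)"
  by (induction k) auto

text \<open>Partial derivatives, the spray, the horizontal frame and the Euler field obey the same rules, so
  these are proved once. The last clause makes \<open>d\<close> depend on the values over the slit domain only, so
  that identities valid there may be differentiated. The chain rule is needed for the logarithm alone,
  namely for \<open>ln (det g)\<close>.\<close>

definition derivation :: "('n tfun \<Rightarrow> 'n tfun) \<Rightarrow> bool" where
  "derivation d \<longleftrightarrow>
     (\<forall>f. sm f \<longrightarrow> sm (d f)) \<and>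
     (\<forall>c x y. x \<in> \<Omega> \<longrightarrow> y \<noteq> 0 \<longrightarrow> d (\<lambda>x y. c) x y = 0) \<and>
     (\<forall>f g x y. sm f \<longrightarrow> sm g \<longrightarrow> x \<in> \<Omega> \<longrightarrow> y \<noteq> 0 \<longrightarrow>
        d (\<lambda>x y. f x y + g x y) x y = d f x y + d g x y \<and>
        d (\<lambda>x y. f x y * g x y) x y = d f x y * g x y + f x y * d g x y) \<and>
     (\<forall>f x y. sm f \<longrightarrow> (\<forall>x\<in>\<Omega>. \<forall>y. y \<noteq> 0 \<longrightarrow> f x y > 0) \<longrightarrow> x \<in> \<Omega> \<longrightarrow> y \<noteq> 0 \<longrightarrow>
        d (\<lambda>x y. ln (f x y)) x y = d f x y / f x y) \<and>
     (\<forall>f g x y. sm f \<longrightarrow> (\<forall>x\<in>\<Omega>. \<forall>y. y \<noteq> 0 \<longrightarrow> f x y = g x y) \<longrightarrow> x \<in> \<Omega> \<longrightarrow> y \<noteq> 0 \<longrightarrow> d g x y = d f x y)"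

context
  fixes d
  assumes d: "derivation d"
begin

lemma derivation_sm: "sm f \<Longrightarrow> sm (d f)"
  using d unfolding derivation_def by blast

lemma derivation_const: "x \<in> \<Omega> \<Longrightarrow> y \<noteq> 0 \<Longrightarrow> d (\<lambda>x y. c) x y = 0"
  using d unfolding derivation_def by blast

lemma derivation_add:
  "sm f \<Longrightarrow> sm g \<Longrightarrow> x \<in> \<Omega> \<Longrightarrow> y \<noteq> 0 \<Longrightarrow> d (\<lambda>x y. f x y + g x y) x y = d f x y + d g x y"
  using d unfolding derivation_def by blast

lemma derivation_mult:
  "sm f \<Longrightarrow> sm g \<Longrightarrow> x \<in> \<Omega> \<Longrightarrow> y \<noteq> 0 \<Longrightarrow> d (\<lambda>x y. f x y * g x y) x y = d f x y * g x y + f x y * d g x y"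
  using d unfolding derivation_def by blast

lemma derivation_ln:
  "sm f \<Longrightarrow> \<forall>x\<in>\<Omega>. \<forall>y. y \<noteq> 0 \<longrightarrow> f x y > 0 \<Longrightarrow> x \<in> \<Omega> \<Longrightarrow> y \<noteq> 0 \<Longrightarrow> d (\<lambda>x y. ln (f x y)) x y = d f x y / f x y"
  using d unfolding derivation_def by blast

lemma derivation_divide_const:
  "sm f \<Longrightarrow> x \<in> \<Omega> \<Longrightarrow> y \<noteq> 0 \<Longrightarrow> d (\<lambda>x y. f x y / c) x y = d f x y / c"
  using derivation_mult[of f "\<lambda>x y. inverse c" x y] by (simp add: derivation_const divide_inverse)

lemma derivation_cong:
  assumes "sm f" "\<And>x y. x \<in> \<Omega> \<Longrightarrow> y \<noteq> 0 \<Longrightarrow> g x y = f x y" "x \<in> \<Omega>" "y \<noteq> 0"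
  shows "d g x y = d f x y"
proof -
  have "\<forall>x\<in>\<Omega>. \<forall>y. y \<noteq> 0 \<longrightarrow> f x y = g x y" using assms(2) by simp
  then show ?thesis using d assms(1,3,4) unfolding derivation_def by blast
qed

lemma derivation_minus:
  "sm f \<Longrightarrow> x \<in> \<Omega> \<Longrightarrow> y \<noteq> 0 \<Longrightarrow> d (\<lambda>x y. - f x y) x y = - d f x y"
  using derivation_mult[of "\<lambda>x y. -1" f x y] by (simp add: derivation_const)

lemma derivation_diff:
  "sm f \<Longrightarrow> sm g \<Longrightarrow> x \<in> \<Omega> \<Longrightarrow> y \<noteq> 0 \<Longrightarrow> d (\<lambda>x y. f x y - g x y) x y = d f x y - d g x y"
  using derivation_add[of f "\<lambda>x y. - g x y" x y] by (simp add: derivation_minus)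

lemma derivation_sum:
  "(\<And>i. i \<in> I \<Longrightarrow> sm (f i)) \<Longrightarrow> x \<in> \<Omega> \<Longrightarrow> y \<noteq> 0 \<Longrightarrow>
     d (\<lambda>x y. \<Sum>i\<in>I. f i x y) x y = (\<Sum>i\<in>I. d (f i) x y)"
  by (induction I rule: infinite_finite_induct) (simp_all add: derivation_const derivation_add)

lemma derivation_power:
  "sm f \<Longrightarrow> x \<in> \<Omega> \<Longrightarrow> y \<noteq> 0 \<Longrightarrow>
     d (\<lambda>x y. f x y ^ k) x y = real k * f x y ^ (k - 1) * d f x y"
proof (induction k)
  case (Suc k)
  then show ?case
    by (cases k) (simp_all add: derivation_mult algebra_simps)
qed (simp add: derivation_const)

lemma derivation_inverse:
  assumes f: "sm f" "\<And>x y. x \<in> \<Omega> \<Longrightarrow> y \<noteq> 0 \<Longrightarrow> f x y \<noteq> 0" and x: "x \<in> \<Omega>" "y \<noteq> 0"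
  shows "d (\<lambda>x y. inverse (f x y)) x y = - d f x y / (f x y)\<^sup>2"
proof -
  have "d (\<lambda>x y. f x y * inverse (f x y)) x y = d (\<lambda>x y. 1) x y"
    using f by (intro derivation_cong x) auto
  then have "d f x y * inverse (f x y) + f x y * d (\<lambda>x y. inverse (f x y)) x y = 0"
    using x f by (simp only: derivation_const derivation_mult sm_inverse not_False_eq_True simp_thms)
  then show ?thesis
    using f(2)[OF x] by (simp add: field_simps power2_eq_square)
qed

end

definition dir :: "(real ^ 'n) \<times> (real ^ 'n) \<Rightarrow> 'n tfun \<Rightarrow> 'n tfun" where
  "dir w f x y = frechet_derivative (\<lambda>p. f (fst p) (snd p)) (at (x, y)) w"

lemma sm_has_derivative:
  "sm f \<Longrightarrow> x \<in> \<Omega> \<Longrightarrow> y \<noteq> 0 \<Longrightarrow> ((\<lambda>p. f (fst p) (snd p)) has_derivative (\<lambda>w. dir w f x y)) (at (x, y))"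
  unfolding dir_def sm_iff by (rule smooth_on_has_derivative) auto

lemma dir_eqI:
  "((\<lambda>p. f (fst p) (snd p)) has_derivative f') (at (x, y)) \<Longrightarrow> dir w f x y = f' w"
  by (metis dir_def frechet_derivative_at)

lemma derivation_dir: "derivation (dir w)"
  unfolding derivation_def
proof (intro conjI allI impI)
  show "sm (dir w f)" if "sm f" for f
    using smooth_on_frechet[OF that[unfolded sm_iff], of w]
    by (simp add: sm_iff dir_def)
next
  fix c :: real and x y :: "real ^ 'n"
  show "dir w (\<lambda>x y. c) x y = 0" by (rule dir_eqI) simp
next
  fix f g :: "'n tfun" and x y :: "real ^ 'n"
  assume *: "sm f" "sm g" "x \<in> \<Omega>" "y \<noteq> 0"
  note df = sm_has_derivative[OF *(1,3,4)]
    and dg = sm_has_derivative[OF *(2,3,4)]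
  show "dir w (\<lambda>x y. f x y + g x y) x y = dir w f x y + dir w g x y"
    by (rule dir_eqI) (rule has_derivative_add[OF df dg])
  show "dir w (\<lambda>x y. f x y * g x y) x y = dir w f x y * g x y + f x y * dir w g x y"
    using dir_eqI[of "\<lambda>x y. f x y * g x y", OF has_derivative_mult[OF df dg], of w]
    by simp
next
  fix f :: "'n tfun" and x y :: "real ^ 'n"
  assume *: "sm f" "\<forall>x\<in>\<Omega>. \<forall>y. y \<noteq> 0 \<longrightarrow> f x y > 0" "x \<in> \<Omega>" "y \<noteq> 0"
  have "((\<lambda>p. ln (f (fst p) (snd p))) has_derivative (\<lambda>w. dir w f x y * inverse (f x y))) (at (x, y))"
    using has_derivative_ln[OF _ sm_has_derivative[OF *(1,3,4)]] *(2-4) by simp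
  then show "dir w (\<lambda>x y. ln (f x y)) x y = dir w f x y / f x y"
    using dir_eqI[of "\<lambda>x y. ln (f x y)"] by (simp add: divide_inverse)
next
  fix f g :: "'n tfun" and x y :: "real ^ 'n"
  assume *: "sm f" "\<forall>x\<in>\<Omega>. \<forall>y. y \<noteq> 0 \<longrightarrow> f x y = g x y" "x \<in> \<Omega>" "y \<noteq> 0"
  show "dir w g x y = dir w f x y"
  proof (rule dir_eqI, rule has_derivative_transform_within_open[OF sm_has_derivative[OF *(1,3,4)] open_slit])
    fix p assume "p \<in> \<Omega> \<times> (UNIV - {0 :: real ^ 'n})"
    then have "fst p \<in> \<Omega>" "snd p \<noteq> 0" by auto
    then show "f (fst p) (snd p) = g (fst p) (snd p)" using *(2) by blast
  qed (use *(3,4) in auto)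
qed

text \<open>The partial derivatives are limits of difference quotients and agree with directional
  Frechet derivatives at smooth functions only; this suffices to inherit the rules.\<close>

lemma derivation_transfer:
  fixes d' :: "'n tfun \<Rightarrow> 'n tfun"
  assumes "derivation d" "\<And>f x y. sm f \<Longrightarrow> x \<in> \<Omega> \<Longrightarrow> y \<noteq> 0 \<Longrightarrow> d' f x y = d f x y"
  shows "derivation d'"
  unfolding derivation_def
proof (intro conjI allI impI)
  show "sm (d' f)" if "sm f" for f
    by (rule sm_cong[OF derivation_sm[OF assms(1) that]]) (simp add: assms(2) that)
next
  fix f g :: "'n tfun" and x y :: "real ^ 'n"
  assume *: "sm f" "\<forall>x\<in>\<Omega>. \<forall>y. y \<noteq> 0 \<longrightarrow> f x y = g x y" "x \<in> \<Omega>" "y \<noteq> 0"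
  have "sm g" by (rule sm_cong[OF *(1)]) (use *(2) in auto)
  then show "d' g x y = d' f x y"
    using * by (simp add: assms(2)) (rule derivation_cong[OF assms(1)], auto)
qed (simp_all add: assms(2) derivation_const[OF assms(1)] derivation_add[OF assms(1)] derivation_mult[OF assms(1)]
    derivation_ln[OF assms(1)] sm_ln)

lemma dx_has_derivative:
  fixes i :: 'n
  assumes "sm f" "x \<in> \<Omega>" "y \<noteq> 0"
  shows "((\<lambda>t. f (x + t *\<^sub>R axis i 1) y) has_real_derivative dir (axis i 1, 0) f x y) (at 0)"
proof -
  note d = sm_has_derivative[OF assms]
  have "((\<lambda>t. (\<lambda>p. f (fst p) (snd p)) (x + t *\<^sub>R axis i 1, y)) has_derivative (\<lambda>t. dir (t *\<^sub>R axis i 1, 0) f x y)) (at 0)"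
    by (rule has_derivative_compose[of "\<lambda>t. (x + t *\<^sub>R axis i 1, y)" "\<lambda>t. (t *\<^sub>R axis i 1, 0)"])
      (use d in \<open>auto intro!: derivative_eq_intros\<close>)
  moreover have "dir (t *\<^sub>R axis i 1, 0) f x y = t * dir (axis i 1, 0) f x y" for t
    using linear_cmul[OF has_derivative_linear[OF d], of t "(axis i 1, 0)"] by simp
  ultimately show ?thesis by (simp add: has_field_derivative_def mult_commute_abs)
qed

lemma dy_has_derivative:
  fixes i :: 'n
  assumes "sm f" "x \<in> \<Omega>" "y \<noteq> 0"
  shows "((\<lambda>t. f x (y + t *\<^sub>R axis i 1)) has_real_derivative dir (0, axis i 1) f x y) (at 0)"
proof -
  note d = sm_has_derivative[OF assms]
  have "((\<lambda>t. (\<lambda>p. f (fst p) (snd p)) (x, y + t *\<^sub>R axis i 1)) has_derivative (\<lambda>t. dir (0, t *\<^sub>R axis i 1) f x y)) (at 0)"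
    by (rule has_derivative_compose[of "\<lambda>t. (x, y + t *\<^sub>R axis i 1)" "\<lambda>t. (0, t *\<^sub>R axis i 1)"])
      (use d in \<open>auto intro!: derivative_eq_intros\<close>)
  moreover have "dir (0, t *\<^sub>R axis i 1) f x y = t * dir (0, axis i 1) f x y" for t
    using linear_cmul[OF has_derivative_linear[OF d], of t "(0, axis i 1)"] by simp
  ultimately show ?thesis by (simp add: has_field_derivative_def mult_commute_abs)
qed

lemma dx_eq_dir: "sm f \<Longrightarrow> x \<in> \<Omega> \<Longrightarrow> y \<noteq> 0 \<Longrightarrow> dx i f x y = dir (axis i 1, 0) f x y"
  unfolding dx_def pd_def by (rule DERIV_imp_deriv) (rule dx_has_derivative)

lemma dy_eq_dir: "sm f \<Longrightarrow> x \<in> \<Omega> \<Longrightarrow> y \<noteq> 0 \<Longrightarrow> dy i f x y = dir (0, axis i 1) f x y"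
  unfolding dy_def pd_def by (rule DERIV_imp_deriv) (rule dy_has_derivative)

lemma derivation_dx: "derivation (dx i)"
  by (rule derivation_transfer[OF derivation_dir dx_eq_dir])

lemma derivation_dy: "derivation (dy i)"
  by (rule derivation_transfer[OF derivation_dir dy_eq_dir])

lemmas sm_dx [simp] = derivation_sm[OF derivation_dx]
lemmas sm_dy [simp] = derivation_sm[OF derivation_dy]

lemma dir_commute:
  assumes "sm f" "x \<in> \<Omega>" "y \<noteq> 0"
  shows "dir v (dir w f) x y = dir w (dir v f) x y"
  using frechet_derivative_commute[OF open_slit, of "(x, y)" "\<lambda>p. f (fst p) (snd p)" w v] assms
  by (simp add: dir_def sm_iff)

text \<open>Stated for operators that agree with constant directional derivatives, so that it covers the three
  combinations of base and fiber coordinates at once.\<close>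

lemma coordinate_fields_commute:
  fixes d d' :: "'n tfun \<Rightarrow> 'n tfun"
  assumes "\<And>g x y. sm g \<Longrightarrow> x \<in> \<Omega> \<Longrightarrow> y \<noteq> 0 \<Longrightarrow> d g x y = dir v g x y"
    and "\<And>g x y. sm g \<Longrightarrow> x \<in> \<Omega> \<Longrightarrow> y \<noteq> 0 \<Longrightarrow> d' g x y = dir w g x y"
    and f: "sm f" "x \<in> \<Omega>" "y \<noteq> 0"
  shows "d (d' f) x y = d' (d f) x y"
proof -
  have s: "sm (dir v f)" "sm (dir w f)" by (rule derivation_sm[OF derivation_dir f(1)])+
  have "d (d' f) x y = dir v (d' f) x y"
    by (rule assms(1)[OF _ f(2,3)], rule sm_cong[OF s(2)]) (simp add: assms(2) f)
  also have "\<dots> = dir v (dir w f) x y"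
    by (rule derivation_cong[OF derivation_dir s(2) _ f(2,3)]) (simp add: assms(2) f)
  also have "\<dots> = dir w (dir v f) x y" by (rule dir_commute[OF f])
  also have "\<dots> = dir w (d f) x y"
    by (rule derivation_cong[OF derivation_dir s(1) _ f(2,3), symmetric]) (simp add: assms(1) f)
  also have "\<dots> = d' (d f) x y"
    by (rule assms(2)[OF _ f(2,3), symmetric], rule sm_cong[OF s(1)]) (simp add: assms(1) f)
  finally show ?thesis .
qed

lemma dx_dx: "sm f \<Longrightarrow> x \<in> \<Omega> \<Longrightarrow> y \<noteq> 0 \<Longrightarrow> dx i (dx j f) x y = dx j (dx i f) x y"
  by (rule coordinate_fields_commute[OF dx_eq_dir dx_eq_dir])

lemma dy_dy: "sm f \<Longrightarrow> x \<in> \<Omega> \<Longrightarrow> y \<noteq> 0 \<Longrightarrow> dy i (dy j f) x y = dy j (dy i f) x y"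
  by (rule coordinate_fields_commute[OF dy_eq_dir dy_eq_dir])

lemma dx_dy: "sm f \<Longrightarrow> x \<in> \<Omega> \<Longrightarrow> y \<noteq> 0 \<Longrightarrow> dx i (dy j f) x y = dy j (dx i f) x y"
  by (rule coordinate_fields_commute[OF dx_eq_dir dy_eq_dir])

lemmas dx_rules = derivation_const[OF derivation_dx] derivation_add[OF derivation_dx]
  derivation_mult[OF derivation_dx] derivation_minus[OF derivation_dx] derivation_diff[OF derivation_dx]
  derivation_ln[OF derivation_dx] derivation_divide_const[OF derivation_dx]
  derivation_sum[OF derivation_dx]

lemmas dy_rules = derivation_const[OF derivation_dy] derivation_add[OF derivation_dy]
  derivation_mult[OF derivation_dy] derivation_minus[OF derivation_dy] derivation_diff[OF derivation_dy]
  derivation_ln[OF derivation_dy] derivation_divide_const[OF derivation_dy]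
  derivation_sum[OF derivation_dy]

text \<open>The spray, the horizontal frame and the Euler field are of this form.\<close>

lemma derivation_vector_field:
  fixes c c' :: "'n \<Rightarrow> 'n tfun"
  assumes "\<And>j. sm (c j)" "\<And>j. sm (c' j)"
  shows "derivation (\<lambda>f x y. (\<Sum>!j. c j x y * dx j f x y) + (\<Sum>!j. c' j x y * dy j f x y))"
  unfolding derivation_def
proof (intro conjI allI impI)
  fix f g :: "'n tfun" and x y :: "real ^ 'n"
  assume "sm f" "\<forall>x\<in>\<Omega>. \<forall>y. y \<noteq> 0 \<longrightarrow> f x y = g x y" "x \<in> \<Omega>" "y \<noteq> 0"
  then have "dx i g x y = dx i f x y" "dy i g x y = dy i f x y" for i
    by (auto intro!: derivation_cong[OF derivation_dx] derivation_cong[OF derivation_dy])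
  then show "(\<Sum>!j. c j x y * dx j g x y) + (\<Sum>!j. c' j x y * dy j g x y)
    = (\<Sum>!j. c j x y * dx j f x y) + (\<Sum>!j. c' j x y * dy j f x y)" by simp
qed (simp_all add: assms dx_rules dy_rules algebra_simps sum.distrib sum_distrib_left sum_divide_distrib add_divide_distrib)

lemma dx_fiber_coord [simp]: "dx i (\<lambda>x y. y $ j) x y = 0"
  by (simp add: dx_def pd_def)

lemma dy_fiber_coord [simp]:
  fixes x y :: "real ^ 'n"
  shows "dy i (\<lambda>x y. y $ j) x y = (if i = j then 1 else 0)"
proof -
  have "((\<lambda>t. (y + t *\<^sub>R axis i 1) $ j) has_real_derivative (axis i 1 :: real ^ 'n) $ j) (at 0)"

    by (simp add: axis_def) (auto intro!: derivative_eq_intros)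
  then have "dy i (\<lambda>x y. y $ j) x y = (axis i 1 :: real ^ 'n) $ j"
    unfolding dy_def pd_def by (rule DERIV_imp_deriv)
  then show ?thesis by (simp add: axis_def)
qed

end

section \<open>Sprays and their curvature\<close>

lemma sum_rotate: "(\<Sum>!a b c. f a b c) = (\<Sum>!c a b. f a b c)"
proof -
  have "(\<Sum>!a b c. f a b c) = (\<Sum>!a c b. f a b c)"
    by (intro sum.cong refl sum.swap)
  also have "\<dots> = (\<Sum>!c a b. f a b c)" by (rule sum.swap)
  finally show ?thesis .
qed

locale spray_domain = slit_domain \<Omega> for \<Omega> :: "(real ^ 'n::finite) set" +
  fixes G :: "'n \<Rightarrow> 'n tfun"
  assumes sm_G [simp]: "sm (G a)"
begin

text \<open>\<open>N\<close> is the nonlinear connection, \<open>S\<close> the spray as a derivation, \<open>curv a k\<close> the Riemann curvature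
  \<open>R\<^sup>a\<^sub>k\<close>, and \<open>Dcurv\<close> its covariant derivative along the spray. \<open>K\<close> is minus the Euler-Lagrange
  expression of the trace of \<open>N\<close>; for a volume preserving spray it is \<open>D D I + R I\<close>, with \<open>I\<close> the vertical
  differential of the logarithmic density.\<close>

definition N :: "'n \<Rightarrow> 'n \<Rightarrow> 'n tfun" where "N a b = dy b (G a)"
definition trN :: "'n tfun" where "trN = (\<lambda>x y. \<Sum>!a. N a a x y)"
definition S :: "'n tfun \<Rightarrow> 'n tfun" where
  "S f = (\<lambda>x y. (\<Sum>!j. y $ j * dx j f x y) - 2 * (\<Sum>!a. G a x y * dy a f x y))"
definition curv :: "'n \<Rightarrow> 'n \<Rightarrow> 'n tfun" where
  "curv a k = (\<lambda>x y. 2 * dx k (G a) x y - S (N a k) x y - (\<Sum>!l. N a l x y * N l k x y))"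
definition ric :: "'n tfun" where "ric = (\<lambda>x y. \<Sum>!a. curv a a x y)"
definition Dcurv :: "'n \<Rightarrow> 'n \<Rightarrow> 'n tfun" where
  "Dcurv a k = (\<lambda>x y. S (curv a k) x y + (\<Sum>!b. N a b x y * curv b k x y)
     - (\<Sum>!b. N b k x y * curv a b x y))"
definition K :: "'n \<Rightarrow> 'n tfun" where
  "K k = (\<lambda>x y. S (dy k trN) x y - dx k trN x y)"

lemma derivation_S: "derivation S"
proof -
  have e: "S = (\<lambda>f x y. (\<Sum>!j. y $ j * dx j f x y) + (\<Sum>!a. (- 2 * G a x y) * dy a f x y))"
    by (intro ext) (simp add: S_def sum_distrib_left sum_negf mult.assoc)
  show ?thesis by (subst e, rule derivation_vector_field) simp_all
qed

lemmas sm_S [simp] = derivation_sm[OF derivation_S]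
lemmas S_rules = derivation_const[OF derivation_S] derivation_add[OF derivation_S]
  derivation_mult[OF derivation_S] derivation_minus[OF derivation_S] derivation_diff[OF derivation_S]
  derivation_ln[OF derivation_S] derivation_divide_const[OF derivation_S]
  derivation_sum[OF derivation_S]
lemmas S_cong = derivation_cong[OF derivation_S]
  and dx_cong = derivation_cong[OF derivation_dx]
  and dy_cong = derivation_cong[OF derivation_dy]

lemma sm_N [simp]: "sm (N a b)" by (simp add: N_def)
lemma sm_trN [simp]: "sm trN" by (simp add: trN_def)
lemma sm_curv [simp]: "sm (curv a b)" by (simp add: curv_def)
lemma sm_spray_terms [simp]: "sm ric" "sm (Dcurv a b)" "sm (K a)" by (simp_all add: ric_def Dcurv_def K_def)

text \<open>The commutator \<open>[\<partial>'\<^sub>i, S] = \<partial>\<^sub>i - 2 N\<^sup>a\<^sub>i \<partial>'\<^sub>a\<close>, from which all later commutation rules follow.\<close>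

lemma dy_S:
  assumes f: "sm f" and x: "x \<in> \<Omega>" "y \<noteq> 0"
  shows "dy i (S f) x y = S (dy i f) x y + dx i f x y - 2 * (\<Sum>!a. N a i x y * dy a f x y)"
proof -
  have 1: "(\<Sum>!j. dx j f x y * (if i = j then 1 else 0)) = dx i f x y"
    by (simp add: if_distrib[of "\<lambda>c. _ * c"] cong: if_cong)
  have 2: "dy i (dx j f) x y = dx j (dy i f) x y" "dy i (dy j f) x y = dy j (dy i f) x y" for j
    using dx_dy[OF f x, of j i] dy_dy[OF f x, of i j] by simp_all
  show ?thesis
    unfolding S_def using f x
    by (simp add: dy_rules 1 2 N_def sum.distrib algebra_simps)
qed

lemma dx_S:
  assumes f: "sm f" and x: "x \<in> \<Omega>" "y \<noteq> 0"
  shows "dx i (S f) x y = S (dx i f) x y - 2 * (\<Sum>!a. dx i (G a) x y * dy a f x y)"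
proof -
  have 2: "dx i (dx j f) x y = dx j (dx i f) x y" "dx i (dy j f) x y = dy j (dx i f) x y" for j
    using dx_dy[OF f x, of i j] dx_dx[OF f x, of i j] by simp_all
  show ?thesis
    unfolding S_def using f x
    by (simp add: dx_rules 2 sum.distrib algebra_simps)
qed

lemma dy_N_commute: "x \<in> \<Omega> \<Longrightarrow> y \<noteq> 0 \<Longrightarrow> dy c (N a b) x y = dy b (N a c) x y"
  unfolding N_def by (rule dy_dy) auto

lemma dy_dx_G: "x \<in> \<Omega> \<Longrightarrow> y \<noteq> 0 \<Longrightarrow> dy b (dx k (G a)) x y = dx k (N a b) x y"
  unfolding N_def using dx_dy[of "G a" x y k b] by simp

lemma dy_trN: "x \<in> \<Omega> \<Longrightarrow> y \<noteq> 0 \<Longrightarrow> dy k trN x y = (\<Sum>!a. dy a (N a k) x y)"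
  unfolding trN_def by (simp add: dy_rules dy_N_commute[of x y k])

lemma dx_trN: "x \<in> \<Omega> \<Longrightarrow> y \<noteq> 0 \<Longrightarrow> dx k trN x y = (\<Sum>!a. dx k (N a a) x y)"
  unfolding trN_def by (simp add: dx_rules)

lemma S_trN: "x \<in> \<Omega> \<Longrightarrow> y \<noteq> 0 \<Longrightarrow> S trN x y = (\<Sum>!a. S (N a a) x y)"
  unfolding trN_def by (simp add: S_rules)

lemma S_dy_trN:
  assumes "x \<in> \<Omega>" "y \<noteq> 0"
  shows "S (dy k trN) x y = (\<Sum>!a. S (dy a (N a k)) x y)"
proof -
  have "S (dy k trN) x y = S (\<lambda>x y. \<Sum>!a. dy a (N a k) x y) x y"
    by (rule S_cong[OF _ _ assms]) (simp_all add: dy_trN)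
  then show ?thesis by (simp add: S_rules assms)
qed

lemma dy_curv:
  assumes "x \<in> \<Omega>" "y \<noteq> 0"
  shows "dy b (curv a k) x y = 2 * dx k (N a b) x y - S (dy b (N a k)) x y - dx b (N a k) x y
     + 2 * (\<Sum>!c. N c b x y * dy c (N a k) x y)
     - (\<Sum>!l. dy b (N a l) x y * N l k x y) - (\<Sum>!l. N a l x y * dy b (N l k) x y)"
  unfolding curv_def using assms
  by (simp add: dy_rules dy_dx_G dy_S sum.distrib)

lemma dx_curv:
  assumes "x \<in> \<Omega>" "y \<noteq> 0"
  shows "dx b (curv a k) x y = 2 * dx b (dx k (G a)) x y - S (dx b (N a k)) x y
     + 2 * (\<Sum>!c. dx b (G c) x y * dy c (N a k) x y)
     - (\<Sum>!l. dx b (N a l) x y * N l k x y) - (\<Sum>!l. N a l x y * dx b (N l k) x y)"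
  unfolding curv_def using assms
  by (simp add: dx_rules dx_S sum.distrib)

lemma ric_eq:
  assumes "x \<in> \<Omega>" "y \<noteq> 0"
  shows "ric x y = 2 * (\<Sum>!a. dx a (G a) x y) - S trN x y - (\<Sum>!a l. N a l x y * N l a x y)"
  unfolding ric_def curv_def
  by (simp add: sum_subtractf sum_distrib_left S_trN assms)

text \<open>The combination of \<open>K\<close> and the divergence of \<open>R\<close> that occurs in the trace identity below, written
  without the curvature. Adding \<open>\<partial>'\<^sub>k Ric\<close> cancels the second order term \<open>S(\<partial>'\<^sub>k N\<^sup>a\<^sub>a)\<close>.\<close>

definition M :: "'n \<Rightarrow> 'n tfun" where
  "M k = (\<lambda>x y. S (dy k trN) x y - (\<Sum>!a. dx a (N a k) x y)
     + (\<Sum>!a c. N c a x y * dy c (N a k) x y) - (\<Sum>!l. dy l trN x y * N l k x y))"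

lemma sm_M [simp]: "sm (M k)" by (simp add: M_def)

lemma M_eq:
  assumes "x \<in> \<Omega>" "y \<noteq> 0"
  shows "M k x y = 2 * K k x y + (\<Sum>!a. dy a (curv a k) x y)"
proof -
  have 1: "(\<Sum>!a l. dy a (N a l) x y * N l k x y) = (\<Sum>!l. dy l trN x y * N l k x y)"
    by (subst sum.swap) (simp add: dy_trN[OF assms] sum_distrib_right)
  have 2: "(\<Sum>!a l. N a l x y * dy a (N l k) x y) = (\<Sum>!a c. N c a x y * dy c (N a k) x y)"
    by (rule sum.swap)
  show ?thesis
    unfolding M_def K_def
    by (simp add: dy_curv[OF assms] S_dy_trN[OF assms] dx_trN[OF assms] sum.distrib sum_subtractf
        sum_distrib_left[symmetric] 1 2 )
qed

text \<open>A trace of the curvature 2-form \<open>\<delta>\<^sub>j N\<^sup>a\<^sub>k - \<delta>\<^sub>k N\<^sup>a\<^sub>j\<close> of the nonlinear connection, over \<open>a = j\<close>.\<close>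

definition Q :: "'n \<Rightarrow> 'n tfun" where
  "Q k = (\<lambda>x y. (\<Sum>!a. dx a (N a k) x y) - dx k trN x y + (\<Sum>!a. N a k x y * dy a trN x y)
     - (\<Sum>!i j. N i j x y * dy k (N j i) x y))"

lemma sm_Q [simp]: "sm (Q k)" by (simp add: Q_def)

lemma dy_ric:
  assumes "x \<in> \<Omega>" "y \<noteq> 0"
  shows "dy k ric x y = 2 * (\<Sum>!a. dx a (N a k) x y) - S (dy k trN) x y - dx k trN x y
    + 2 * (\<Sum>!a. N a k x y * dy a trN x y) - 2 * (\<Sum>!i j. N i j x y * dy k (N j i) x y)"
proof -
  have "dy k ric x y = dy k (\<lambda>x y. 2 * (\<Sum>!a. dx a (G a) x y) - S trN x y - (\<Sum>!a l. N a l x y * N l a x y)) x y"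
    by (rule dy_cong[OF _ _ assms]) (simp_all add: ric_eq)
  also have "\<dots> = 2 * (\<Sum>!a. dx a (N a k) x y) - (S (dy k trN) x y + dx k trN x y
    - 2 * (\<Sum>!a. N a k x y * dy a trN x y))
    - ((\<Sum>!i j. dy k (N i j) x y * N j i x y) + (\<Sum>!i j. N i j x y * dy k (N j i) x y))"
    using assms by (simp add: dy_rules dy_S dy_dx_G sum.distrib)
  also have "(\<Sum>!i j. dy k (N i j) x y * N j i x y) = (\<Sum>!i j. N i j x y * dy k (N j i) x y)"
    by (subst sum.swap) (simp add: mult.commute)
  finally show ?thesis by simp
qed

lemma dx_ric:
  assumes "x \<in> \<Omega>" "y \<noteq> 0"
  shows "dx k ric x y = 2 * (\<Sum>!a. dx a (dx k (G a)) x y) - S (dx k trN) x y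
    + 2 * (\<Sum>!a. dx k (G a) x y * dy a trN x y) - 2 * (\<Sum>!i j. N i j x y * dx k (N j i) x y)"
proof -
  have "dx k ric x y = dx k (\<lambda>x y. 2 * (\<Sum>!a. dx a (G a) x y) - S trN x y - (\<Sum>!a l. N a l x y * N l a x y)) x y"
    by (rule dx_cong[OF _ _ assms]) (simp_all add: ric_eq)
  also have "\<dots> = 2 * (\<Sum>!a. dx k (dx a (G a)) x y) - (S (dx k trN) x y
    - 2 * (\<Sum>!a. dx k (G a) x y * dy a trN x y))
    - ((\<Sum>!i j. dx k (N i j) x y * N j i x y) + (\<Sum>!i j. N i j x y * dx k (N j i) x y))"
    using assms by (simp add: dx_rules dx_S sum.distrib)
  also have "(\<Sum>!i j. dx k (N i j) x y * N j i x y) = (\<Sum>!i j. N i j x y * dx k (N j i) x y)"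
    by (subst sum.swap) (simp add: mult.commute)
  finally show ?thesis by (simp add: dx_dx[OF sm_G assms, of k])
qed

lemma M_add_dy_ric:
  assumes "x \<in> \<Omega>" "y \<noteq> 0"
  shows "M k x y + dy k ric x y = Q k x y"
proof -
  have 1: "(\<Sum>!a c. N c a x y * dy c (N a k) x y) = (\<Sum>!i j. N i j x y * dy k (N j i) x y)"
    by (subst sum.swap) (simp add: dy_N_commute[OF assms, of k])
  show ?thesis
    unfolding M_def Q_def dy_ric[OF assms] 1 by (simp add: mult.commute)
qed

lemma S_Q:
  assumes "x \<in> \<Omega>" "y \<noteq> 0"
  shows "S (Q k) x y = (\<Sum>!a. S (dx a (N a k)) x y) - S (dx k trN) x y
    + (\<Sum>!a. S (N a k) x y * dy a trN x y) + (\<Sum>!a. N a k x y * S (dy a trN) x y)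
    - (\<Sum>!i j. S (N i j) x y * dy k (N j i) x y)
    - (\<Sum>!i j. N i j x y * S (dy k (N j i)) x y)"
  unfolding Q_def using assms by (simp add: S_rules sum.distrib)

lemma dy_Dcurv_trace:
  assumes "x \<in> \<Omega>" "y \<noteq> 0"
  shows "(\<Sum>!a. dy a (Dcurv a k) x y) = S (\<lambda>x y. \<Sum>!a. dy a (curv a k) x y) x y
    + (\<Sum>!a. dx a (curv a k) x y) - (\<Sum>!a b. N b a x y * dy b (curv a k) x y)
    + (\<Sum>!b. dy b trN x y * curv b k x y)
    - (\<Sum>!a b. dy a (N b k) x y * curv a b x y)
    - (\<Sum>!b. N b k x y * (\<Sum>!a. dy a (curv a b) x y))"
proof -
  have 1: "(\<Sum>!a b. dy a (N a b) x y * curv b k x y) = (\<Sum>!b. dy b trN x y * curv b k x y)"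
    by (subst sum.swap) (simp add: dy_trN[OF assms] sum_distrib_right)
  have 2: "(\<Sum>!a b. N a b x y * dy a (curv b k) x y) = (\<Sum>!a b. N b a x y * dy b (curv a k) x y)"
    by (rule sum.swap)
  have 3: "(\<Sum>!a b. N b k x y * dy a (curv a b) x y) = (\<Sum>!b. N b k x y * (\<Sum>!a. dy a (curv a b) x y))"
    by (subst sum.swap) (simp add: sum_distrib_left)
  have "dy a (Dcurv a k) x y = S (dy a (curv a k)) x y + dx a (curv a k) x y - 2 * (\<Sum>!b. N b a x y * dy b (curv a k) x y)
    + ((\<Sum>!b. dy a (N a b) x y * curv b k x y) + (\<Sum>!b. N a b x y * dy a (curv b k) x y))
    - ((\<Sum>!b. dy a (N b k) x y * curv a b x y) + (\<Sum>!b. N b k x y * dy a (curv a b) x y))" for a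
    unfolding Dcurv_def using assms
    by (simp add: dy_rules dy_S sum.distrib)
  then show ?thesis
    using assms by (simp add: sum.distrib sum_subtractf S_rules 1 2 3 sum_distrib_left[symmetric])
qed

text \<open>A consequence of the Bianchi identities that involves only the traces \<open>K\<close> and \<open>Ric\<close> and the vertical
  divergence of \<open>D R\<close>. Since \<open>K\<close> and the divergence of \<open>R\<close> combine to \<open>M\<close>, and \<open>M\<^sub>k + \<partial>'\<^sub>k Ric = Q\<^sub>k\<close>, the
  derivatives of these quantities along \<open>S\<close> add up to \<open>S Q\<^sub>k\<close>. Expanding this and the curvature leaves
  contractions of derivatives of \<open>G\<close>, which cancel after renaming indices.\<close>

lemma trace_curvature_identity:
  assumes x: "x \<in> \<Omega>" "y \<noteq> 0"
  shows "2 * (S (K k) x y - (\<Sum>!a. N a k x y * K a x y)) + (\<Sum>!a. dy a (Dcurv a k) x y)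
    = dx k ric x y - S (dy k ric) x y"
proof -
  \<comment> \<open>From here on everything happens at one point; lower and upper case mark values and functions.\<close>
  define n where "n a b = N a b x y" for a b
  define g where "g k a = dx k (G a) x y" for k a
  define h where "h a b c = dx c (N a b) x y" for a b c
  define n2 where "n2 a b c = dy c (N a b) x y" for a b c
  define s where "s a b = S (N a b) x y" for a b
  define s2 where "s2 a b c = S (dy c (N a b)) x y" for a b c
  define t where "t a = dy a trN x y" for a
  define st where "st a = S (dy a trN) x y" for a
  note names = n_def g_def h_def n2_def s_def s2_def t_def st_def
  have n2_commute: "n2 a b c = n2 a c b" for a b c
    unfolding n2_def by (rule dy_N_commute[OF x])
  have SM: "S (M k) x y = 2 * S (K k) x y + S (\<lambda>x y. \<Sum>!a. dy a (curv a k) x y) x y"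
  proof -
    have "S (M k) x y = S (\<lambda>x y. 2 * K k x y + (\<Sum>!a. dy a (curv a k) x y)) x y"
      by (rule S_cong[OF _ _ x]) (simp_all add: M_eq)
    then show ?thesis by (simp add: S_rules x)
  qed
  have SMQ: "S (M k) x y + S (dy k ric) x y = S (Q k) x y"
  proof -
    have "S (Q k) x y = S (\<lambda>x y. M k x y + dy k ric x y) x y"
      by (rule S_cong[OF _ _ x]) (simp_all add: M_add_dy_ric)
    then show ?thesis by (simp add: S_rules x)
  qed
  have NM: "(\<Sum>!a. n a k * M a x y) = 2 * (\<Sum>!a. n a k * K a x y) + (\<Sum>!b. n b k * (\<Sum>!a. dy a (curv a b) x y))"
    by (simp add: M_eq[OF x] algebra_simps sum.distrib sum_distrib_left[symmetric])
  have "2 * (S (K k) x y - (\<Sum>!a. n a k * K a x y)) + (\<Sum>!a. dy a (Dcurv a k) x y)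
     - (dx k ric x y - S (dy k ric) x y)
    = S (Q k) x y - (\<Sum>!b. n b k * M b x y) + (\<Sum>!a. dx a (curv a k) x y)
      - (\<Sum>!a b. n b a * dy b (curv a k) x y) + (\<Sum>!b. t b * curv b k x y)
      - (\<Sum>!a b. n2 b k a * curv a b x y) - dx k ric x y"
    unfolding dy_Dcurv_trace[OF x] using SM SMQ NM by (simp add: names algebra_simps)
  also have "\<dots> = 0"
  proof -
    \<comment> \<open>The only contraction that is cubic in \<open>N\<close> without a trace; it occurs with total coefficient zero.\<close>
    define cub where "cub = (\<Sum>!a b c. n b a * (n c b * n2 a k c))"
    have 1: "(\<Sum>!b. n b k * M b x y) = (\<Sum>!b. n b k * st b) - (\<Sum>!a b. n b k * h a b a)
        + (\<Sum>!a b c. n b k * (n c a * n2 a b c)) - (\<Sum>!b l. n b k * (t l * n l b))"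
    proof -
      have "(\<Sum>!b. n b k * M b x y) = (\<Sum>!b. n b k * st b) - (\<Sum>!b a. n b k * h a b a)
        + (\<Sum>!b a c. n b k * (n c a * n2 a b c)) - (\<Sum>!b l. n b k * (t l * n l b))"
        by (simp add: M_def names algebra_simps sum.distrib sum_subtractf sum_distrib_left)
      also have "(\<Sum>!b a. n b k * h a b a) = (\<Sum>!a b. n b k * h a b a)"
        by (rule sum.swap)
      also have "(\<Sum>!b a c. n b k * (n c a * n2 a b c)) = (\<Sum>!a b c. n b k * (n c a * n2 a b c))"
        by (rule sum.swap)
      finally show ?thesis .
    qed
    have 2: "(\<Sum>!a. dx a (curv a k) x y) = 2 * (\<Sum>!a. dx a (dx k (G a)) x y) - (\<Sum>!a. S (dx a (N a k)) x y)
        + 2 * (\<Sum>!a b. g a b * n2 a k b) - (\<Sum>!a b. n b k * h a b a) - (\<Sum>!a b. n a b * h b k a)"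
      by (simp add: dx_curv[OF x] names algebra_simps sum.distrib sum_subtractf sum_distrib_left)
    have 3: "(\<Sum>!a b. n b a * dy b (curv a k) x y)
      = 2 * (\<Sum>!a b. n b a * h a b k) - (\<Sum>!a b. n b a * s2 a k b) - (\<Sum>!a b. n b a * h a k b)
        + 2 * cub - (\<Sum>!a b c. n c k * (n b a * n2 a c b)) - cub"
    proof -
      have "(\<Sum>!a b. n b a * dy b (curv a k) x y)
        = 2 * (\<Sum>!a b. n b a * h a b k) - (\<Sum>!a b. n b a * s2 a k b) - (\<Sum>!a b. n b a * h a k b)
          + 2 * cub - (\<Sum>!a b c. n c k * (n b a * n2 a c b)) - (\<Sum>!a b c. n b a * (n a c * n2 c k b))"
        by (simp add: dy_curv[OF x] names cub_def algebra_simps sum.distrib sum_subtractf sum_distrib_left)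
      also have "(\<Sum>!a b c. n b a * (n a c * n2 c k b)) = cub"
      proof -
        have "(\<Sum>!a b c. n b a * (n a c * n2 c k b))
            = (\<Sum>!c a b. n b a * (n a c * n2 c k b))"
          by (rule sum_rotate)
        also have "\<dots> = cub" by (simp add: cub_def mult.left_commute)
        finally show ?thesis .
      qed
      finally show ?thesis .
    qed
    have 4: "(\<Sum>!b. t b * curv b k x y) = 2 * (\<Sum>!b. t b * g k b) - (\<Sum>!b. t b * s b k) - (\<Sum>!b l. t b * (n b l * n l k))"
      by (simp add: curv_def names algebra_simps sum.distrib sum_subtractf sum_distrib_left)
    have swap4: "(\<Sum>!b l. t b * (n b l * n l k)) = (\<Sum>!b l. n b k * (t l * n l b))"
      by (subst sum.swap) (simp add: mult_ac)
    have 5: "(\<Sum>!a b. n2 b k a * curv a b x y) = 2 * (\<Sum>!a b. n2 b k a * g b a) - (\<Sum>!a b. n2 b k a * s a b) - cub"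
    proof -
      have "(\<Sum>!a b. n2 b k a * curv a b x y) = 2 * (\<Sum>!a b. n2 b k a * g b a) - (\<Sum>!a b. n2 b k a * s a b)
         - (\<Sum>!a b c. n2 b k a * (n a c * n c b))"
        by (simp add: curv_def names algebra_simps sum.distrib sum_subtractf sum_distrib_left)
      also have "(\<Sum>!a b c. n2 b k a * (n a c * n c b)) = (\<Sum>!b c a. n2 b k a * (n a c * n c b))"
        by (rule sum_rotate[symmetric])
      also have "\<dots> = cub" by (simp add: cub_def mult_ac)
      finally show ?thesis .
    qed
    have swap5: "(\<Sum>!a b. n2 b k a * g b a) = (\<Sum>!a b. g a b * n2 a k b)"
      by (subst sum.swap) (simp add: mult.commute)
    have swap5b: "(\<Sum>!a b. n2 b k a * s a b) = (\<Sum>!i j. s i j * n2 j i k)"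
      by (simp add: mult.commute n2_commute[of _ k])
    have 6: "S (Q k) x y = (\<Sum>!a. S (dx a (N a k)) x y) - S (dx k trN) x y
      + (\<Sum>!b. t b * s b k) + (\<Sum>!b. n b k * st b)
      - (\<Sum>!i j. s i j * n2 j i k) - (\<Sum>!i j. n i j * S (dy k (N j i)) x y)"
      by (simp add: S_Q[OF x] names mult.commute)
    have swap6: "(\<Sum>!i j. n i j * S (dy k (N j i)) x y) = (\<Sum>!a b. n b a * s2 a k b)"
    proof -
      have "S (dy k (N j i)) x y = s2 j k i" for i j
        unfolding s2_def by (rule S_cong[OF _ _ x]) (simp_all add: dy_N_commute[of _ _ k])
      then show ?thesis by (subst sum.swap) simp
    qed
    have 7: "dx k ric x y = 2 * (\<Sum>!a. dx a (dx k (G a)) x y) - S (dx k trN) x y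
      + 2 * (\<Sum>!b. t b * g k b) - 2 * (\<Sum>!a b. n b a * h a b k)"
    proof -
      have "(\<Sum>!i j. n i j * h j i k) = (\<Sum>!a b. n b a * h a b k)"
        by (rule sum.swap)
      then show ?thesis by (simp add: dx_ric[OF x] names mult.commute)
    qed
    have 8: "(\<Sum>!a b. n a b * h b k a) = (\<Sum>!a b. n b a * h a k b)"
      by (rule sum.swap)
    have 9: "(\<Sum>!a b c. n b k * (n c a * n2 a b c)) = (\<Sum>!a b c. n c k * (n b a * n2 a c b))"
      by (intro sum.cong refl sum.swap)
    show ?thesis
      unfolding 1 2 3 4 swap4 5 swap5 swap5b 6 swap6 7 8 9 by simp
  qed
  finally show ?thesis by (simp add: n_def)
qed

text \<open>The horizontal frame.\<close>

definition \<delta> :: "'n \<Rightarrow> 'n tfun \<Rightarrow> 'n tfun" where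
  "\<delta> j f = (\<lambda>x y. dx j f x y - (\<Sum>!a. N a j x y * dy a f x y))"

lemma derivation_\<delta>: "derivation (\<delta> j)"
proof -
  have e: "\<delta> j = (\<lambda>f x y. (\<Sum>!i. (if i = j then 1 else 0) * dx i f x y) + (\<Sum>!a. - N a j x y * dy a f x y))"
    by (intro ext) (simp add: \<delta>_def sum_negf if_distrib[of "\<lambda>c. c * _"] cong: if_cong)
  show ?thesis by (subst e, rule derivation_vector_field) simp_all
qed

lemmas sm_\<delta> [simp] = derivation_sm[OF derivation_\<delta>]
lemmas \<delta>_rules = derivation_const[OF derivation_\<delta>] derivation_add[OF derivation_\<delta>]
  derivation_mult[OF derivation_\<delta>] derivation_minus[OF derivation_\<delta>] derivation_diff[OF derivation_\<delta>]
  derivation_ln[OF derivation_\<delta>] derivation_divide_const[OF derivation_\<delta>]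
  derivation_sum[OF derivation_\<delta>]
lemmas \<delta>_cong = derivation_cong[OF derivation_\<delta>]

lemma dy_\<delta>:
  assumes "sm f" and x: "x \<in> \<Omega>" "y \<noteq> 0"
  shows "dy k (\<delta> j f) x y = \<delta> j (dy k f) x y - (\<Sum>!a. dy k (N a j) x y * dy a f x y)"
  unfolding \<delta>_def using assms
  by (simp add: dy_rules sum.distrib dx_dy dy_dy[of f _ _ k])

text \<open>The curvature is the vertical part of the commutator of the spray with the horizontal frame.\<close>

lemma S_\<delta>:
  assumes f: "sm f" and x: "x \<in> \<Omega>" "y \<noteq> 0"
  shows "S (\<delta> j f) x y = \<delta> j (S f) x y + (\<Sum>!a. N a j x y * \<delta> a f x y) + (\<Sum>!a. curv a j x y * dy a f x y)"
proof -
  have 1: "(\<Sum>!a b. N a j x y * (N b a x y * dy b f x y)) = (\<Sum>!a l. dy a f x y * (N a l x y * N l j x y))"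
    by (subst sum.swap) (simp add: mult_ac)
  have S: "S (\<delta> j f) x y = S (dx j f) x y - (\<Sum>!a. S (N a j) x y * dy a f x y) - (\<Sum>!a. N a j x y * S (dy a f) x y)"
    unfolding \<delta>_def using assms by (simp add: S_rules sum.distrib)
  have h: "\<delta> j (S f) x y = S (dx j f) x y - 2 * (\<Sum>!a. dx j (G a) x y * dy a f x y)
     - (\<Sum>!a. N a j x y * S (dy a f) x y) - (\<Sum>!a. N a j x y * dx a f x y)
     + 2 * (\<Sum>!a b. N a j x y * (N b a x y * dy b f x y))"
    unfolding \<delta>_def dx_S[OF assms] dy_S[OF assms]
    by (simp add: algebra_simps sum.distrib sum_subtractf sum_distrib_left)
  have c: "(\<Sum>!a. curv a j x y * dy a f x y) = 2 * (\<Sum>!a. dx j (G a) x y * dy a f x y) - (\<Sum>!a. S (N a j) x y * dy a f x y)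
     - (\<Sum>!a l. dy a f x y * (N a l x y * N l j x y))"
    by (simp add: curv_def algebra_simps sum.distrib sum_subtractf sum_distrib_left)
  have n: "(\<Sum>!a. N a j x y * \<delta> a f x y) = (\<Sum>!a. N a j x y * dx a f x y)
     - (\<Sum>!a b. N a j x y * (N b a x y * dy b f x y))"
    by (simp add: \<delta>_def algebra_simps sum_subtractf sum_distrib_left)
  show ?thesis unfolding S h c n 1 by simp
qed

lemma \<delta>_\<delta>:
  assumes f: "sm f" and x: "x \<in> \<Omega>" "y \<noteq> 0"
  shows "\<delta> j (\<delta> k f) x y - \<delta> k (\<delta> j f) x y = - (\<Sum>!a. (\<delta> j (N a k) x y - \<delta> k (N a j) x y) * dy a f x y)"
proof -
  have e: "\<delta> j (\<delta> k f) x y = dx j (dx k f) x y - (\<Sum>!a. dx j (N a k) x y * dy a f x y) - (\<Sum>!a. N a k x y * dx j (dy a f) x y)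
     - (\<Sum>!b. N b j x y * dx k (dy b f) x y) + (\<Sum>!b a. N b j x y * (dy b (N a k) x y * dy a f x y))
     + (\<Sum>!b a. N b j x y * (N a k x y * dy b (dy a f) x y))" for j k
    unfolding \<delta>_def using assms
    by (simp add: dx_rules dy_rules dx_dy[symmetric] algebra_simps sum.distrib sum_subtractf sum_distrib_left)
  have 1: "(\<Sum>!b a. N b k x y * (N a j x y * dy b (dy a f) x y)) = (\<Sum>!b a. N b j x y * (N a k x y * dy b (dy a f) x y))"
    by (subst sum.swap) (simp add: mult.left_commute dy_dy[OF f x])
  have r: "(\<Sum>!a. \<delta> j (N a k) x y * dy a f x y) = (\<Sum>!a. dx j (N a k) x y * dy a f x y)
     - (\<Sum>!b a. N b j x y * (dy b (N a k) x y * dy a f x y))" for j k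
    by (subst sum.swap) (simp add: \<delta>_def algebra_simps sum_subtractf sum_distrib_left)
  show ?thesis
    unfolding e left_diff_distrib sum_subtractf r
    using 1 dx_dx[OF f x, of j k] by (simp add: algebra_simps)
qed

text \<open>The curvature 2-form of the nonlinear connection is determined by \<open>R\<^sup>a\<^sub>k\<close>. The factor 3 collects
  \<open>2 \<partial>\<^sub>j N\<close> from the first term of \<open>R\<close> and \<open>\<partial>\<^sub>j N\<close> from commuting \<open>\<partial>'\<close> with \<open>S\<close>.\<close>

lemma curv_antisym:
  assumes x: "x \<in> \<Omega>" "y \<noteq> 0"
  shows "dy k (curv a j) x y - dy j (curv a k) x y = 3 * (\<delta> j (N a k) x y - \<delta> k (N a j) x y)"
proof -
  have 1: "S (dy k (N a j)) x y = S (dy j (N a k)) x y"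
    by (rule S_cong[OF _ _ x]) (simp_all add: dy_N_commute[of _ _ k])
  have 2: "(\<Sum>!l. N a l x y * dy k (N l j) x y) = (\<Sum>!l. N a l x y * dy j (N l k) x y)"
    by (simp add: dy_N_commute[OF x, of k _ j])
  have 3: "(\<Sum>!l. dy k (N a l) x y * N l j x y) = (\<Sum>!l. N l j x y * dy l (N a k) x y)" for j k
    by (simp add: dy_N_commute[OF x, of k] mult.commute)
  show ?thesis
    unfolding dy_curv[OF x] \<delta>_def 1 2 3 by simp
qed

end

section \<open>Sprays that preserve a volume\<close>

text \<open>The assumption on \<open>\<sigma>\<close> says that \<open>S\<close> is divergence free for the density \<open>exp (2 \<sigma>)\<close>: its divergence
  with respect to \<open>dx dy\<close> is \<open>- 2 N\<^sup>a\<^sub>a\<close>.\<close>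

locale volume_spray = spray_domain \<Omega> G for \<Omega> :: "(real ^ 'n::finite) set" and G +
  fixes \<sigma> :: "'n tfun"
  assumes sm_\<sigma> [simp]: "sm \<sigma>"
    and S_\<sigma>: "x \<in> \<Omega> \<Longrightarrow> y \<noteq> 0 \<Longrightarrow> S \<sigma> x y = trN x y"
begin

text \<open>All divergences refer to the density \<open>exp (2 \<sigma>) dx dy\<close>: \<open>vdiv V\<close> is that of the vertical field
  \<open>V\<^sup>a \<partial>'\<^sub>a\<close>, \<open>lift_div V\<close> that of the complete lift \<open>V\<^sup>j \<partial>\<^sub>j + S(V\<^sup>j) \<partial>'\<^sub>j\<close>, and \<open>jacobi V\<close> the commutator
  of \<open>S\<close> with this lift, which is vertical. \<open>P\<close> is the mean Landsberg tensor, which is \<open>D I\<close> (the mean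
  Cartan tensor \<open>I\<close> differentiated along the spray). \<open>D\<close> is the covariant derivative of covectors along the spray.\<close>

definition I :: "'n \<Rightarrow> 'n tfun" where "I a = dy a \<sigma>"
definition P :: "'n \<Rightarrow> 'n tfun" where "P k = (\<lambda>x y. dy k trN x y - \<delta> k \<sigma> x y)"
definition vdiv :: "('n \<Rightarrow> 'n tfun) \<Rightarrow> 'n tfun" where
  "vdiv V = (\<lambda>x y. (\<Sum>!a. dy a (V a) x y) + 2 * (\<Sum>!a. I a x y * V a x y))"
definition lift_div :: "('n \<Rightarrow> 'n tfun) \<Rightarrow> 'n tfun" where
  "lift_div V = (\<lambda>x y. (\<Sum>!j. dx j (V j) x y) + (\<Sum>!j. dy j (S (V j)) x y)
     + 2 * (\<Sum>!j. V j x y * dx j \<sigma> x y) + 2 * (\<Sum>!j. S (V j) x y * I j x y))"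
definition jacobi :: "('n \<Rightarrow> 'n tfun) \<Rightarrow> 'n \<Rightarrow> 'n tfun" where
  "jacobi V a = (\<lambda>x y. S (S (V a)) x y + 2 * (\<Sum>!j. S (V j) x y * N a j x y)
     + 2 * (\<Sum>!j. V j x y * dx j (G a) x y))"
definition D :: "('n \<Rightarrow> 'n tfun) \<Rightarrow> 'n \<Rightarrow> 'n tfun" where
  "D \<theta> k = (\<lambda>x y. S (\<theta> k) x y - (\<Sum>!a. N a k x y * \<theta> a x y))"

lemma sm_I [simp]: "sm (I a)" by (simp add: I_def)
lemma sm_P [simp]: "sm (P a)" by (simp add: P_def)
lemma sm_vdiv [simp]: "(\<And>a. sm (V a)) \<Longrightarrow> sm (vdiv V)" by (simp add: vdiv_def)
lemma sm_lift_div [simp]: "(\<And>a. sm (V a)) \<Longrightarrow> sm (lift_div V)" by (simp add: lift_div_def)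
lemma sm_jacobi [simp]: "(\<And>a. sm (V a)) \<Longrightarrow> sm (jacobi V a)" by (simp add: jacobi_def)
lemma sm_D [simp]: "(\<And>a. sm (\<theta> a)) \<Longrightarrow> sm (D \<theta> k)" by (simp add: D_def)

lemma S_dx_\<sigma>:
  assumes x: "x \<in> \<Omega>" "y \<noteq> 0"
  shows "S (dx j \<sigma>) x y = dx j trN x y + 2 * (\<Sum>!b. dx j (G b) x y * I b x y)"
proof -
  have "dx j (S \<sigma>) x y = dx j trN x y"
    by (rule dx_cong[OF _ _ x]) (simp_all add: S_\<sigma>)
  then show ?thesis by (simp add: dx_S x I_def)
qed

lemma S_I:
  assumes x: "x \<in> \<Omega>" "y \<noteq> 0"
  shows "S (I j) x y = dy j trN x y - dx j \<sigma> x y + 2 * (\<Sum>!b. N b j x y * I b x y)"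
proof -
  have "dy j (S \<sigma>) x y = dy j trN x y"
    by (rule dy_cong[OF _ _ x]) (simp_all add: S_\<sigma>)
  then show ?thesis by (simp add: dy_S x I_def)
qed

text \<open>For divergence free \<open>S\<close> and any vector field \<open>Y\<close>, \<open>S (div Y) = div [S, Y]\<close>; here \<open>Y\<close> is the complete
  lift of \<open>V\<close>.\<close>

lemma S_lift_div:
  assumes V: "\<And>a. sm (V a)" and x: "x \<in> \<Omega>" "y \<noteq> 0"
  shows "S (lift_div V) x y = vdiv (jacobi V) x y"
proof -
  let ?T1 = "\<Sum>!a. S (dx a (V a)) x y"
  let ?T2 = "\<Sum>!a. S (dy a (S (V a))) x y"
  let ?T3 = "\<Sum>!a. S (S (V a)) x y * I a x y"
  let ?A = "\<Sum>!a b. dx a (G b) x y * dy b (V a) x y"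
  let ?B = "\<Sum>!a b. N b a x y * dy b (S (V a)) x y"
  let ?C = "\<Sum>!j. S (V j) x y * dy j trN x y"
  let ?E = "\<Sum>!j. V j x y * dx j trN x y"
  let ?H = "\<Sum>!j b. V j x y * (dx j (G b) x y * I b x y)"
  let ?J = "\<Sum>!j b. S (V j) x y * (N b j x y * I b x y)"
  have L: "S (lift_div V) x y = ?T1 + ?T2 + 2 * ?E + 4 * ?H + 2 * ?T3 + 2 * ?C + 4 * ?J"
    unfolding lift_div_def using x V
    by (simp add: S_rules S_dx_\<sigma> S_I algebra_simps sum.distrib sum_subtractf sum_distrib_left)
  have dyS: "dy a (S (S (V a))) x y = S (dy a (S (V a))) x y + S (dx a (V a)) x y
      - 2 * (\<Sum>!b. dx a (G b) x y * dy b (V a) x y) - 2 * (\<Sum>!b. N b a x y * dy b (S (V a)) x y)" for a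
    using x V by (simp add: dy_S[of "S (V a)"] dx_S)
  have B: "(\<Sum>!a b. dy a (S (V b)) x y * N a b x y) = ?B"
    by (subst sum.swap) (simp add: mult.commute)
  have A: "(\<Sum>!a b. dy a (V b) x y * dx b (G a) x y) = ?A"
    by (subst sum.swap) (simp add: mult.commute)
  have C: "(\<Sum>!a b. S (V b) x y * dy a (N a b) x y) = ?C"
    by (subst sum.swap) (simp add: dy_trN x sum_distrib_left)
  have E: "(\<Sum>!a b. V b x y * dx b (N a a) x y) = ?E"
    by (subst sum.swap) (simp add: dx_trN x sum_distrib_left)
  have H: "(\<Sum>!a b. V b x y * (dx b (G a) x y * I a x y)) = ?H"
    by (rule sum.swap)
  have J: "(\<Sum>!a b. S (V b) x y * (N a b x y * I a x y)) = ?J"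
    by (rule sum.swap)
  have "(\<Sum>!a. dy a (jacobi V a) x y) = ?T2 + ?T1 - 2 * ?A - 2 * ?B + 2 * (?B + ?C) + 2 * (?A + ?E)"
    unfolding jacobi_def using x V
    by (simp add: dy_rules dyS dy_dx_G sum.distrib sum_subtractf sum_distrib_left[symmetric] A B C E)
  moreover have "(\<Sum>!a. I a x y * jacobi V a x y) = ?T3
      + 2 * (\<Sum>!a b. S (V b) x y * (N a b x y * I a x y))
      + 2 * (\<Sum>!a b. V b x y * (dx b (G a) x y * I a x y))"
    by (simp add: jacobi_def algebra_simps sum.distrib sum_distrib_left)
  ultimately show ?thesis unfolding L vdiv_def H J by simp
qed

text \<open>Commute \<open>S\<close> with \<open>\<delta>\<^sub>k\<close> on \<open>\<sigma>\<close> and use \<open>S \<sigma> = N\<^sup>a\<^sub>a\<close>.\<close>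

lemma D_P:
  assumes x: "x \<in> \<Omega>" "y \<noteq> 0"
  shows "D P k x y = K k x y - (\<Sum>!a. curv a k x y * I a x y)"
proof -
  have "S (\<delta> k \<sigma>) x y = \<delta> k (S \<sigma>) x y + (\<Sum>!a. N a k x y * \<delta> a \<sigma> x y) + (\<Sum>!a. curv a k x y * I a x y)"
    unfolding I_def by (rule S_\<delta>[OF sm_\<sigma> x])
  moreover have "\<delta> k (S \<sigma>) x y = \<delta> k trN x y"
    by (rule \<delta>_cong[OF _ _ x]) (simp_all add: S_\<sigma>)
  moreover have "\<delta> k trN x y = dx k trN x y - (\<Sum>!a. N a k x y * dy a trN x y)"
    by (simp add: \<delta>_def)
  ultimately show ?thesis
    using x by (simp add: D_def P_def K_def S_rules algebra_simps sum_subtractf)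
qed

text \<open>Differentiate the formula for \<open>D P\<close> once more; the derivative \<open>D I = P\<close> cancels against the
  curvature term of the Jacobi operator.\<close>

lemma D_D_P:
  assumes x: "x \<in> \<Omega>" "y \<noteq> 0"
  shows "D (D P) k x y + (\<Sum>!a. curv a k x y * P a x y)
    = S (K k) x y - (\<Sum>!a. N a k x y * K a x y) - (\<Sum>!a. I a x y * Dcurv a k x y)"
proof -
  have S1: "S (D P k) x y = S (K k) x y - (\<Sum>!a. S (curv a k) x y * I a x y) - (\<Sum>!a. curv a k x y * S (I a) x y)"
  proof -
    have "S (D P k) x y = S (\<lambda>x y. K k x y - (\<Sum>!a. curv a k x y * I a x y)) x y"
      by (rule S_cong[OF _ _ x]) (simp_all add: D_P)
    then show ?thesis using x by (simp add: S_rules sum.distrib)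
  qed
  have SI: "S (I a) x y = P a x y + (\<Sum>!b. N b a x y * I b x y)" for a
    unfolding S_I[OF x] by (simp add: P_def \<delta>_def I_def)
  have 1: "(\<Sum>!a b. curv a k x y * (N b a x y * I b x y)) = (\<Sum>!a b. I a x y * (N a b x y * curv b k x y))"
    by (subst sum.swap) (simp add: mult_ac)
  have 2: "(\<Sum>!a b. N a k x y * (curv b a x y * I b x y)) = (\<Sum>!a b. I a x y * (N b k x y * curv a b x y))"
    by (subst sum.swap) (simp add: mult_ac)
  have 3: "(\<Sum>!a. curv a k x y * S (I a) x y) = (\<Sum>!a. curv a k x y * P a x y) + (\<Sum>!a b. I a x y * (N a b x y * curv b k x y))"
    by (simp add: SI distrib_left sum.distrib sum_distrib_left 1)
  have 4: "(\<Sum>!a. N a k x y * D P a x y) = (\<Sum>!a. N a k x y * K a x y) - (\<Sum>!a b. I a x y * (N b k x y * curv a b x y))"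
    by (simp add: D_P[OF x] right_diff_distrib sum_subtractf sum_distrib_left 2)
  have 5: "(\<Sum>!a. I a x y * Dcurv a k x y) = (\<Sum>!a. S (curv a k) x y * I a x y)
    + (\<Sum>!a b. I a x y * (N a b x y * curv b k x y)) - (\<Sum>!a b. I a x y * (N b k x y * curv a b x y))"
    by (simp add: Dcurv_def algebra_simps sum.distrib sum_subtractf sum_distrib_left)
  show ?thesis
    unfolding D_def[of "D P"] S1 3 4 5 by simp
qed

text \<open>The Jacobi operator of \<open>P\<close> is, up to a vertical divergence, half the Euler-Lagrange expression of
  the Ricci scalar.\<close>

lemma D_D_P_ric:
  assumes x: "x \<in> \<Omega>" "y \<noteq> 0"
  shows "2 * (D (D P) k x y + (\<Sum>!a. curv a k x y * P a x y))
    = dx k ric x y - S (dy k ric) x y - vdiv (\<lambda>a. Dcurv a k) x y"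
  using trace_curvature_identity[OF x, of k] unfolding D_D_P[OF x] vdiv_def by simp

end

section \<open>Determinants and homogeneity\<close>

definition posdef :: "real ^ 'n ^ 'n::finite \<Rightarrow> bool" where
  "posdef A \<longleftrightarrow> (\<forall>z. z \<noteq> 0 \<longrightarrow> (\<Sum>!i j. A $ i $ j * z $ i * z $ j) > 0)"

lemma quadratic_form_inner: "(\<Sum>!i j. A $ i $ j * z $ i * z $ j) = z \<bullet> (A *v z)"
  for A :: "real ^ 'n ^ 'n::finite"
  by (simp add: inner_vec_def matrix_vector_mult_def sum_distrib_left mult_ac)

lemma posdef_det_nz: "posdef A \<Longrightarrow> det A \<noteq> 0"
  unfolding invertible_det_nz[symmetric] invertible_left_inverse matrix_left_invertible_ker
    posdef_def quadratic_form_inner by (metis inner_zero_right less_irrefl)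

text \<open>On the segment from the identity matrix all matrices are positive definite, so the determinant
  cannot change sign.\<close>

lemma posdef_det_pos:
  assumes "posdef A"
  shows "det A > 0"
proof (rule ccontr)
  assume "\<not> det A > 0"
  then have neg: "det A < 0" using posdef_det_nz[OF assms] by simp
  let ?B = "\<lambda>t. (\<chi> i j. t * A $ i $ j + (1 - t) * (mat 1 :: real ^ 'a ^ 'a) $ i $ j) :: real ^ 'a ^ 'a"
  have "continuous_on {0..1} (\<lambda>t. det (?B t))"
    unfolding det_def by (auto intro!: continuous_intros)
  moreover have "det (?B 0) = 1"
  proof -
    have "?B 0 = mat 1" by (simp add: vec_eq_iff)
    then show ?thesis by simp
  qed
  moreover have "det (?B 1) = det A"
  proof -
    have "?B 1 = A" by (simp add: vec_eq_iff)
    then show ?thesis by simp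
  qed
  ultimately obtain t where t: "0 \<le> t" "t \<le> 1" "det (?B t) = 0"
    using IVT2'[of "\<lambda>t. det (?B t)" 1 0 0] neg by auto
  have "posdef (?B t)"
    unfolding posdef_def
  proof (intro allI impI)
    fix z :: "real ^ 'a" assume z: "z \<noteq> 0"
    have "(\<Sum>!i j. ?B t $ i $ j * z $ i * z $ j)
      = t * (\<Sum>!i j. A $ i $ j * z $ i * z $ j)
        + (1 - t) * (\<Sum>!i j. (mat 1 :: real ^ 'a ^ 'a) $ i $ j * z $ i * z $ j)"
      by (simp add: sum_distrib_left distrib_right sum.distrib mult.assoc)
    also have "\<dots> = t * (\<Sum>!i j. A $ i $ j * z $ i * z $ j) + (1 - t) * (z \<bullet> z)"
      by (simp add: quadratic_form_inner)
    also have "\<dots> > 0"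
    proof -
      have "(\<Sum>!i j. A $ i $ j * z $ i * z $ j) > 0" "z \<bullet> z > 0"
        using assms z by (simp_all add: posdef_def)
      then show ?thesis using t(1,2)
        by (cases "t = 0") (auto intro!: add_pos_nonneg mult_pos_pos)
    qed
    finally show "(\<Sum>!i j. ?B t $ i $ j * z $ i * z $ j) > 0" .
  qed
  with t(3) posdef_det_nz show False by blast
qed

lemma matrix_inv_nz:
  fixes A :: "real ^ 'n::finite ^ 'n"
  assumes "det A \<noteq> 0"
  shows "A ** matrix_inv A = mat 1" "matrix_inv A ** A = mat 1"
proof -
  have "\<exists>A'. A ** A' = mat 1 \<and> A' ** A = mat 1"
    using assms by (simp add: invertible_det_nz[symmetric] invertible_def)
  then show "A ** matrix_inv A = mat 1" "matrix_inv A ** A = mat 1"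
    unfolding matrix_inv_def by (metis (mono_tags, lifting) someI_ex)+
qed

lemma matrix_inv_cramer:
  fixes A :: "real ^ 'n::finite ^ 'n"
  assumes "det A \<noteq> 0"
  shows "matrix_inv A $ k $ l = det (\<chi> i j. if j = k then (if i = l then 1 else 0) else A $ i $ j) / det A"
proof -
  have "A *v (\<chi> i. matrix_inv A $ i $ l) = axis l 1"
  proof -
    have "(A *v (\<chi> i. matrix_inv A $ i $ l)) $ i = (A ** matrix_inv A) $ i $ l" for i
      by (simp add: matrix_vector_mult_def matrix_matrix_mult_def)
    then show ?thesis by (simp add: matrix_inv_nz[OF assms] vec_eq_iff mat_def axis_def)
  qed
  then have "(\<chi> i. matrix_inv A $ i $ l) = (\<chi> k. det (\<chi> i j. if j = k then (axis l 1 :: real ^ 'n) $ i else A $ i $ j) / det A)"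
    by (simp add: cramer[OF assms])
  then have "(\<chi> i. matrix_inv A $ i $ l) $ k = (\<chi> k. det (\<chi> i j. if j = k then (axis l 1 :: real ^ 'n) $ i else A $ i $ j) / det A) $ k"
    by simp
  then show ?thesis by (simp add: axis_def cong: if_cong)
qed

text \<open>Write the new row \<open>w\<close> as the combination of the rows of \<open>A\<close> with coefficients \<open>w B\<close>.\<close>

lemma det_replace_row:
  fixes A B :: "real ^ 'n::finite ^ 'n"
  assumes BA: "B ** A = mat 1"
  shows "det (\<chi> r c. if r = i then w $ c else A $ r $ c) = (\<Sum>!k. w $ k * B $ k $ i) * det A"
proof -
  let ?x = "w v* B"
  have "(\<Sum>!j. ?x $ j *s row j A) = w"
  proof -
    have "(\<Sum>!j. ?x $ j *s row j A) = ?x v* A"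
      by (simp add: vec_eq_iff row_def vector_matrix_mult_def mult.commute)
    also have "\<dots> = w v* (B ** A)"
      by (simp add: vec_eq_iff vector_matrix_mult_def matrix_matrix_mult_def sum_distrib_left sum_distrib_right mult_ac)
        (auto intro: sum.swap)
    finally show ?thesis by (simp add: BA vector_matrix_mul_rid)
  qed
  then have "det (\<chi> r. if r = i then w else row r A) = ?x $ i * det A"
    using cramer_lemma_transpose[of i ?x A] by (simp only:)
  moreover have "(\<chi> r. if r = i then w else row r A) = (\<chi> r c. if r = i then w $ c else A $ r $ c)"
    by (simp add: vec_eq_iff row_def)
  ultimately show ?thesis by (simp add: vector_matrix_mult_def mult.commute)
qed

context slit_domain
begin

lemma sm_det: "(\<And>i j. sm (A i j)) \<Longrightarrow> sm (\<lambda>x y. det (\<chi> i j. A i j x y))"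
  unfolding det_def by (auto intro!: sm_sum sm_mult sm_prod)

lemma derivation_prod:
  assumes d: "derivation d" and f: "\<And>i. i \<in> J \<Longrightarrow> sm (f i)" and x: "x \<in> \<Omega>" "y \<noteq> 0" and "finite J"
  shows "d (\<lambda>x y. \<Prod>i\<in>J. f i x y) x y = (\<Sum>i\<in>J. d (f i) x y * (\<Prod>j\<in>J - {i}. f j x y))"
  using \<open>finite J\<close> f
proof (induction J)
  case (insert i J)
  have "(\<Sum>k\<in>J. d (f k) x y * (\<Prod>j\<in>insert i J - {k}. f j x y)) = (\<Sum>k\<in>J. f i x y * (d (f k) x y * (\<Prod>j\<in>J - {k}. f j x y)))"
  proof (rule sum.cong[OF refl])
    fix k assume "k \<in> J"
    then have "insert i J - {k} = insert i (J - {k})" using insert by auto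
    then show "d (f k) x y * (\<Prod>j\<in>insert i J - {k}. f j x y) = f i x y * (d (f k) x y * (\<Prod>j\<in>J - {k}. f j x y))"
      using insert by simp
  qed
  then show ?case
    using insert by (simp add: derivation_mult[OF d] sm_prod x sum_distrib_left insert_Diff_if)
qed (simp add: derivation_const[OF d] x)

text \<open>Jacobi's formula: differentiate the rows one at a time.\<close>

lemma derivation_det:
  fixes A :: "'n \<Rightarrow> 'n \<Rightarrow> 'n tfun"
  assumes d: "derivation d" and A: "\<And>i j. sm (A i j)" and x: "x \<in> \<Omega>" "y \<noteq> 0"
    and B: "B ** (\<chi> i j. A i j x y) = mat 1"
  shows "d (\<lambda>x y. det (\<chi> i j. A i j x y)) x y
    = (\<Sum>!i k. B $ k $ i * d (A i k) x y) * det (\<chi> i j. A i j x y)"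
proof -
  let ?U = "UNIV :: 'n set" and ?Pm = "{p. p permutes (UNIV :: 'n set)}"
  have split: "(\<Prod>j\<in>?U. if j = i then a j else b j) = a i * (\<Prod>j\<in>?U - {i}. b j)" for i :: 'n and a b :: "'n \<Rightarrow> real"
    by (simp add: prod.remove[of ?U i])
  have "d (\<lambda>x y. det (\<chi> i j. A i j x y)) x y
      = (\<Sum>p\<in>?Pm. of_int (sign p) * (\<Sum>!i. d (A i (p i)) x y * (\<Prod>j\<in>?U - {i}. A j (p j) x y)))"
    unfolding det_def
    by (simp add: derivation_sum[OF d] derivation_mult[OF d] derivation_const[OF d] derivation_prod[OF d] sm_prod A x)
  also have "\<dots> = (\<Sum>!i. \<Sum>p\<in>?Pm. of_int (sign p) * (\<Prod>j\<in>?U. if j = i then d (A i (p j)) x y else A j (p j) x y))"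
    unfolding split sum_distrib_left by (rule sum.swap)
  also have "\<dots> = (\<Sum>!i. det (\<chi> r c. if r = i then (\<chi> k. d (A i k) x y) $ c else (\<chi> i j. A i j x y) $ r $ c))"
    unfolding det_def by (intro sum.cong refl arg_cong2[where f = "(*)"] prod.cong) auto
  also have "\<dots> = (\<Sum>!i. (\<Sum>!k. B $ k $ i * d (A i k) x y) * det (\<chi> i j. A i j x y))"
    by (simp only: det_replace_row[OF B]) (simp add: mult.commute)
  finally show ?thesis by (simp add: sum_distrib_right)
qed

definition euler :: "'n tfun \<Rightarrow> 'n tfun" where
  "euler f = (\<lambda>x y. \<Sum>!l. y $ l * dy l f x y)"

lemma derivation_euler: "derivation euler"
proof -
  have e: "euler = (\<lambda>f x y. (\<Sum>!l. 0 * dx l f x y) + (\<Sum>!l. y $ l * dy l f x y))"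
    by (intro ext) (simp add: euler_def)
  show ?thesis by (subst e, rule derivation_vector_field) simp_all
qed

lemma euler_fiber_coord: "euler (\<lambda>x y. y $ j) x y = y $ j"
  unfolding euler_def dy_fiber_coord by (simp add: if_distrib[of "\<lambda>c. _ * c"] cong: if_cong)

text \<open>Homogeneity of degree \<open>r\<close> in \<open>y\<close>, expressed infinitesimally by Euler's relation; in this form it
  is inherited by sums, products and derivatives through the rules for derivations.\<close>

definition hom :: "real \<Rightarrow> 'n tfun \<Rightarrow> bool" where
  "hom r f \<longleftrightarrow> sm f \<and> (\<forall>x\<in>\<Omega>. \<forall>y. y \<noteq> 0 \<longrightarrow> euler f x y = r * f x y)"

lemma homI: "sm f \<Longrightarrow> (\<And>x y. x \<in> \<Omega> \<Longrightarrow> y \<noteq> 0 \<Longrightarrow> euler f x y = r * f x y) \<Longrightarrow> hom r f"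
  by (auto simp: hom_def)

lemma hom_sm: "hom r f \<Longrightarrow> sm f" by (simp add: hom_def)
lemma hom_euler: "hom r f \<Longrightarrow> x \<in> \<Omega> \<Longrightarrow> y \<noteq> 0 \<Longrightarrow> euler f x y = r * f x y" by (simp add: hom_def)

lemma hom_cong:
  assumes "hom r f" "\<And>x y. x \<in> \<Omega> \<Longrightarrow> y \<noteq> 0 \<Longrightarrow> g x y = f x y"
  shows "hom r g"
proof (rule homI)
  show "sm g" by (rule sm_cong[OF hom_sm[OF assms(1)]]) (simp add: assms(2))
  fix x y assume x: "x \<in> \<Omega>" "y \<noteq> (0 :: real ^ 'n)"
  have "euler g x y = euler f x y"
    by (rule derivation_cong[OF derivation_euler hom_sm[OF assms(1)] assms(2) x])
  then show "euler g x y = r * g x y" by (simp add: hom_euler[OF assms(1)] x assms(2))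
qed

lemma hom_const: "hom 0 (\<lambda>x y. c)"
  by (rule homI) (simp_all add: derivation_const[OF derivation_euler])

lemma hom_fiber_coord: "hom 1 (\<lambda>x y. y $ j)"
  by (rule homI) (simp_all add: euler_fiber_coord)

lemma hom_add: "hom r f \<Longrightarrow> hom r g \<Longrightarrow> hom r (\<lambda>x y. f x y + g x y)"
  by (rule homI) (simp_all add: hom_sm derivation_add[OF derivation_euler] hom_euler distrib_left)

lemma hom_diff: "hom r f \<Longrightarrow> hom r g \<Longrightarrow> hom r (\<lambda>x y. f x y - g x y)"
  by (rule homI) (simp_all add: hom_sm derivation_diff[OF derivation_euler] hom_euler right_diff_distrib)

lemma hom_mult: "hom r f \<Longrightarrow> hom s g \<Longrightarrow> t = r + s \<Longrightarrow> hom t (\<lambda>x y. f x y * g x y)"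
  by (rule homI) (simp_all add: hom_sm derivation_mult[OF derivation_euler] hom_euler algebra_simps)

lemma hom_sum: "(\<And>i. i \<in> J \<Longrightarrow> hom r (f i)) \<Longrightarrow> hom r (\<lambda>x y. \<Sum>i\<in>J. f i x y)"
proof (rule homI)
  assume f: "\<And>i. i \<in> J \<Longrightarrow> hom r (f i)"
  then have s: "\<And>i. i \<in> J \<Longrightarrow> sm (f i)" by (blast intro: hom_sm)
  show "sm (\<lambda>x y. \<Sum>i\<in>J. f i x y)" by (rule sm_sum[OF s])
  fix x y assume x: "x \<in> \<Omega>" "y \<noteq> (0 :: real ^ 'n)"
  show "euler (\<lambda>x y. \<Sum>i\<in>J. f i x y) x y = r * (\<Sum>i\<in>J. f i x y)"
  proof -
    have "euler (\<lambda>x y. \<Sum>i\<in>J. f i x y) x y = (\<Sum>i\<in>J. euler (f i) x y)"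
      by (rule derivation_sum[OF derivation_euler s x])
    also have "\<dots> = (\<Sum>i\<in>J. r * f i x y)"
      by (intro sum.cong refl hom_euler[OF f] x)
    finally show ?thesis by (simp add: sum_distrib_left)
  qed
qed

lemma hom_power: "hom r f \<Longrightarrow> s = real k * r \<Longrightarrow> hom s (\<lambda>x y. f x y ^ k)"
proof (induction k arbitrary: s)
  case 0
  then show ?case using hom_const[of 1] by simp
next
  case (Suc k)
  then show ?case by (simp) (rule hom_mult[OF Suc.prems(1) Suc.IH[OF Suc.prems(1) refl]], simp add: algebra_simps)
qed

lemma hom_inverse:
  assumes f: "hom r f" "\<And>x y. x \<in> \<Omega> \<Longrightarrow> y \<noteq> 0 \<Longrightarrow> f x y \<noteq> 0"
  shows "hom (- r) (\<lambda>x y. inverse (f x y))"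
proof (rule homI)
  show "sm (\<lambda>x y. inverse (f x y))" by (rule sm_inverse[OF hom_sm[OF f(1)] f(2)])
  fix x y assume x: "x \<in> \<Omega>" "y \<noteq> (0 :: real ^ 'n)"
  show "euler (\<lambda>x y. inverse (f x y)) x y = - r * inverse (f x y)"
    using derivation_inverse[OF derivation_euler hom_sm[OF f(1)] f(2) x] f(2)[OF x]
    by (simp add: hom_euler[OF f(1) x] power2_eq_square field_simps)
qed

lemma hom_dy:
  assumes f: "hom r f"
  shows "hom (r - 1) (dy i f)"
proof (rule homI)
  note s = hom_sm[OF f]
  show "sm (dy i f)" using s by simp
  fix x y assume x: "x \<in> \<Omega>" "y \<noteq> (0 :: real ^ 'n)"
  have "dy i (euler f) x y = dy i (\<lambda>x y. r * f x y) x y"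
    using s by (intro derivation_cong[OF derivation_dy _ _ x]) (simp_all add: hom_euler[OF f])
  also have "\<dots> = r * dy i f x y" using s x by (simp add: dy_rules)
  also have "dy i (euler f) x y = dy i f x y + (\<Sum>!l. y $ l * dy i (dy l f) x y)"
  proof -
    have "(\<Sum>!j. dy j f x y * (if i = j then 1 else 0)) = dy i f x y"
      by (simp add: if_distrib[of "\<lambda>c. _ * c"] cong: if_cong)
    then show ?thesis unfolding euler_def using s x by (simp add: dy_rules sum.distrib mult.commute)
  qed
  finally show "euler (dy i f) x y = (r - 1) * dy i f x y"
    by (simp add: euler_def dy_dy[OF s x, of i] algebra_simps)
qed

lemma hom_dx:
  assumes f: "hom r f"
  shows "hom r (dx i f)"
proof (rule homI)
  note s = hom_sm[OF f]
  show "sm (dx i f)" using s by simp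
  fix x y assume x: "x \<in> \<Omega>" "y \<noteq> (0 :: real ^ 'n)"
  have "dx i (euler f) x y = dx i (\<lambda>x y. r * f x y) x y"
    using s by (intro derivation_cong[OF derivation_dx _ _ x]) (simp_all add: hom_euler[OF f])
  also have "\<dots> = r * dx i f x y" using s x by (simp add: dx_rules)
  also have "dx i (euler f) x y = (\<Sum>!l. y $ l * dx i (dy l f) x y)"
    unfolding euler_def using s x by (simp add: dx_rules)
  finally show "euler (dx i f) x y = r * dx i f x y"
    by (simp add: euler_def dx_dy[OF s x, of i])
qed

text \<open>Differentiate the scaling relation at \<open>t = 1\<close>.\<close>

lemma hom_of_scaling:
  assumes f: "sm f" and scale: "\<And>x y t. x \<in> \<Omega> \<Longrightarrow> y \<noteq> 0 \<Longrightarrow> t > 0 \<Longrightarrow> f x (t *\<^sub>R y) = t * f x y"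
  shows "hom 1 f"
proof (rule homI[OF f])
  fix x y assume x: "x \<in> \<Omega>" "y \<noteq> (0 :: real ^ 'n)"
  note d = sm_has_derivative[OF f x]
  have "((\<lambda>t. (\<lambda>p. f (fst p) (snd p)) (x, t *\<^sub>R y)) has_derivative (\<lambda>t. dir (0, t *\<^sub>R y) f x y)) (at 1)"
    by (rule has_derivative_compose[of "\<lambda>t. (x, t *\<^sub>R y)" "\<lambda>t. (0, t *\<^sub>R y)"])
      (use d in \<open>auto intro!: derivative_eq_intros\<close>)
  moreover have "dir (0, t *\<^sub>R y) f x y = t * euler f x y" for t
  proof -
    note lin = has_derivative_linear[OF d]
    have y: "(0 :: real ^ 'n, y) = (\<Sum>!l. y $ l *\<^sub>R (0, axis l 1))"
      by (simp add: prod_eq_iff fst_sum snd_sum basis_expansion scalar_mult_eq_scaleR[symmetric])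
    have "dir (0, t *\<^sub>R y) f x y = t * dir (0, y) f x y"
      using linear_cmul[OF lin, of t "(0, y)"] by simp
    also have "dir (0, y) f x y = (\<Sum>!l. y $ l * dir (0, axis l 1) f x y)"
    proof -
      have "dir (0, y) f x y = (\<Sum>!l. dir (y $ l *\<^sub>R (0, axis l 1)) f x y)"
        unfolding y linear_sum[OF lin] by (simp only: y[symmetric])
      then show ?thesis by (simp only: linear_cmul[OF lin] real_scaleR_def)
    qed
    finally show ?thesis by (simp add: euler_def dy_eq_dir[OF f x])
  qed
  ultimately have "((\<lambda>t. f x (t *\<^sub>R y)) has_real_derivative euler f x y) (at 1)"
    by (simp add: has_field_derivative_def mult_commute_abs)
  moreover have "((\<lambda>t. f x (t *\<^sub>R y)) has_real_derivative f x y) (at 1)"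
  proof (rule DERIV_cong_ev[THEN iffD2])
    show "\<forall>\<^sub>F t in nhds (1 :: real). f x (t *\<^sub>R y) = t * f x y"
      using scale[OF x] eventually_nhds_in_open[of "{0<..}" "1 :: real"]
      by (auto elim!: eventually_mono)
    show "((\<lambda>t. t * f x y) has_real_derivative f x y) (at 1)"
      by (auto intro!: derivative_eq_intros)
  qed simp_all
  ultimately show "euler f x y = 1 * f x y" using DERIV_unique by fastforce
qed

end

section \<open>The fundamental tensor of a Finsler metric\<close>

text \<open>The coordinate expression \<open>L\<close> of a Finsler metric over a chart.\<close>

locale finsler_domain = slit_domain \<Omega> for \<Omega> :: "(real ^ 'n::finite) set" +
  fixes L :: "'n tfun"
  assumes sm_L [simp]: "sm L"
    and L_pos: "x \<in> \<Omega> \<Longrightarrow> y \<noteq> 0 \<Longrightarrow> L x y > 0"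
    and L_scale: "x \<in> \<Omega> \<Longrightarrow> y \<noteq> 0 \<Longrightarrow> t > 0 \<Longrightarrow> L x (t *\<^sub>R y) = t * L x y"
    and fund_posdef: "x \<in> \<Omega> \<Longrightarrow> y \<noteq> 0 \<Longrightarrow> posdef (fund_matrix L x y)"
begin

abbreviation g :: "'n \<Rightarrow> 'n \<Rightarrow> 'n tfun" where "g \<equiv> fund_tensor L"
abbreviation gi :: "'n \<Rightarrow> 'n \<Rightarrow> 'n tfun" where "gi \<equiv> fund_inv L"
abbreviation p :: "'n \<Rightarrow> 'n tfun" where "p \<equiv> y_low L"
text \<open>The energy. Its fiber derivatives of first and second order are the lowered position
  \<open>p\<^sub>i = y\<^sub>i\<close> and the fundamental tensor.\<close>

definition E :: "'n tfun" where "E = (\<lambda>x y. 1/2 * (L x y)\<^sup>2)"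

lemma sm_E [simp]: "sm E" by (simp add: E_def)

lemma g_fun: "g i j = (\<lambda>x y. 1/2 * dy i (dy j (\<lambda>x y. (L x y)\<^sup>2)) x y)"
  by (intro ext) (simp add: fund_tensor_def)

lemma sm_g [simp]: "sm (g i j)" unfolding g_fun by simp

lemma dy_E: "x \<in> \<Omega> \<Longrightarrow> y \<noteq> 0 \<Longrightarrow> dy j E x y = 1/2 * dy j (\<lambda>x y. (L x y)\<^sup>2) x y"
  unfolding E_def by (simp add: dy_rules)

lemma g_eq:
  assumes x: "x \<in> \<Omega>" "y \<noteq> 0"
  shows "g i j x y = dy i (dy j E) x y"
proof -
  have "dy i (dy j E) x y = dy i (\<lambda>x y. 1/2 * dy j (\<lambda>x y. (L x y)\<^sup>2) x y) x y"
    by (rule derivation_cong[OF derivation_dy _ _ x]) (simp_all add: dy_E)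
  also have "\<dots> = g i j x y" unfolding g_fun using x by (simp add: dy_rules)
  finally show ?thesis by simp
qed

lemma g_sym: "x \<in> \<Omega> \<Longrightarrow> y \<noteq> 0 \<Longrightarrow> g i j x y = g j i x y"
  by (simp add: g_eq dy_dy[OF sm_E])

lemma hom_L: "hom 1 L" by (rule hom_of_scaling) (simp_all add: L_scale)

lemma hom_E: "hom 2 E"
proof -
  have "hom 2 (\<lambda>x y. (L x y)\<^sup>2)" by (rule hom_power[OF hom_L]) simp
  then show ?thesis unfolding E_def by (rule hom_mult[OF hom_const]) simp
qed

lemma hom_g: "hom 0 (g i j)"
  using hom_cong[OF hom_dy[OF hom_dy[OF hom_E]], of "g i j" i j] by (simp add: g_eq)

lemma p_eq:
  assumes x: "x \<in> \<Omega>" "y \<noteq> 0"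
  shows "p i x y = dy i E x y"
proof -
  have "p i x y = euler (dy i E) x y"
    by (simp add: y_low_def euler_def g_eq[OF x] dy_dy[OF sm_E x, of i] mult.commute)
  also have "\<dots> = dy i E x y" using hom_euler[OF hom_dy[OF hom_E] x, of i] by simp
  finally show ?thesis .
qed

lemma p_fun: "p i = (\<lambda>x y. \<Sum>!j. g i j x y * y $ j)"
  by (intro ext) (simp add: y_low_def)

lemma sm_p [simp]: "sm (p i)" unfolding p_fun by simp

lemma hom_p: "hom 1 (p i)"
  using hom_cong[OF hom_dy[OF hom_E], of "p i" i] by (simp add: p_eq)

lemma dy_p:
  assumes x: "x \<in> \<Omega>" "y \<noteq> 0"
  shows "dy j (p i) x y = g i j x y"
proof -
  have "dy j (p i) x y = dy j (dy i E) x y"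
    by (rule derivation_cong[OF derivation_dy _ _ x]) (simp_all add: p_eq)
  then show ?thesis by (simp add: g_eq[OF x] dy_dy[OF sm_E x, of i])
qed

lemma dx_p:
  assumes x: "x \<in> \<Omega>" "y \<noteq> 0"
  shows "dx j (p i) x y = dy i (dx j E) x y"
proof -
  have "dx j (p i) x y = dx j (dy i E) x y"
    by (rule derivation_cong[OF derivation_dx _ _ x]) (simp_all add: p_eq)
  then show ?thesis by (simp add: dx_dy[OF sm_E x])
qed

lemma E_eq:
  assumes x: "x \<in> \<Omega>" "y \<noteq> 0"
  shows "(\<Sum>!i. y $ i * p i x y) = 2 * E x y"
  using hom_euler[OF hom_E x] by (simp add: euler_def p_eq[OF x])

definition gdet :: "'n tfun" where "gdet = (\<lambda>x y. det (fund_matrix L x y))"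

lemma gdet_pos: "x \<in> \<Omega> \<Longrightarrow> y \<noteq> 0 \<Longrightarrow> gdet x y > 0"
  unfolding gdet_def by (rule posdef_det_pos[OF fund_posdef])

lemma gdet_nz: "x \<in> \<Omega> \<Longrightarrow> y \<noteq> 0 \<Longrightarrow> det (fund_matrix L x y) \<noteq> 0"
  using gdet_pos[of x y] by (simp add: gdet_def)

lemma sm_gdet [simp]: "sm gdet" unfolding gdet_def fund_matrix_def by (rule sm_det) simp

lemma sm_gi [simp]: "sm (gi k l)"
proof -
  have "sm (\<lambda>x y. det (\<chi> i j. (if j = k then (\<lambda>x y. if i = l then 1 else 0) else g i j) x y) * inverse (gdet x y))"
    by (intro sm_mult sm_det sm_inverse) (auto dest: gdet_pos)
  then show ?thesis
  proof (rule sm_cong)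
    fix x y assume x: "x \<in> \<Omega>" "y \<noteq> (0 :: real ^ 'n)"
    have "(\<chi> i j. (if j = k then (\<lambda>x y. if i = l then 1 else 0) else g i j) x y)
       = (\<chi> i j. if j = k then if i = l then 1 else 0 else fund_matrix L x y $ i $ j)"
      by (simp add: vec_eq_iff fund_matrix_def)
    then show "det (\<chi> i j. (if j = k then (\<lambda>x y. if i = l then 1 else 0) else g i j) x y) * inverse (gdet x y) = gi k l x y"
      by (simp only: fund_inv_def matrix_inv_cramer[OF gdet_nz[OF x]] gdet_def divide_inverse)
  qed
qed

lemma gi_g:
  assumes x: "x \<in> \<Omega>" "y \<noteq> 0"
  shows "(\<Sum>!j. gi i j x y * g j k x y) = (if i = k then 1 else 0)"
proof -
  have "(matrix_inv (fund_matrix L x y) ** fund_matrix L x y) $ i $ k = (mat 1 :: real ^ 'n ^ 'n) $ i $ k"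
    by (simp add: matrix_inv_nz[OF gdet_nz[OF x]])
  then show ?thesis by (simp add: matrix_matrix_mult_def fund_inv_def fund_matrix_def mat_def)
qed

lemma g_gi:
  assumes x: "x \<in> \<Omega>" "y \<noteq> 0"
  shows "(\<Sum>!j. g i j x y * gi j k x y) = (if i = k then 1 else 0)"
proof -
  have "(fund_matrix L x y ** matrix_inv (fund_matrix L x y)) $ i $ k = (mat 1 :: real ^ 'n ^ 'n) $ i $ k"
    by (simp add: matrix_inv_nz[OF gdet_nz[OF x]])
  then show ?thesis by (simp add: matrix_matrix_mult_def fund_inv_def fund_matrix_def mat_def)
qed

lemma lower_raise:
  assumes x: "x \<in> \<Omega>" "y \<noteq> 0"
  shows "(\<Sum>!j k. g i j x y * (gi j k x y * v k)) = v i"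
proof -
  have "(\<Sum>!j k. g i j x y * (gi j k x y * v k)) = (\<Sum>!k. (\<Sum>!j. g i j x y * gi j k x y) * v k)"
    by (subst sum.swap) (simp add: sum_distrib_right mult.assoc)
  then show ?thesis by (simp add: g_gi[OF x] if_distrib[of "\<lambda>c. c * _"] cong: if_cong)
qed

lemma raise_lower:
  assumes x: "x \<in> \<Omega>" "y \<noteq> 0"
  shows "(\<Sum>!j k. gi i j x y * (g j k x y * v k)) = v i"
proof -
  have "(\<Sum>!j k. gi i j x y * (g j k x y * v k)) = (\<Sum>!k. (\<Sum>!j. gi i j x y * g j k x y) * v k)"
    by (subst sum.swap) (simp add: sum_distrib_right mult.assoc)
  then show ?thesis by (simp add: gi_g[OF x] if_distrib[of "\<lambda>c. c * _"] cong: if_cong)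
qed

lemma gi_sym:
  assumes x: "x \<in> \<Omega>" "y \<noteq> 0"
  shows "gi i j x y = gi j i x y"
proof -
  have "gi j i x y = (\<Sum>!a b. gi i a x y * (g a b x y * gi j b x y))"
    by (rule raise_lower[OF x, symmetric])
  also have "\<dots> = (\<Sum>!a. gi i a x y * (\<Sum>!b. gi j b x y * g b a x y))"
    by (simp add: sum_distrib_left mult.commute g_sym[OF x])
  also have "\<dots> = gi i j x y"
    unfolding gi_g[OF x] by (simp add: if_distrib[of "\<lambda>c. _ * c"] cong: if_cong)
  finally show ?thesis by simp
qed

text \<open>Differentiate \<open>g g\<^sup>-\<^sup>1 = 1\<close>.\<close>

lemma derivation_gi:
  assumes d: "derivation d" and x: "x \<in> \<Omega>" "y \<noteq> 0"
  shows "d (gi i l) x y = - (\<Sum>!a b. gi i a x y * (d (g a b) x y * gi b l x y))"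
proof -
  have z: "(\<Sum>!j. g k j x y * d (gi j l) x y) = - (\<Sum>!b. d (g k b) x y * gi b l x y)" for k
  proof -
    have "d (\<lambda>x y. \<Sum>!j. g k j x y * gi j l x y) x y = d (\<lambda>x y. if k = l then 1 else 0) x y"
      by (rule derivation_cong[OF d sm_const _ x]) (simp add: g_gi)
    then show ?thesis
      by (simp add: derivation_sum[OF d] derivation_mult[OF d] derivation_const[OF d] x sum.distrib)
  qed
  have "d (gi i l) x y = (\<Sum>!a j. gi i a x y * (g a j x y * d (gi j l) x y))"
    by (rule raise_lower[OF x, symmetric])
  also have "\<dots> = (\<Sum>!a. gi i a x y * (\<Sum>!j. g a j x y * d (gi j l) x y))"
    by (simp add: sum_distrib_left)
  finally show ?thesis unfolding z by (simp add: sum_negf sum_distrib_left)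
qed

lemma hom_gi: "hom 0 (gi i j)"
  by (rule homI) (simp_all add: derivation_gi[OF derivation_euler] hom_euler[OF hom_g])

text \<open>The density \<open>exp (2 \<sigma>)\<close> is \<open>det g\<close>.\<close>

definition \<sigma> :: "'n tfun" where "\<sigma> = (\<lambda>x y. 1/2 * ln (gdet x y))"

lemma sm_\<sigma> [simp]: "sm \<sigma>"
  unfolding \<sigma>_def by (intro sm_mult sm_const sm_ln) (auto dest: gdet_pos)

lemma derivation_gdet:
  assumes d: "derivation d" and x: "x \<in> \<Omega>" "y \<noteq> 0"
  shows "d gdet x y = gdet x y * (\<Sum>!a b. gi a b x y * d (g b a) x y)"
proof -
  have "matrix_inv (fund_matrix L x y) ** (\<chi> i j. g i j x y) = mat 1"
    using matrix_inv_nz(2)[OF gdet_nz[OF x]] by (simp add: fund_matrix_def)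
  note dd = derivation_det[OF d sm_g x this]
  have "d gdet x y = (\<Sum>!i k. gi k i x y * d (g i k) x y) * gdet x y"
    using dd by (simp add: gdet_def fund_matrix_def fund_inv_def)
  also have "(\<Sum>!i k. gi k i x y * d (g i k) x y) = (\<Sum>!a b. gi a b x y * d (g b a) x y)"
    by (rule sum.swap)
  finally show ?thesis by simp
qed

lemma derivation_\<sigma>_gdet:
  assumes d: "derivation d" and x: "x \<in> \<Omega>" "y \<noteq> 0"
  shows "d gdet x y = 2 * gdet x y * d \<sigma> x y"
proof -
  have "d \<sigma> x y = 1/2 * (d gdet x y / gdet x y)"
    unfolding \<sigma>_def using gdet_pos x
    by (simp add: derivation_divide_const[OF d] derivation_ln[OF d] sm_ln)
  then show ?thesis using gdet_pos[OF x] by simp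
qed

lemma derivation_\<sigma>:
  assumes d: "derivation d" and x: "x \<in> \<Omega>" "y \<noteq> 0"
  shows "d \<sigma> x y = 1/2 * (\<Sum>!a b. gi a b x y * d (g b a) x y)"
  using derivation_\<sigma>_gdet[OF d x] derivation_gdet[OF d x] gdet_pos[OF x] by simp

lemma hom_\<sigma>: "hom 0 \<sigma>"
  by (rule homI) (simp_all add: derivation_\<sigma>[OF derivation_euler] hom_euler[OF hom_g])

lemma hom_gdet: "hom 0 gdet"
  by (rule homI) (simp_all add: derivation_gdet[OF derivation_euler] hom_euler[OF hom_g])

end

section \<open>The geodesic spray\<close>

context finsler_domain
begin

lemma sm_spray: "sm (spray L i)"
proof -
  have "spray L i = (\<lambda>x y. 1/4 * (\<Sum>!a b c. gi i c x y *
      (dx a (g c b) x y + dx b (g a c) x y - dx c (g a b) x y) * y $ a * y $ b))"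
    by (intro ext) (simp add: spray_def)
  then show ?thesis by simp
qed

end

sublocale finsler_domain \<subseteq> spray_domain \<Omega> "spray L"
  by unfold_locales (rule sm_spray)

context finsler_domain
begin

lemma hom_spray: "hom 2 (spray L i)"
proof -
  have "hom 2 (\<lambda>x y. 1/4 * (\<Sum>!a b c. gi i c x y *
      (dx a (g c b) x y + dx b (g a c) x y - dx c (g a b) x y) * y $ a * y $ b))"
    by (rule hom_mult[OF hom_const], rule hom_sum, rule hom_sum, rule hom_sum,
        rule hom_mult[OF hom_mult[OF hom_mult[OF hom_gi] hom_fiber_coord refl] hom_fiber_coord],
        rule hom_diff, rule hom_add)
      (auto intro: hom_dx hom_g)
  then show ?thesis by (rule hom_cong) (simp add: spray_def)
qed

lemma hom_N: "hom 1 (N a b)"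
  using hom_dy[OF hom_spray, of b a] by (simp add: N_def)

lemma hom_trN: "hom 1 trN" unfolding trN_def by (intro hom_sum hom_N)

lemma y_N:
  assumes x: "x \<in> \<Omega>" "y \<noteq> 0"
  shows "(\<Sum>!j. N a j x y * y $ j) = 2 * spray L a x y"
  using hom_euler[OF hom_spray x, of a] by (simp add: euler_def N_def mult.commute)

lemma y_\<delta>:
  assumes x: "x \<in> \<Omega>" "y \<noteq> 0"
  shows "(\<Sum>!j. y $ j * \<delta> j f x y) = S f x y"
proof -
  have "(\<Sum>!j a. y $ j * (N a j x y * dy a f x y)) = (\<Sum>!a. (\<Sum>!j. N a j x y * y $ j) * dy a f x y)"
    by (subst sum.swap) (simp add: sum_distrib_left mult_ac)
  then show ?thesis
    unfolding y_N[OF x] by (simp add: \<delta>_def S_def right_diff_distrib sum_subtractf sum_distrib_left mult_ac)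
qed

text \<open>The definition of the spray coefficients contracts derivatives of \<open>g\<close> twice with \<open>y\<close>; these
  contractions are derivatives of \<open>p\<close> and \<open>E\<close>.\<close>

lemma lower_spray:
  assumes x: "x \<in> \<Omega>" "y \<noteq> 0"
  shows "2 * (\<Sum>!i. g e i x y * spray L i x y) = (\<Sum>!a. y $ a * dx a (p e) x y) - dx e E x y"
proof -
  let ?q = "\<lambda>c a b. (dx a (g c b) x y + dx b (g a c) x y - dx c (g a b) x y) * y $ a * y $ b"
  define w where "w c = (\<Sum>!a b. ?q c a b)" for c
  have "spray L i x y = 1/4 * (\<Sum>!c. gi i c x y * w c)" for i
  proof -
    have "(\<Sum>!a b c. gi i c x y * (?q c a b))
       = (\<Sum>!c a b. gi i c x y * (?q c a b))"
      by (rule sum_rotate)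
    also have "\<dots> = (\<Sum>!c. gi i c x y * w c)"
      by (simp add: w_def sum_distrib_left mult.assoc)
    finally show ?thesis by (simp add: spray_def mult.assoc)
  qed
  then have 1: "(\<Sum>!i. g e i x y * spray L i x y) = 1/4 * w e"
    using lower_raise[OF x, of e w] by (simp add: sum_distrib_left mult_ac)
  have dp: "dx a (p c) x y = (\<Sum>!b. dx a (g c b) x y * y $ b)" for a c
    unfolding p_fun using x by (simp add: dx_rules)
  have dE: "2 * dx c E x y = (\<Sum>!a b. dx c (g a b) x y * y $ a * y $ b)" for c
  proof -
    have "dx c (\<lambda>x y. \<Sum>!a. y $ a * p a x y) x y = dx c (\<lambda>x y. 2 * E x y) x y"
      by (rule dx_cong[OF _ _ x]) (simp_all add: E_eq)
    then have "2 * dx c E x y = (\<Sum>!a. y $ a * dx c (p a) x y)"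
      using x by (simp add: dx_rules)
    then show ?thesis by (simp add: dp sum_distrib_left mult_ac)
  qed
  have "w e = 2 * (\<Sum>!a. y $ a * dx a (p e) x y) - 2 * dx e E x y"
  proof -
    have "w e = (\<Sum>!a b. dx a (g e b) x y * y $ a * y $ b)
       + (\<Sum>!a b. dx b (g a e) x y * y $ a * y $ b) - (\<Sum>!a b. dx e (g a b) x y * y $ a * y $ b)"
      by (simp add: w_def algebra_simps sum.distrib sum_subtractf)
    also have "(\<Sum>!a b. dx b (g a e) x y * y $ a * y $ b) = (\<Sum>!a b. dx a (g e b) x y * y $ a * y $ b)"
    proof -
      have "dx b (g a e) x y = dx b (g e a) x y" for a b
        by (rule dx_cong[OF _ _ x]) (simp_all add: g_sym[of _ _ a e])
      then show ?thesis by (subst sum.swap) (simp add: mult_ac)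
    qed
    also have "(\<Sum>!a b. dx a (g e b) x y * y $ a * y $ b) = (\<Sum>!a. y $ a * dx a (p e) x y)"
      by (simp add: dp sum_distrib_left mult_ac)
    finally show ?thesis unfolding dE by simp
  qed
  with 1 show ?thesis by simp
qed

text \<open>The integral curves of \<open>S\<close> are the extremals of the energy.\<close>

lemma euler_lagrange:
  assumes x: "x \<in> \<Omega>" "y \<noteq> 0"
  shows "S (p e) x y = dx e E x y"
  using lower_spray[OF x, of e] by (simp add: S_def dy_p[OF x] mult.commute)

lemma S_fiber_coord: "S (\<lambda>x y. y $ j) x y = - 2 * spray L j x y"
proof -
  have "(\<Sum>!a. spray L a x y * (if a = j then 1 else 0)) = spray L j x y"
    by (simp add: if_distrib[of "\<lambda>c. _ * c"] cong: if_cong)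
  then show ?thesis by (simp add: S_def)
qed

text \<open>Contract the Euler-Lagrange equations with \<open>y\<close>.\<close>

lemma S_E:
  assumes x: "x \<in> \<Omega>" "y \<noteq> 0"
  shows "S E x y = 0"
proof -
  have "S (\<lambda>x y. \<Sum>!i. y $ i * p i x y) x y = S (\<lambda>x y. 2 * E x y) x y"
    by (rule S_cong[OF _ _ x]) (simp_all add: E_eq)
  then have "2 * S E x y = (\<Sum>!i. y $ i * dx i E x y) - 2 * (\<Sum>!i. spray L i x y * p i x y)"
    using x by (simp add: S_rules S_fiber_coord euler_lagrange sum.distrib sum_subtractf sum_distrib_left mult_ac)
  also have "\<dots> = S E x y" by (simp add: S_def p_eq[OF x])
  finally show ?thesis by simp
qed

text \<open>Vertical derivative of the conservation law \<open>S E = 0\<close>; it says that \<open>E\<close> is constant along the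
  horizontal frame.\<close>

lemma dx_E:
  assumes x: "x \<in> \<Omega>" "y \<noteq> 0"
  shows "dx i E x y = (\<Sum>!a. N a i x y * p a x y)"
proof -
  have "dy i (S E) x y = dy i (\<lambda>x y. 0) x y"
    by (rule dy_cong[OF _ _ x]) (simp_all add: S_E)
  moreover have "S (dy i E) x y = S (p i) x y"
    by (rule S_cong[OF _ _ x]) (simp_all add: p_eq)
  ultimately show ?thesis
    using x by (simp add: dy_S dy_rules euler_lagrange p_eq)
qed

lemma \<delta>_E:
  assumes x: "x \<in> \<Omega>" "y \<noteq> 0"
  shows "\<delta> i E x y = 0"
  using dx_E[OF x] by (simp add: \<delta>_def p_eq[OF x])

lemma \<delta>_p:
  assumes x: "x \<in> \<Omega>" "y \<noteq> 0"
  shows "\<delta> i (p l) x y = (\<Sum>!a. dy l (N a i) x y * p a x y)"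
proof -
  have "dy l (\<delta> i E) x y = dy l (\<lambda>x y. 0) x y"
    by (rule dy_cong[OF _ _ x]) (simp_all add: \<delta>_E)
  moreover have "\<delta> i (dy l E) x y = \<delta> i (p l) x y"
    by (rule \<delta>_cong[OF _ _ x]) (simp_all add: p_eq)
  ultimately show ?thesis using x by (simp add: dy_\<delta> dy_rules p_eq)
qed

lemma \<delta>_p_sym:
  assumes x: "x \<in> \<Omega>" "y \<noteq> 0"
  shows "\<delta> i (p l) x y = \<delta> l (p i) x y"
  by (simp add: \<delta>_p[OF x] dy_N_commute[OF x, of l])

text \<open>The metric is parallel along the spray, \<open>D g = 0\<close>: take the vertical derivative of the
  Euler-Lagrange equations.\<close>

lemma S_g:
  assumes x: "x \<in> \<Omega>" "y \<noteq> 0"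
  shows "S (g i j) x y = (\<Sum>!a. N a i x y * g a j x y) + (\<Sum>!a. N a j x y * g a i x y)"
proof -
  have "dy j (S (p i)) x y = dy j (dx i E) x y"
    by (rule dy_cong[OF _ _ x]) (simp_all add: euler_lagrange)
  moreover have "S (dy j (p i)) x y = S (g i j) x y"
    by (rule S_cong[OF _ _ x]) (simp_all add: dy_p)
  ultimately have "S (g i j) x y + dx j (p i) x y - 2 * (\<Sum>!a. N a j x y * g i a x y) = dx i (p j) x y"
    using x by (simp add: dy_S dy_p dx_p)
  moreover have "\<delta> l (p k) x y = dx l (p k) x y - (\<Sum>!a. N a l x y * g a k x y)" for l k
    by (simp add: \<delta>_def dy_p[OF x] g_sym[OF x, of k])
  ultimately show ?thesis
    using \<delta>_p_sym[OF x, of i j] by (simp add: g_sym[OF x, of i])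
qed

lemma S_p:
  assumes x: "x \<in> \<Omega>" "y \<noteq> 0"
  shows "S (p k) x y = (\<Sum>!a. N a k x y * p a x y)"
  by (simp add: euler_lagrange[OF x] dx_E[OF x])

text \<open>The trace of \<open>D g = 0\<close>.\<close>

lemma S_log_density:
  assumes x: "x \<in> \<Omega>" "y \<noteq> 0"
  shows "S \<sigma> x y = trN x y"
proof -
  have 1: "(\<Sum>!a b. gi a b x y * (\<Sum>!c. N c a x y * g c b x y)) = trN x y"
  proof -
    have "(\<Sum>!a b. gi a b x y * (\<Sum>!c. N c a x y * g c b x y))
        = (\<Sum>!a b c. gi a b x y * (g b c x y * N c a x y))"
      by (simp add: sum_distrib_left mult_ac g_sym[OF x])
    also have "\<dots> = (\<Sum>!a. N a a x y)" by (simp only: raise_lower[OF x])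
    finally show ?thesis by (simp add: trN_def)
  qed
  have 2: "(\<Sum>!a b. gi a b x y * (\<Sum>!c. N c b x y * g c a x y)) = trN x y"
    by (subst 1[symmetric], subst sum.swap) (simp add: gi_sym[OF x])
  show ?thesis
    using 1 2 by (simp add: derivation_\<sigma>[OF derivation_S x] S_g[OF x] distrib_left sum.distrib)
qed

end

sublocale finsler_domain \<subseteq> volume_spray \<Omega> "spray L" \<sigma>
  by unfold_locales (simp_all add: S_log_density)

context finsler_domain
begin

text \<open>The vertical part of \<open>[S, \<delta>\<^sub>j]\<close> annihilates \<open>E\<close>, because \<open>S\<close> and all \<open>\<delta>\<^sub>j\<close> do.\<close>

lemma p_curv:
  assumes x: "x \<in> \<Omega>" "y \<noteq> 0"
  shows "(\<Sum>!a. curv a j x y * p a x y) = 0"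
proof -
  have "S (\<delta> j E) x y = S (\<lambda>x y. 0) x y" "\<delta> j (S E) x y = \<delta> j (\<lambda>x y. 0) x y"
    by (rule S_cong[OF _ _ x] \<delta>_cong[OF _ _ x], simp_all add: \<delta>_E S_E)+
  then show ?thesis
    using S_\<delta>[OF sm_E x, of j] x by (simp add: S_rules \<delta>_rules \<delta>_E p_eq)
qed

text \<open>Vertical differentiation of \<open>y\<^sub>a R\<^sup>a\<^sub>j = 0\<close> expresses \<open>R\<^sub>k\<^sub>j\<close> by \<open>y\<^sub>a \<partial>'\<^sub>k R\<^sup>a\<^sub>j\<close>. Its antisymmetric part
  is a multiple of \<open>[\<delta>\<^sub>j, \<delta>\<^sub>k] E\<close>, which vanishes.\<close>

lemma curv_sym:
  assumes x: "x \<in> \<Omega>" "y \<noteq> 0"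
  shows "(\<Sum>!a. g k a x y * curv a j x y) = (\<Sum>!a. g j a x y * curv a k x y)"
proof -
  have e: "(\<Sum>!a. g k a x y * curv a j x y) = - (\<Sum>!a. dy k (curv a j) x y * p a x y)" for j k
  proof -
    have "dy k (\<lambda>x y. \<Sum>!a. curv a j x y * p a x y) x y = dy k (\<lambda>x y. 0) x y"
      by (rule dy_cong[OF _ _ x]) (simp_all add: p_curv)
    then show ?thesis using x by (simp add: dy_rules dy_p sum.distrib mult.commute g_sym[of x y k])
  qed
  have "\<delta> j (\<delta> k E) x y = \<delta> j (\<lambda>x y. 0) x y" "\<delta> k (\<delta> j E) x y = \<delta> k (\<lambda>x y. 0) x y"
    by (rule \<delta>_cong[OF _ _ x], simp_all add: \<delta>_E)+
  then have "(\<Sum>!a. (\<delta> j (N a k) x y - \<delta> k (N a j) x y) * p a x y) = 0"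
    using \<delta>_\<delta>[OF sm_E x, of j k] x by (simp add: \<delta>_rules p_eq)
  then have "(\<Sum>!a. (dy k (curv a j) x y - dy j (curv a k) x y) * p a x y) = 0"
    unfolding curv_antisym[OF x] by (simp only: mult.assoc sum_distrib_left[symmetric] mult_zero_right)
  then show ?thesis unfolding e by (simp add: left_diff_distrib sum_subtractf)
qed

text \<open>\<open>D\<close> annihilates \<open>y\<^sub>a\<close>, so it may be pulled out of the contraction with \<open>y\<^sub>a R\<^sup>a\<^sub>k = 0\<close>.\<close>

lemma p_Dcurv:
  assumes x: "x \<in> \<Omega>" "y \<noteq> 0"
  shows "(\<Sum>!a. p a x y * Dcurv a k x y) = 0"
proof -
  have "S (\<lambda>x y. \<Sum>!a. curv a k x y * p a x y) x y = S (\<lambda>x y. 0) x y"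
    by (rule S_cong[OF _ _ x]) (simp_all add: p_curv)
  then have 1: "(\<Sum>!a. p a x y * S (curv a k) x y) + (\<Sum>!a b. curv a k x y * (N b a x y * p b x y)) = 0"
    using x by (simp add: S_rules S_p sum.distrib sum_distrib_left mult.commute)
  have 2: "(\<Sum>!a b. p a x y * (N a b x y * curv b k x y)) = (\<Sum>!a b. curv a k x y * (N b a x y * p b x y))"
    by (subst sum.swap) (simp add: mult_ac)
  have 3: "(\<Sum>!a b. p a x y * (N b k x y * curv a b x y)) = 0"
  proof -
    have "(\<Sum>!a b. p a x y * (N b k x y * curv a b x y)) = (\<Sum>!b. N b k x y * (\<Sum>!a. curv a b x y * p a x y))"
      by (subst sum.swap) (simp add: sum_distrib_left mult_ac)
    then show ?thesis by (simp add: p_curv[OF x])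
  qed
  show ?thesis
    unfolding Dcurv_def using 1 2 3
    by (simp add: distrib_left right_diff_distrib sum.distrib sum_subtractf sum_distrib_left)
qed

text \<open>The covariant derivative along the spray of a vector; on covectors it is \<open>D\<close>.\<close>

definition D_up :: "('n \<Rightarrow> 'n tfun) \<Rightarrow> 'n \<Rightarrow> 'n tfun" where
  "D_up V a = (\<lambda>x y. S (V a) x y + (\<Sum>!b. N a b x y * V b x y))"

lemma sm_D_up [simp]: "(\<And>a. sm (V a)) \<Longrightarrow> sm (D_up V a)" by (simp add: D_up_def)

text \<open>Lowering an index commutes with the derivative along the spray since \<open>D g = 0\<close>.\<close>

lemma lower_D_up:
  assumes V: "\<And>a. sm (V a)" and low: "\<And>x y k. x \<in> \<Omega> \<Longrightarrow> y \<noteq> 0 \<Longrightarrow> \<theta> k x y = (\<Sum>!a. g k a x y * V a x y)"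
    and x: "x \<in> \<Omega>" "y \<noteq> 0"
  shows "(\<Sum>!a. g k a x y * D_up V a x y) = D \<theta> k x y"
proof -
  have "S (\<theta> k) x y = S (\<lambda>x y. \<Sum>!a. g k a x y * V a x y) x y"
    by (rule S_cong[OF _ _ x]) (simp_all add: low V)
  then have 1: "S (\<theta> k) x y = (\<Sum>!a b. N b k x y * (g b a x y * V a x y))
     + (\<Sum>!a b. N b a x y * (g b k x y * V a x y)) + (\<Sum>!a. g k a x y * S (V a) x y)"
    using x V by (simp add: S_rules S_g sum.distrib distrib_right sum_distrib_right mult.assoc)
  have 2: "(\<Sum>!a b. N b k x y * (g b a x y * V a x y)) = (\<Sum>!b. N b k x y * \<theta> b x y)"
    by (subst sum.swap) (simp add: low[OF x] sum_distrib_left)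
  have 3: "(\<Sum>!a b. N b a x y * (g b k x y * V a x y)) = (\<Sum>!a b. g k a x y * (N a b x y * V b x y))"
    by (subst sum.swap) (simp add: mult.left_commute g_sym[OF x, of _ k])
  show ?thesis
    unfolding D_def 1 2 3 by (simp add: D_up_def distrib_left sum.distrib sum_distrib_left)
qed

lemma jacobi_eq:
  assumes V: "\<And>a. sm (V a)" and x: "x \<in> \<Omega>" "y \<noteq> 0"
  shows "jacobi V a x y = D_up (D_up V) a x y + (\<Sum>!j. curv a j x y * V j x y)"
proof -
  have s: "S (D_up V a) x y = S (S (V a)) x y + (\<Sum>!b. S (N a b) x y * V b x y) + (\<Sum>!b. N a b x y * S (V b) x y)"
    unfolding D_up_def using x V by (simp add: S_rules sum.distrib)
  have n: "(\<Sum>!b. N a b x y * D_up V b x y) = (\<Sum>!b. N a b x y * S (V b) x y)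
     + (\<Sum>!b c. N a b x y * (N b c x y * V c x y))"
    by (simp add: D_up_def distrib_left sum.distrib sum_distrib_left)
  have c: "(\<Sum>!j. curv a j x y * V j x y) = 2 * (\<Sum>!j. V j x y * dx j (spray L a) x y)
     - (\<Sum>!b. S (N a b) x y * V b x y) - (\<Sum>!b c. N a b x y * (N b c x y * V c x y))"
  proof -
    have "(\<Sum>!j l. N a l x y * (N l j x y * V j x y)) = (\<Sum>!b c. N a b x y * (N b c x y * V c x y))"
      by (rule sum.swap)
    moreover have "(\<Sum>!j. curv a j x y * V j x y) = 2 * (\<Sum>!j. V j x y * dx j (spray L a) x y)
     - (\<Sum>!b. S (N a b) x y * V b x y) - (\<Sum>!j l. N a l x y * (N l j x y * V j x y))"
      by (simp add: curv_def algebra_simps sum.distrib sum_subtractf sum_distrib_left)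
    ultimately show ?thesis by simp
  qed
  show ?thesis
    unfolding D_up_def[of "D_up V"] s n c jacobi_def by (simp add: mult.commute)
qed

definition P_up :: "'n \<Rightarrow> 'n tfun" where
  "P_up a = (\<lambda>x y. \<Sum>!k. gi a k x y * P k x y)"

lemma sm_P_up [simp]: "sm (P_up a)" by (simp add: P_up_def)

lemma lower_P_up: "x \<in> \<Omega> \<Longrightarrow> y \<noteq> 0 \<Longrightarrow> P k x y = (\<Sum>!a. g k a x y * P_up a x y)"
  using lower_raise[of x y k "\<lambda>k. P k x y"] by (simp add: P_up_def sum_distrib_left)

lemma lower_jacobi:
  assumes x: "x \<in> \<Omega>" "y \<noteq> 0"
  shows "(\<Sum>!a. g k a x y * jacobi P_up a x y) = D (D P) k x y + (\<Sum>!a. curv a k x y * P a x y)"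
proof -
  have 1: "(\<Sum>!a. g k a x y * D_up (D_up P_up) a x y) = D (D P) k x y"
    by (rule lower_D_up[OF _ _ x]) (simp_all add: lower_D_up[OF _ lower_P_up])
  have "(\<Sum>!a j. g k a x y * (curv a j x y * P_up j x y)) = (\<Sum>!j. (\<Sum>!a. g k a x y * curv a j x y) * P_up j x y)"
    by (subst sum.swap) (simp add: sum_distrib_right mult.assoc)
  also have "\<dots> = (\<Sum>!j. (\<Sum>!a. g j a x y * curv a k x y) * P_up j x y)"
    by (simp only: curv_sym[OF x, of k])
  also have "\<dots> = (\<Sum>!a. curv a k x y * P a x y)"
    by (simp add: sum_distrib_right lower_P_up[OF x] sum_distrib_left) (subst sum.swap, simp add: mult_ac g_sym[OF x])
  finally show ?thesis
    by (simp add: jacobi_eq[OF _ x] distrib_left sum.distrib sum_distrib_left 1)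
qed

text \<open>\<open>N\<^sup>a\<^sub>a\<close> is homogeneous of degree 1 and \<open>y\<^sup>k \<delta>\<^sub>k = S\<close>, so the contraction is \<open>N\<^sup>a\<^sub>a - S \<sigma>\<close>.\<close>

lemma y_P:
  assumes x: "x \<in> \<Omega>" "y \<noteq> 0"
  shows "(\<Sum>!k. y $ k * P k x y) = 0"
proof -
  have "(\<Sum>!k. y $ k * dy k trN x y) = trN x y"
    using hom_euler[OF hom_trN x] by (simp add: euler_def)
  then show ?thesis
    using y_\<delta>[OF x, of \<sigma>] S_log_density[OF x] by (simp add: P_def right_diff_distrib sum_subtractf)
qed

lemma y_D:
  assumes \<theta>: "\<And>k. sm (\<theta> k)" and z: "\<And>x y. x \<in> \<Omega> \<Longrightarrow> y \<noteq> 0 \<Longrightarrow> (\<Sum>!k. y $ k * \<theta> k x y) = 0"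
    and x: "x \<in> \<Omega>" "y \<noteq> 0"
  shows "(\<Sum>!k. y $ k * D \<theta> k x y) = 0"
proof -
  have "S (\<lambda>x y. \<Sum>!k. y $ k * \<theta> k x y) x y = S (\<lambda>x y. 0) x y"
    by (rule S_cong[OF _ _ x]) (simp_all add: z)
  then have "(\<Sum>!k. y $ k * S (\<theta> k) x y) = (\<Sum>!k. 2 * spray L k x y * \<theta> k x y)"
    using x \<theta> by (simp add: S_rules S_fiber_coord sum_subtractf)
  moreover have "(\<Sum>!k a. y $ k * (N a k x y * \<theta> a x y)) = (\<Sum>!k. 2 * spray L k x y * \<theta> k x y)"
    by (subst sum.swap) (simp add: y_N[OF x, symmetric] sum_distrib_left mult_ac)
  ultimately show ?thesis by (simp add: D_def right_diff_distrib sum_subtractf sum_distrib_left)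
qed

text \<open>\<open>D\<close> preserves orthogonality to \<open>y\<close>, and so does the self-adjoint curvature \<open>R\<close>, which annihilates
  \<open>y\<close>.\<close>

lemma p_jacobi:
  assumes x: "x \<in> \<Omega>" "y \<noteq> 0"
  shows "(\<Sum>!a. p a x y * jacobi P_up a x y) = 0"
proof -
  let ?q = "\<lambda>k j a. y $ k * (g k a x y * curv a j x y * P_up j x y)"
  have "(\<Sum>!a. p a x y * jacobi P_up a x y) = (\<Sum>!k. y $ k * (\<Sum>!a. g k a x y * jacobi P_up a x y))"
    by (simp add: y_low_def sum_distrib_right sum_distrib_left) (subst sum.swap, simp add: mult_ac g_sym[OF x])
  also have "\<dots> = (\<Sum>!k. y $ k * D (D P) k x y) + (\<Sum>!k. y $ k * (\<Sum>!a. curv a k x y * P a x y))"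
    by (simp only: lower_jacobi[OF x] distrib_left sum.distrib)
  also have "(\<Sum>!k. y $ k * D (D P) k x y) = 0"
    by (rule y_D[OF _ _ x]) (simp_all add: y_D y_P)
  also have "(\<Sum>!k. y $ k * (\<Sum>!a. curv a k x y * P a x y)) = (\<Sum>!j. P_up j x y * (\<Sum>!a. curv a j x y * p a x y))"
  proof -
    have e: "(\<Sum>!a. curv a k x y * P a x y) = (\<Sum>!j. (\<Sum>!a. g k a x y * curv a j x y) * P_up j x y)" for k
    proof -
      have "(\<Sum>!a. curv a k x y * P a x y) = (\<Sum>!a j. g j a x y * curv a k x y * P_up j x y)"
        by (simp add: lower_P_up[OF x] sum_distrib_left mult_ac g_sym[OF x])
      also have "\<dots> = (\<Sum>!j. (\<Sum>!a. g j a x y * curv a k x y) * P_up j x y)"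
        by (subst sum.swap) (simp add: sum_distrib_right)
      finally show ?thesis by (simp only: curv_sym[OF x, of k])
    qed
    have "(\<Sum>!k. y $ k * (\<Sum>!a. curv a k x y * P a x y))
      = (\<Sum>!k j a. ?q k j a)"
      unfolding e by (simp add: sum_distrib_left sum_distrib_right)
    also have "\<dots> = (\<Sum>!j a k. ?q k j a)"
      by (rule sum_rotate[symmetric])
    also have "\<dots> = (\<Sum>!j. P_up j x y * (\<Sum>!a. curv a j x y * p a x y))"
      by (simp add: y_low_def sum_distrib_left mult_ac g_sym[OF x])
    finally show ?thesis .
  qed
  finally show ?thesis by (simp add: p_curv[OF x])
qed

end

section \<open>The mean Landsberg tensor\<close>

context finsler_domain
begin

lemma hor_eq: "hor L j f = \<delta> j f"
  by (intro ext) (simp add: hor_def \<delta>_def N_def)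

lemma cov0_0_eq: "x \<in> \<Omega> \<Longrightarrow> y \<noteq> 0 \<Longrightarrow> cov0_0 L f x y = S f x y"
  by (simp add: cov0_0_def hor_eq y_\<delta>)

lemma Ric_eq:
  assumes x: "x \<in> \<Omega>" "y \<noteq> 0"
  shows "Ric L x y = ric x y"
  unfolding Ric_def ric_eq[OF x] S_trN[OF x] N_def[symmetric]
  by (simp add: S_def sum_subtractf sum_distrib_left)

definition chern_low :: "'n \<Rightarrow> 'n \<Rightarrow> 'n \<Rightarrow> 'n tfun" where
  "chern_low l j i = (\<lambda>x y. 1/2 * (\<delta> j (g l i) x y + \<delta> i (g l j) x y - \<delta> l (g j i) x y))"

lemma chern_eq: "chern L k j i x y = (\<Sum>!l. gi k l x y * chern_low l j i x y)"
  by (simp add: chern_def chern_low_def hor_eq sum_distrib_left mult_ac)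

lemma \<delta>_g_sym: "x \<in> \<Omega> \<Longrightarrow> y \<noteq> 0 \<Longrightarrow> \<delta> l (g i j) x y = \<delta> l (g j i) x y"
  by (rule \<delta>_cong) (simp_all add: g_sym[of _ _ i])

lemma \<delta>_\<sigma>:
  assumes x: "x \<in> \<Omega>" "y \<noteq> 0"
  shows "(\<Sum>!a b. gi a b x y * \<delta> l (g b a) x y) = 2 * \<delta> l \<sigma> x y"
  by (simp add: derivation_\<sigma>[OF derivation_\<delta> x])

lemma chern_trace:
  assumes x: "x \<in> \<Omega>" "y \<noteq> 0"
  shows "(\<Sum>!a. chern L a a i x y) = \<delta> i \<sigma> x y"
proof -
  have "(\<Sum>!a l. gi a l x y * \<delta> l (g a i) x y) = (\<Sum>!a l. gi a l x y * \<delta> a (g l i) x y)"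
    by (subst sum.swap) (simp add: gi_sym[OF x])
  moreover have "(\<Sum>!a l. gi a l x y * (2 * chern_low l a i x y)) = (\<Sum>!a l. gi a l x y * \<delta> a (g l i) x y)
     + (\<Sum>!a l. gi a l x y * \<delta> i (g l a) x y) - (\<Sum>!a l. gi a l x y * \<delta> l (g a i) x y)"
    by (simp add: chern_low_def algebra_simps sum.distrib sum_subtractf)
  moreover have "(\<Sum>!a l. gi a l x y * (2 * chern_low l a i x y)) = 2 * (\<Sum>!a. chern L a a i x y)"
    by (simp add: chern_eq sum_distrib_left mult_ac)
  ultimately show ?thesis by (simp add: \<delta>_\<sigma>[OF x])
qed

lemma mean_landsberg_eq:
  assumes x: "x \<in> \<Omega>" "y \<noteq> 0"
  shows "mean_landsberg L i x y = P i x y"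
proof -
  have "dy i trN x y = (\<Sum>!a. dy i (N a a) x y)"
    unfolding trN_def using x by (simp add: dy_rules)
  then show ?thesis
    by (simp add: mean_landsberg_def P_def N_def[symmetric] sum_subtractf chern_trace[OF x])
qed

text \<open>The three terms contract to \<open>S g\<close> and to two derivatives of \<open>p\<close>, which cancel by symmetry of
  \<open>\<delta>\<^sub>i p\<^sub>l\<close>.\<close>

lemma y_chern_low:
  assumes x: "x \<in> \<Omega>" "y \<noteq> 0"
  shows "(\<Sum>!j. chern_low l j i x y * y $ j) = (\<Sum>!a. g l a x y * N a i x y)"
proof -
  have hy: "(\<Sum>!j. \<delta> i (g l j) x y * y $ j) = \<delta> i (p l) x y + (\<Sum>!j. g l j x y * N j i x y)" for i l
  proof -
    have "\<delta> i (\<lambda>x y. y $ j) x y = - N j i x y" for j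
    proof -
      have "(\<Sum>!a. N a i x y * (if a = j then 1 else 0)) = N j i x y"
        by (simp add: if_distrib[of "\<lambda>c. _ * c"] cong: if_cong)
      then show ?thesis by (simp add: \<delta>_def)
    qed
    then show ?thesis unfolding p_fun using x by (simp add: \<delta>_rules sum.distrib sum_subtractf sum_negf)
  qed
  have 1: "(\<Sum>!j. \<delta> j (g l i) x y * y $ j) = S (g l i) x y"
    using y_\<delta>[OF x, of "g l i"] by (simp add: mult.commute)
  have 2: "(\<Sum>!j. \<delta> l (g j i) x y * y $ j) = \<delta> l (p i) x y + (\<Sum>!j. g i j x y * N j l x y)"
    unfolding hy[symmetric] by (simp add: \<delta>_g_sym[OF x, of l i])
  have "(\<Sum>!j. 2 * chern_low l j i x y * y $ j) = (\<Sum>!j. \<delta> j (g l i) x y * y $ j)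
     + (\<Sum>!j. \<delta> i (g l j) x y * y $ j) - (\<Sum>!j. \<delta> l (g j i) x y * y $ j)"
    by (simp add: chern_low_def algebra_simps sum.distrib sum_subtractf)
  also have "\<dots> = 2 * (\<Sum>!a. g l a x y * N a i x y)"
    unfolding 1 2 hy S_g[OF x] by (simp add: \<delta>_p_sym[OF x, of i] g_sym[OF x, of _ l] g_sym[OF x, of _ i] mult.commute)
  finally show ?thesis by (simp add: sum_distrib_left[symmetric] mult.assoc)
qed

lemma y_chern:
  assumes x: "x \<in> \<Omega>" "y \<noteq> 0"
  shows "(\<Sum>!j. chern L k j i x y * y $ j) = N k i x y"
proof -
  have "(\<Sum>!j. chern L k j i x y * y $ j) = (\<Sum>!j l. gi k l x y * (chern_low l j i x y * y $ j))"
    by (simp add: chern_eq sum_distrib_right mult.assoc)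
  also have "\<dots> = (\<Sum>!l. gi k l x y * (\<Sum>!j. chern_low l j i x y * y $ j))"
    by (subst sum.swap) (simp add: sum_distrib_left)
  also have "\<dots> = (\<Sum>!l a. gi k l x y * (g l a x y * N a i x y))"
    by (simp add: y_chern_low[OF x] sum_distrib_left)
  also have "\<dots> = N k i x y" by (rule raise_lower[OF x])
  finally show ?thesis .
qed

lemma cov1_eq:
  assumes x: "x \<in> \<Omega>" "y \<noteq> 0"
  shows "cov1 L (mean_landsberg L) i j x y = \<delta> j (P i) x y - (\<Sum>!k. chern L k j i x y * P k x y)"
proof -
  have "\<delta> j (mean_landsberg L i) x y = \<delta> j (P i) x y"
    by (rule \<delta>_cong[OF _ _ x]) (simp_all add: mean_landsberg_eq)
  then show ?thesis by (simp add: cov1_def hor_eq mean_landsberg_eq[OF x])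
qed

lemma cov1_0_eq:
  assumes x: "x \<in> \<Omega>" "y \<noteq> 0"
  shows "cov1_0 L (mean_landsberg L) i x y = D P i x y"
proof -
  have "(\<Sum>!j. (\<Sum>!k. chern L k j i x y * P k x y) * y $ j) = (\<Sum>!k. (\<Sum>!j. chern L k j i x y * y $ j) * P k x y)"
    by (simp add: sum_distrib_right) (subst sum.swap, simp add: mult_ac)
  moreover have "(\<Sum>!j. \<delta> j (P i) x y * y $ j) = S (P i) x y"
    using y_\<delta>[OF x, of "P i"] by (simp add: mult.commute)
  ultimately show ?thesis
    by (simp add: cov1_0_def cov1_eq[OF x] y_chern[OF x] D_def left_diff_distrib sum_subtractf)
qed

text \<open>The fields \<open>g\<^sup>j\<^sup>i \<partial>'\<^sub>j\<close> are divergence free with respect to \<open>det g dy\<close>. They are the coordinate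
  fields of the dual coordinates \<open>p\<close>, in which this measure is Lebesgue measure. The proof uses that
  \<open>\<partial>'\<^sub>j g\<^sub>a\<^sub>b\<close> is totally symmetric.\<close>

lemma div_gi:
  assumes x: "x \<in> \<Omega>" "y \<noteq> 0"
  shows "(\<Sum>!j. dy j (gi j i) x y) = - 2 * (\<Sum>!b. I b x y * gi b i x y)"
proof -
  let ?T = "\<lambda>j a b. gi j a x y * (dy b (g a j) x y * gi b i x y)"
  have t: "dy j (g a b) x y = dy b (g a j) x y" for a b j
  proof -
    have "dy j (g a b) x y = dy j (dy b (p a)) x y"
      by (rule dy_cong[OF _ _ x]) (simp_all add: dy_p)
    also have "\<dots> = dy b (dy j (p a)) x y" by (rule dy_dy[OF sm_p x])
    also have "\<dots> = dy b (g a j) x y"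
      by (rule dy_cong[OF _ _ x, symmetric]) (simp_all add: dy_p)
    finally show ?thesis .
  qed
  have "(\<Sum>!j. dy j (gi j i) x y) = - (\<Sum>!j a b. ?T j a b)"
    by (simp add: derivation_gi[OF derivation_dy x] t[of i] sum_negf) (simp add: t)
  also have "(\<Sum>!j a b. ?T j a b)
    = (\<Sum>!b j a. ?T j a b)"
    by (rule sum_rotate)
  also have "\<dots> = (\<Sum>!b. (\<Sum>!j a. gi j a x y * dy b (g a j) x y) * gi b i x y)"
    by (simp add: sum_distrib_right mult.assoc)
  also have "\<dots> = 2 * (\<Sum>!b. I b x y * gi b i x y)"
    by (simp add: I_def derivation_\<sigma>[OF derivation_dy x] sum_distrib_left mult_ac)
  finally show ?thesis by simp
qed

lemma vdiv_raise:
  assumes \<theta>: "\<And>k. sm (\<theta> k)" and x: "x \<in> \<Omega>" "y \<noteq> 0"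
  shows "vdiv (\<lambda>a x y. \<Sum>!k. gi a k x y * \<theta> k x y) x y = (\<Sum>!k a. gi k a x y * dy a (\<theta> k) x y)"
proof -
  have "(\<Sum>!a. dy a (\<lambda>x y. \<Sum>!k. gi a k x y * \<theta> k x y) x y)
     = (\<Sum>!a k. dy a (gi a k) x y * \<theta> k x y) + (\<Sum>!a k. gi a k x y * dy a (\<theta> k) x y)"
    using x \<theta> by (simp add: dy_rules sum.distrib)
  also have "(\<Sum>!a k. dy a (gi a k) x y * \<theta> k x y) = (\<Sum>!k. (\<Sum>!a. dy a (gi a k) x y) * \<theta> k x y)"
    by (subst sum.swap) (simp add: sum_distrib_right)
  also have "\<dots> = - 2 * (\<Sum>!k b. I b x y * (gi b k x y * \<theta> k x y))"
    by (simp add: div_gi[OF x] sum_distrib_left sum_distrib_right mult_ac sum_negf)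
  also have "(\<Sum>!k b. I b x y * (gi b k x y * \<theta> k x y)) = (\<Sum>!b. I b x y * (\<Sum>!k. gi b k x y * \<theta> k x y))"
    by (subst sum.swap) (simp add: sum_distrib_left)
  also have "(\<Sum>!a k. gi a k x y * dy a (\<theta> k) x y) = (\<Sum>!k a. gi k a x y * dy a (\<theta> k) x y)"
    by (subst sum.swap) (simp add: gi_sym[OF x])
  finally show ?thesis by (simp add: vdiv_def)
qed

lemma vdiv_cong:
  assumes "\<And>a. sm (V a)" "\<And>a x y. x \<in> \<Omega> \<Longrightarrow> y \<noteq> 0 \<Longrightarrow> W a x y = V a x y" and x: "x \<in> \<Omega>" "y \<noteq> 0"
  shows "vdiv W x y = vdiv V x y"
proof -
  have "dy a (W a) x y = dy a (V a) x y" for a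
    by (rule dy_cong[OF assms(1) assms(2) x])
  then show ?thesis by (simp add: vdiv_def assms(2)[OF x])
qed

lemma raise_D_P:
  assumes x: "x \<in> \<Omega>" "y \<noteq> 0"
  shows "D_up P_up a x y = (\<Sum>!k. gi a k x y * D P k x y)"
proof -
  have "D_up P_up a x y = (\<Sum>!k b. gi a k x y * (g k b x y * D_up P_up b x y))"
    by (rule raise_lower[OF x, symmetric])
  also have "\<dots> = (\<Sum>!k. gi a k x y * (\<Sum>!b. g k b x y * D_up P_up b x y))"
    by (simp add: sum_distrib_left)
  finally show ?thesis by (simp add: lower_D_up[OF sm_P_up lower_P_up x])
qed

text \<open>The Chern connection is horizontally metric and \<open>\<Gamma>\<^sup>a\<^sub>a\<^sub>j = \<delta>\<^sub>j \<sigma>\<close>. Subtracting \<open>P\<^sub>i P\<^sup>i\<close> from both sides gives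
  the divergence of the horizontal field \<open>P\<^sup>i \<delta>\<^sub>i\<close>.\<close>

lemma hdiv_P_up:
  assumes x: "x \<in> \<Omega>" "y \<noteq> 0"
  shows "(\<Sum>!i j. gi i j x y * cov1 L (mean_landsberg L) i j x y)
    = (\<Sum>!j. \<delta> j (P_up j) x y) + (\<Sum>!j. P_up j x y * \<delta> j \<sigma> x y)"
proof -
  let ?T = "\<lambda>j a b. gi j a x y * (\<delta> j (g a b) x y * P_up b x y)"
    and ?R = "\<lambda>j a b i. gi j a x y * (\<delta> j (g a b) x y * (gi b i x y * P i x y))"
    and ?Y = "\<lambda>l i j. P_up l x y * (gi i j x y * chern_low l j i x y)"
  let ?X = "\<Sum>!l i j. P_up l x y * (gi i j x y * \<delta> j (g i l) x y)"
  have c: "(\<Sum>!k. chern L k j i x y * P k x y) = (\<Sum>!l. P_up l x y * chern_low l j i x y)" for i j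
  proof -
    have "(\<Sum>!k. chern L k j i x y * P k x y) = (\<Sum>!k l. gi k l x y * P k x y * chern_low l j i x y)"
      by (simp add: chern_eq sum_distrib_left mult_ac)
    also have "\<dots> = (\<Sum>!l k. gi l k x y * P k x y * chern_low l j i x y)"
      by (subst sum.swap) (simp add: gi_sym[OF x])
    finally show ?thesis by (simp add: P_up_def sum_distrib_right)
  qed
  have c2: "(\<Sum>!i j. gi i j x y * chern_low l j i x y) = (\<Sum>!i j. gi i j x y * \<delta> j (g i l) x y) - \<delta> l \<sigma> x y" for l
  proof -
    have "2 * (\<Sum>!i j. gi i j x y * chern_low l j i x y) = (\<Sum>!i j. gi i j x y * \<delta> j (g i l) x y)
      + (\<Sum>!i j. gi i j x y * \<delta> i (g l j) x y) - (\<Sum>!i j. gi i j x y * \<delta> l (g j i) x y)"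
      by (simp add: chern_low_def algebra_simps sum.distrib sum_subtractf sum_distrib_left \<delta>_g_sym[OF x, of _ l])
    also have "(\<Sum>!i j. gi i j x y * \<delta> i (g l j) x y) = (\<Sum>!i j. gi i j x y * \<delta> j (g i l) x y)"
      by (subst sum.swap) (simp add: gi_sym[OF x] \<delta>_g_sym[OF x, of _ l])
    finally show ?thesis by (simp add: \<delta>_\<sigma>[OF x])
  qed
  have e: "(\<Sum>!i j. gi i j x y * (\<Sum>!k. chern L k j i x y * P k x y)) = ?X - (\<Sum>!l. P_up l x y * \<delta> l \<sigma> x y)"
  proof -
    have "(\<Sum>!i j. gi i j x y * (\<Sum>!k. chern L k j i x y * P k x y))
      = (\<Sum>!i j l. ?Y l i j)"
      by (simp add: c sum_distrib_left mult_ac)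
    also have "\<dots> = (\<Sum>!l i j. ?Y l i j)"
      by (rule sum_rotate)
    also have "\<dots> = (\<Sum>!l. P_up l x y * (\<Sum>!i j. gi i j x y * chern_low l j i x y))"
      by (simp add: sum_distrib_left)
    finally show ?thesis by (simp add: c2 right_diff_distrib sum_subtractf sum_distrib_left)
  qed
  have h: "\<delta> j (P_up j) x y = (\<Sum>!i. gi j i x y * \<delta> j (P i) x y) - (\<Sum>!a b. ?T j a b)" for j
  proof -
    have "\<delta> j (P_up j) x y = (\<Sum>!i. gi j i x y * \<delta> j (P i) x y)
       - (\<Sum>!i a b. ?R j a b i)"
      unfolding P_up_def using x
      by (simp add: \<delta>_rules derivation_gi[OF derivation_\<delta>] sum.distrib sum_subtractf sum_distrib_right mult.assoc)
    also have "(\<Sum>!i a b. ?R j a b i)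
       = (\<Sum>!a b i. ?R j a b i)"
      by (rule sum_rotate[symmetric])
    finally show ?thesis by (simp add: P_up_def sum_distrib_left)
  qed
  have X: "(\<Sum>!j a b. ?T j a b) = ?X"
  proof -
    have "(\<Sum>!j a b. ?T j a b)
      = (\<Sum>!b j a. ?T j a b)"
      by (rule sum_rotate)
    also have "\<dots> = (\<Sum>!b a j. ?T j a b)"
      by (intro sum.cong refl sum.swap)
    also have "\<dots> = (\<Sum>!b a j. P_up b x y * (gi a j x y * \<delta> j (g a b) x y))"
      by (intro sum.cong refl) (simp add: gi_sym[OF x] mult_ac)
    finally show ?thesis .
  qed
  have s: "(\<Sum>!j i. gi j i x y * \<delta> j (P i) x y) = (\<Sum>!i j. gi i j x y * \<delta> j (P i) x y)"
    by (subst sum.swap) (simp add: gi_sym[OF x])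
  show ?thesis
    by (simp add: cov1_eq[OF x] right_diff_distrib sum_subtractf e h X s)
qed

text \<open>The first two terms of \<open>\<PP>\<close> form the divergence of \<open>P\<^sup>i \<delta>\<^sub>i\<close> and the third that of the vertical
  field \<open>(D P)\<^sup>i \<partial>'\<^sub>i\<close>; together these fields are the complete lift of \<open>P\<close>.\<close>

lemma frakP_eq:
  assumes x: "x \<in> \<Omega>" "y \<noteq> 0"
  shows "frakP L x y = lift_div P_up x y"
proof -
  have d: "dy j (cov1_0 L (mean_landsberg L) i) x y = dy j (D P i) x y" for i j
    by (rule dy_cong[OF _ _ x]) (simp_all add: cov1_0_eq)
  have v: "vdiv (D_up P_up) x y = (\<Sum>!i j. gi i j x y * dy j (D P i) x y)"
  proof -
    have "vdiv (D_up P_up) x y = vdiv (\<lambda>a x y. \<Sum>!k. gi a k x y * D P k x y) x y"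
      by (rule vdiv_cong[OF _ _ x]) (simp_all add: raise_D_P)
    also have "\<dots> = (\<Sum>!i j. gi i j x y * dy j (D P i) x y)"
      by (rule vdiv_raise[OF _ x]) simp
    finally show ?thesis .
  qed
  have PP: "(\<Sum>!i j. gi i j x y * (P i x y * P j x y)) = (\<Sum>!i. P_up i x y * P i x y)"
    by (simp add: P_up_def sum_distrib_left mult_ac)
  have 1: "frakP L x y = (\<Sum>!j. \<delta> j (P_up j) x y) + (\<Sum>!j. P_up j x y * \<delta> j \<sigma> x y)
     - (\<Sum>!i. P_up i x y * P i x y) + vdiv (D_up P_up) x y"
    unfolding v PP[symmetric] hdiv_P_up[OF x, symmetric]
    by (simp add: frakP_def mean_landsberg_eq[OF x] d distrib_left right_diff_distrib sum.distrib sum_subtractf)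
  have a: "(\<Sum>!a b. dy a (N a b) x y * P_up b x y) = (\<Sum>!b. P_up b x y * dy b trN x y)"
    by (subst sum.swap) (simp add: dy_trN[OF x] sum_distrib_left mult.commute)
  have b: "(\<Sum>!a b. N a b x y * dy a (P_up b) x y) = (\<Sum>!b a. N a b x y * dy a (P_up b) x y)"
    by (rule sum.swap)
  have c: "(\<Sum>!a b. I a x y * (N a b x y * P_up b x y)) = (\<Sum>!b. P_up b x y * (\<Sum>!a. N a b x y * I a x y))"
    by (subst sum.swap) (simp add: sum_distrib_left mult_ac)
  have 2: "vdiv (D_up P_up) x y = (\<Sum>!a. dy a (S (P_up a)) x y) + (\<Sum>!b. P_up b x y * dy b trN x y)
     + (\<Sum>!b a. N a b x y * dy a (P_up b) x y) + 2 * (\<Sum>!a. S (P_up a) x y * I a x y)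
     + 2 * (\<Sum>!b. P_up b x y * (\<Sum>!a. N a b x y * I a x y))"
    unfolding vdiv_def D_up_def using x
    by (simp add: dy_rules sum.distrib a b c distrib_left sum_distrib_left[of "I _ x y"] mult.commute[of "S _ _ _"])
  have h\<sigma>: "\<delta> j \<sigma> x y = dx j \<sigma> x y - (\<Sum>!a. N a j x y * I a x y)" for j
    by (simp add: \<delta>_def I_def)
  show ?thesis
    unfolding 1 2 lift_div_def
    by (simp add: P_def h\<sigma> \<delta>_def[of _ "P_up _"] algebra_simps sum.distrib sum_subtractf)
qed

lemma S_frakP:
  assumes x: "x \<in> \<Omega>" "y \<noteq> 0"
  shows "S (frakP L) x y = vdiv (jacobi P_up) x y"
proof -
  have "S (frakP L) x y = S (lift_div P_up) x y"
    by (rule S_cong[OF _ _ x]) (simp_all add: frakP_eq)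
  then show ?thesis by (simp add: S_lift_div x)
qed

end

section \<open>The vertical flux on Einstein metrics\<close>

context finsler_domain
begin

lemma hom_S:
  assumes f: "hom r f"
  shows "hom (r + 1) (S f)"
  unfolding S_def
  by (intro hom_diff hom_mult[OF hom_const] hom_sum hom_mult[OF hom_fiber_coord hom_dx[OF f]]
      hom_mult[OF hom_spray hom_dy[OF f]]) simp_all

lemma hom_\<delta>:
  assumes f: "hom r f"
  shows "hom r (\<delta> j f)"
  unfolding \<delta>_def by (intro hom_diff hom_dx[OF f] hom_sum hom_mult[OF hom_N hom_dy[OF f]]) simp

lemma hom_P: "hom 0 (P k)"
proof -
  have "hom 0 (dy k trN)" using hom_dy[OF hom_trN] by simp
  then show ?thesis unfolding P_def by (intro hom_diff hom_\<delta> hom_\<sigma>)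
qed

lemma hom_P_up: "hom 0 (P_up a)"
  unfolding P_up_def by (intro hom_sum hom_mult[OF hom_gi hom_P]) simp

lemma hom_jacobi: "hom 2 (jacobi P_up a)"
proof -
  have S: "hom 1 (S (P_up j))" for j using hom_S[OF hom_P_up] by simp
  have "hom 2 (S (S (P_up a)))" using hom_S[OF S] by simp
  then show ?thesis
    unfolding jacobi_def
    by (intro hom_add hom_mult[OF hom_const] hom_sum hom_mult[OF S hom_N] hom_mult[OF hom_P_up hom_dx[OF hom_spray]]) simp_all
qed

lemma hom_curv: "hom 2 (curv a k)"
proof -
  have "hom 2 (S (N a k))" using hom_S[OF hom_N] by simp
  then show ?thesis unfolding curv_def
    by (intro hom_diff hom_mult[OF hom_const hom_dx[OF hom_spray]] hom_sum hom_mult[OF hom_N hom_N]) simp_all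
qed

lemma hom_Dcurv: "hom 3 (Dcurv a k)"
proof -
  have "hom 3 (S (curv a k))" using hom_S[OF hom_curv] by simp
  then show ?thesis unfolding Dcurv_def
    by (intro hom_diff hom_add hom_sum hom_mult[OF hom_N hom_curv]) simp_all
qed

definition Linv :: "nat \<Rightarrow> 'n tfun" where "Linv m = (\<lambda>x y. inverse (L x y ^ m))"

lemma L_nz: "x \<in> \<Omega> \<Longrightarrow> y \<noteq> 0 \<Longrightarrow> L x y ^ m \<noteq> 0"
  using L_pos[of x y] by simp

lemma sm_Linv [simp]: "sm (Linv m)"
  unfolding Linv_def by (rule sm_inverse) (simp_all add: L_nz del: power_eq_0_iff)

lemma hom_Linv: "hom (- real m) (Linv m)"
  unfolding Linv_def by (rule hom_inverse[OF hom_power[OF hom_L]]) (simp_all add: L_nz del: power_eq_0_iff)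

lemma dy_L:
  assumes x: "x \<in> \<Omega>" "y \<noteq> 0"
  shows "dy a L x y = p a x y / L x y"
proof -
  have "dy a E x y = L x y * dy a L x y"
    unfolding dy_E[OF x] using derivation_power[OF derivation_dy sm_L x, of a 2] by simp
  then show ?thesis using L_pos[OF x] by (simp add: p_eq[OF x])
qed

lemma dy_Linv:
  assumes x: "x \<in> \<Omega>" "y \<noteq> 0"
  shows "dy a (Linv m) x y = - real m * Linv (m + 2) x y * p a x y"
proof -
  have "dy a (Linv m) x y = - dy a (\<lambda>x y. L x y ^ m) x y / (L x y ^ m)\<^sup>2"
    unfolding Linv_def by (rule derivation_inverse[OF derivation_dy _ _ x]) (simp_all add: L_nz del: power_eq_0_iff)
  also have "\<dots> = - (real m * L x y ^ (m - 1) * (p a x y / L x y)) / (L x y ^ m)\<^sup>2"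
    using derivation_power[OF derivation_dy sm_L x, of a m] by (simp add: dy_L[OF x])
  also have "\<dots> = - real m * Linv (m + 2) x y * p a x y"
    using L_pos[OF x] by (cases m) (simp_all add: Linv_def field_simps power2_eq_square)
  finally show ?thesis .
qed

lemma vdiv_add:
  "(\<And>a. sm (V a)) \<Longrightarrow> (\<And>a. sm (W a)) \<Longrightarrow> x \<in> \<Omega> \<Longrightarrow> y \<noteq> 0 \<Longrightarrow>
     vdiv (\<lambda>a x y. V a x y + W a x y) x y = vdiv V x y + vdiv W x y"
  by (simp add: vdiv_def dy_rules distrib_left sum.distrib)

lemma vdiv_mult:
  "sm f \<Longrightarrow> (\<And>a. sm (W a)) \<Longrightarrow> x \<in> \<Omega> \<Longrightarrow> y \<noteq> 0 \<Longrightarrow>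
     vdiv (\<lambda>a x y. f x y * W a x y) x y = f x y * vdiv W x y + (\<Sum>!a. dy a f x y * W a x y)"
  by (simp add: vdiv_def dy_rules algebra_simps sum.distrib sum_distrib_left)

lemma dy_gdet:
  assumes V: "\<And>a. sm (V a)" and x: "x \<in> \<Omega>" "y \<noteq> 0"
  shows "(\<Sum>!a. dy a (\<lambda>x y. gdet x y * V a x y) x y) = gdet x y * vdiv V x y"
  using x V
  by (simp add: dy_rules vdiv_def derivation_\<sigma>_gdet[OF derivation_dy] I_def algebra_simps sum.distrib sum_distrib_left)

end

locale einstein_domain = finsler_domain \<Omega> L for \<Omega> :: "(real ^ 'n::finite) set" and L +
  fixes \<rho> :: "real ^ 'n \<Rightarrow> real"
  assumes einstein: "x \<in> \<Omega> \<Longrightarrow> y \<noteq> 0 \<Longrightarrow> Ric L x y = \<rho> x * (L x y)\<^sup>2"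
begin

definition rho :: "'n tfun" where "rho = (\<lambda>x y. \<rho> x)"

text \<open>Smoothness of \<open>\<rho>\<close> is inherited from \<open>Ric / L\<^sup>2\<close>.\<close>

lemma sm_rho [simp]: "sm rho"
proof (rule sm_cong)
  show "sm (\<lambda>x y. ric x y * Linv 2 x y)" by simp
  fix x y assume x: "x \<in> \<Omega>" "y \<noteq> (0 :: real ^ 'n)"
  have "ric x y = \<rho> x * (L x y)\<^sup>2" using Ric_eq[OF x] einstein[OF x] by simp
  then show "ric x y * Linv 2 x y = rho x y"
    using L_pos[OF x] by (simp add: rho_def Linv_def)
qed

lemma dy_rho: "dy i rho x y = 0"
  by (simp add: dy_def pd_def rho_def)

lemma hom_rho: "hom 0 rho"
  by (rule homI) (simp_all add: euler_def dy_rho)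

lemma ric_rho: "x \<in> \<Omega> \<Longrightarrow> y \<noteq> 0 \<Longrightarrow> ric x y = 2 * (rho x y * E x y)"
  using Ric_eq[of x y] einstein[of x y] by (simp add: rho_def E_def)

lemma S_rho:
  assumes x: "x \<in> \<Omega>" "y \<noteq> 0"
  shows "S rho x y = (\<Sum>!j. y $ j * dx j rho x y)"
  by (simp add: S_def dy_rho)

lemma dy_dx_rho:
  assumes x: "x \<in> \<Omega>" "y \<noteq> 0"
  shows "dy a (dx j rho) x y = 0"
proof -
  have "dx j (dy a rho) x y = dx j (\<lambda>x y. 0) x y"
    by (rule dx_cong[OF _ _ x]) (simp_all add: dy_rho)
  then show ?thesis using dx_dy[OF sm_rho x, of j a] x by (simp add: dx_rules)
qed

text \<open>The Euler-Lagrange expression of \<open>2 \<rho> E\<close>; the derivatives of \<open>E\<close> drop out since the spray consists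
  of extremals of \<open>E\<close>.\<close>

lemma ric_variation:
  assumes x: "x \<in> \<Omega>" "y \<noteq> 0"
  shows "dx k ric x y - S (dy k ric) x y = (L x y)\<^sup>2 * dx k rho x y - 2 * p k x y * S rho x y"
proof -
  have "dx k ric x y = dx k (\<lambda>x y. 2 * (rho x y * E x y)) x y"
    by (rule dx_cong[OF _ _ x]) (simp_all add: ric_rho)
  then have 1: "dx k ric x y = 2 * (dx k rho x y * E x y + rho x y * dx k E x y)"
    using x by (simp add: dx_rules)
  have "dy k ric x y = 2 * (rho x y * p k x y)" if x: "x \<in> \<Omega>" "y \<noteq> 0" for x y
  proof -
    have "dy k ric x y = dy k (\<lambda>x y. 2 * (rho x y * E x y)) x y"
      by (rule dy_cong[OF _ _ x]) (simp_all add: ric_rho)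
    then show ?thesis using x by (simp add: dy_rules dy_rho p_eq)
  qed
  then have "S (dy k ric) x y = S (\<lambda>x y. 2 * (rho x y * p k x y)) x y"
    by (intro S_cong[OF _ _ x]) simp_all
  then have 2: "S (dy k ric) x y = 2 * (S rho x y * p k x y + rho x y * dx k E x y)"
    using x by (simp add: S_rules euler_lagrange)
  show ?thesis unfolding 1 2 by (simp add: E_def algebra_simps)
qed

text \<open>The first two terms produce \<open>L\<^bsup>-n-2\<^esup> y\<^sub>k S \<PP>\<close> and remove the divergence of \<open>D R\<^sub>k\<close>; the third replaces
  \<open>L\<^bsup>-n-2\<^esup> y\<^sub>k y\<^sup>j \<partial>\<^sub>j\<rho>\<close> by \<open>L\<^bsup>-n\<^esup> \<partial>\<^sub>k\<rho> / n\<close>.\<close>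

definition flux :: "'n \<Rightarrow> 'n \<Rightarrow> 'n tfun" where
  "flux k a = (\<lambda>x y.
     Linv (CARD('n) + 2) x y * (p k x y * jacobi P_up a x y)
     + Linv (CARD('n) + 2) x y * (1/2 * Dcurv a k x y)
     + (- 1 / real CARD('n)) * (Linv CARD('n) x y * (p k x y * (\<Sum>!j. gi a j x y * dx j rho x y))))"

lemma sm_flux [simp]: "sm (flux k a)" by (simp add: flux_def)

lemma hom_flux: "hom (1 - real CARD('n)) (flux k a)"
proof -
  have j: "hom 3 (\<lambda>x y. p k x y * jacobi P_up a x y)" by (rule hom_mult[OF hom_p hom_jacobi]) simp
  have c: "hom 3 (\<lambda>x y. 1/2 * Dcurv a k x y)" by (rule hom_mult[OF hom_const hom_Dcurv]) simp
  have "hom 0 (\<lambda>x y. \<Sum>!j. gi a j x y * dx j rho x y)"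
    by (intro hom_sum hom_mult[OF hom_gi hom_dx[OF hom_rho]]) simp
  then have p: "hom 1 (\<lambda>x y. p k x y * (\<Sum>!j. gi a j x y * dx j rho x y))"
    by (rule hom_mult[OF hom_p]) simp
  show ?thesis unfolding flux_def
    by (intro hom_add hom_mult[OF hom_Linv j] hom_mult[OF hom_Linv c] hom_mult[OF hom_const hom_mult[OF hom_Linv p refl]]) simp_all
qed

lemma vdiv_flux:
  assumes x: "x \<in> \<Omega>" "y \<noteq> 0"
  shows "vdiv (flux k) x y = Linv (CARD('n) + 2) x y * (p k x y * S (frakP L) x y)
    + (1/2 - 1/real CARD('n)) * Linv CARD('n) x y * dx k rho x y"
proof -
  let ?l = "Linv (CARD('n) + 2)" and ?m = "Linv CARD('n)"
  let ?V1 = "\<lambda>a x y. ?l x y * (p k x y * jacobi P_up a x y)"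
    and ?Z = "D (D P) k x y + (\<Sum>!a. curv a k x y * P a x y)"
    and ?V2 = "\<lambda>a x y. ?l x y * (1/2 * Dcurv a k x y)"
    and ?V3 = "\<lambda>a x y. (- 1 / real CARD('n)) * (?m x y * (p k x y * (\<Sum>!j. gi a j x y * dx j rho x y)))"
  have lp: "(\<Sum>!a. dy a ?l x y * V a) = - (real CARD('n) + 2) * Linv (CARD('n) + 4) x y * (\<Sum>!a. p a x y * V a)" for V
  proof -
    have "dy a ?l x y * V a = - (real CARD('n) + 2) * Linv (CARD('n) + 4) x y * (p a x y * V a)" for a
    proof -
      have e: "CARD('n) + 2 + 2 = CARD('n) + 4" by simp
      show ?thesis
        unfolding dy_Linv[OF x] e by (simp only: of_nat_add of_nat_numeral mult.assoc)
    qed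
    then show ?thesis by (simp only: sum_distrib_left)
  qed
  have 1: "vdiv ?V1 x y
      = ?l x y * (p k x y * S (frakP L) x y + (?Z))"
  proof -
    have "(\<Sum>!a. p a x y * (p k x y * jacobi P_up a x y)) = p k x y * (\<Sum>!a. p a x y * jacobi P_up a x y)"
      by (simp add: sum_distrib_left mult_ac)
    then have z: "(\<Sum>!a. p a x y * (p k x y * jacobi P_up a x y)) = 0" by (simp add: p_jacobi[OF x])
    have "vdiv ?V1 x y
      = ?l x y * vdiv (\<lambda>a x y. p k x y * jacobi P_up a x y) x y + (\<Sum>!a. dy a ?l x y * (p k x y * jacobi P_up a x y))"
      by (rule vdiv_mult[OF _ _ x]) simp_all
    moreover have "vdiv (\<lambda>a x y. p k x y * jacobi P_up a x y) x y
      = p k x y * S (frakP L) x y + (?Z)"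
      using x by (simp add: vdiv_mult S_frakP dy_p lower_jacobi[symmetric])
    ultimately show ?thesis by (simp only: lp z)
  qed
  have 2: "vdiv ?V2 x y = ?l x y * (1/2 * vdiv (\<lambda>a. Dcurv a k) x y)"
  proof -
    have "(\<Sum>!a. p a x y * (1/2 * Dcurv a k x y)) = 1/2 * (\<Sum>!a. p a x y * Dcurv a k x y)"
      by (simp add: sum_distrib_left mult_ac)
    then have z: "(\<Sum>!a. p a x y * (1/2 * Dcurv a k x y)) = 0" by (simp add: p_Dcurv[OF x])
    have "vdiv (\<lambda>a x y. 1/2 * Dcurv a k x y) x y = 1/2 * vdiv (\<lambda>a. Dcurv a k) x y"
      using vdiv_mult[of "\<lambda>x y. 1/2" "\<lambda>a. Dcurv a k", OF _ _ x] x by (simp add: dy_rules)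
    then show ?thesis
      using vdiv_mult[of ?l "\<lambda>a x y. 1/2 * Dcurv a k x y", OF _ _ x] by (simp only: lp z) (simp)
  qed
  have 3: "vdiv ?V3 x y
      = (- 1 / real CARD('n)) * (?m x y * dx k rho x y - real CARD('n) * ?l x y * p k x y * S rho x y)"
  proof -
    define R where "R a = (\<lambda>x y. \<Sum>!j. gi a j x y * dx j rho x y)" for a
    have sR: "sm (R a)" for a by (simp add: R_def)
    have v: "vdiv R x y = 0"
      unfolding R_def by (subst vdiv_raise[OF _ x]) (simp_all add: dy_dx_rho[OF x])
    have gR: "(\<Sum>!a. g k a x y * R a x y) = dx k rho x y" for k
      unfolding R_def sum_distrib_left by (rule lower_raise[OF x])
    have pR: "(\<Sum>!a. p a x y * R a x y) = S rho x y"
    proof -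
      have "(\<Sum>!a. p a x y * R a x y) = (\<Sum>!a j. y $ j * (g j a x y * R a x y))"
        by (simp add: y_low_def sum_distrib_left sum_distrib_right mult_ac g_sym[OF x])
      also have "\<dots> = (\<Sum>!j. y $ j * (\<Sum>!a. g j a x y * R a x y))"
        by (subst sum.swap) (simp add: sum_distrib_left)
      finally show ?thesis by (simp add: gR S_rho[OF x])
    qed
    have "vdiv (\<lambda>a x y. p k x y * R a x y) x y = dx k rho x y"
      using x sR by (simp add: vdiv_mult v dy_p gR)
    moreover have "(\<Sum>!a. dy a ?m x y * (p k x y * R a x y)) = - real CARD('n) * ?l x y * p k x y * S rho x y"
      by (simp add: dy_Linv[OF x] pR[symmetric] sum_distrib_left sum_negf mult_ac)
    ultimately have "vdiv (\<lambda>a x y. ?m x y * (p k x y * R a x y)) x y = ?m x y * dx k rho x y - real CARD('n) * ?l x y * p k x y * S rho x y"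
      using x sR by (simp add: vdiv_mult[of ?m])
    moreover have "vdiv (\<lambda>a x y. (- 1 / real CARD('n)) * (?m x y * (p k x y * R a x y))) x y
      = (- 1 / real CARD('n)) * vdiv (\<lambda>a x y. ?m x y * (p k x y * R a x y)) x y"
      using vdiv_mult[of "\<lambda>x y. - 1 / real CARD('n)" "\<lambda>a x y. ?m x y * (p k x y * R a x y)", OF _ _ x] x sR
      by (simp add: derivation_const[OF derivation_dy])
    ultimately show ?thesis by (simp add: R_def)
  qed
  have "vdiv (flux k) x y = vdiv ?V1 x y
     + vdiv ?V2 x y
     + vdiv ?V3 x y"
  proof -
    have "vdiv (flux k) x y = vdiv (\<lambda>a x y. ?l x y * (p k x y * jacobi P_up a x y) + ?l x y * (1/2 * Dcurv a k x y)) x y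
     + vdiv ?V3 x y"
      unfolding flux_def by (rule vdiv_add[OF _ _ x]) simp_all
    also have "vdiv (\<lambda>a x y. ?l x y * (p k x y * jacobi P_up a x y) + ?l x y * (1/2 * Dcurv a k x y)) x y
      = vdiv ?V1 x y + vdiv ?V2 x y"
      by (rule vdiv_add[OF _ _ x]) simp_all
    finally show ?thesis .
  qed
  moreover have "2 * (?Z)
      = (L x y)\<^sup>2 * dx k rho x y - 2 * p k x y * S rho x y - vdiv (\<lambda>a. Dcurv a k) x y"
    using D_D_P_ric[OF x, of k] ric_variation[OF x, of k] by simp
  then have "?Z
      = 1/2 * (L x y)\<^sup>2 * dx k rho x y - p k x y * S rho x y - 1/2 * vdiv (\<lambda>a. Dcurv a k) x y" by simp
  moreover have "?l x y * (L x y)\<^sup>2 = ?m x y"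
    using L_pos[OF x] by (simp add: Linv_def power_add power2_eq_square field_simps)
  ultimately show ?thesis
    unfolding 1 2 3 by (simp add: algebra_simps)
qed

lemma fiber_identity:
  assumes x: "x \<in> \<Omega>" "y \<noteq> 0"
  shows "L x y powr (- 2) * cov0_0 L (frakP L) x y * p k x y * fiber_density L x y
    = (\<Sum>!a. dy a (\<lambda>x y. gdet x y * flux k a x y) x y) - (1/2 - 1/real CARD('n)) * pd k \<rho> x * fiber_density L x y"
proof -
  have d: "fiber_density L x y = gdet x y * Linv CARD('n) x y"
    by (simp add: fiber_density_def gdet_def Linv_def divide_inverse)
  have l: "L x y powr (- 2) * Linv CARD('n) x y = Linv (CARD('n) + 2) x y"
    using L_pos[OF x] by (simp add: Linv_def powr_minus powr_numeral power_add mult.commute power2_eq_square)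
  have pd: "pd k \<rho> x = dx k rho x y" by (simp add: dx_def rho_def)
  have "L x y powr (- 2) * cov0_0 L (frakP L) x y * p k x y * fiber_density L x y
    = gdet x y * ((L x y powr (- 2) * Linv CARD('n) x y) * (p k x y * S (frakP L) x y))"
    by (simp add: d cov0_0_eq[OF x])
  then show ?thesis
    unfolding l dy_gdet[OF sm_flux x] vdiv_flux[OF x] by (simp add: d pd algebra_simps)
qed

lemma hom_weighted_flux: "hom (1 - real CARD('n)) (\<lambda>x y. gdet x y * flux k a x y)"
  by (rule hom_mult[OF hom_gdet hom_flux]) simp

end

section \<open>A divergence theorem on the fibers\<close>

text \<open>The point with coordinates \<open>u\<close> on \<open>J\<close> and constant coordinates \<open>c\<close> elsewhere, so that faces of the
  cube and their edges of codimension two are treated alike.\<close>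

definition cube_point :: "'n::finite set \<Rightarrow> real ^ 'n \<Rightarrow> ('n \<Rightarrow> real) \<Rightarrow> real ^ 'n" where
  "cube_point J c u = (\<chi> j. if j \<in> J then u j else c $ j)"

abbreviation lborel_on :: "'n set \<Rightarrow> ('n \<Rightarrow> real) measure" where
  "lborel_on J \<equiv> PiM J (\<lambda>_. lborel)"
abbreviation cube :: "'n set \<Rightarrow> ('n \<Rightarrow> real) set" where
  "cube J \<equiv> J \<rightarrow>\<^sub>E {-1..1}"

lemma face_point_eq: "face_point k \<epsilon> u = cube_point (UNIV - {k}) (axis k \<epsilon>) u"
  by (simp add: face_point_def cube_point_def vec_eq_iff axis_def)

lemma cube_point_nz: "j \<notin> J \<Longrightarrow> c $ j \<noteq> 0 \<Longrightarrow> cube_point J c u \<noteq> 0"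
  by (auto simp: cube_point_def vec_eq_iff)

lemma cube_point_measurable: "cube_point J c \<in> borel_measurable (lborel_on J)"
proof (rule borel_measurable_euclidean_space[THEN iffD2], rule ballI)
  fix i :: "real ^ 'a" assume "i \<in> Basis"
  then obtain j where i: "i = axis j 1" by (auto simp: Basis_vec_def)
  have "(\<lambda>u. if j \<in> J then u j else c $ j) \<in> borel_measurable (lborel_on J)"
    by (cases "j \<in> J") auto
  then show "(\<lambda>u. cube_point J c u \<bullet> i) \<in> borel_measurable (lborel_on J)"
    by (simp add: i inner_axis cube_point_def)
qed

lemma sets_cube: "cube J \<in> sets (lborel_on (J :: 'n::finite set))"
  by (intro sets_PiM_I_finite) auto

lemma emeasure_cube: "emeasure (lborel_on J) (cube J) = 2 ^ card (J :: 'n::finite set)"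
proof -
  interpret product_sigma_finite "\<lambda>_ :: 'n. lborel :: real measure" ..
  have "emeasure (lborel_on J) (cube J) = (\<Prod>j\<in>J. emeasure lborel {-1..1 :: real})"
    by (intro emeasure_PiM) auto
  then show ?thesis by (simp add: ennreal_numeral)
qed

lemma continuous_bounded_on_cube:
  fixes h :: "real ^ 'n::finite \<Rightarrow> real"
  assumes h: "continuous_on (- {0}) h" and j: "j \<notin> J" "c $ j \<noteq> 0"
  obtains B where "\<And>u. u \<in> cube J \<Longrightarrow> \<bar>h (cube_point J c u)\<bar> \<le> B"
proof -
  let ?K = "{y :: real ^ 'n. \<forall>i. (if i \<in> J then -1 else c $ i) \<le> y $ i \<and> y $ i \<le> (if i \<in> J then 1 else c $ i)}"
  have "?K = cbox (\<chi> i. if i \<in> J then -1 else c $ i) (\<chi> i. if i \<in> J then 1 else c $ i)"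
    by (intro set_eqI) (simp add: mem_box_cart)
  then have "compact ?K" by simp
  moreover have "continuous_on ?K h"
  proof (rule continuous_on_subset[OF h], rule subsetI)
    fix y assume "y \<in> ?K"
    then have "(if j \<in> J then -1 else c $ j) \<le> y $ j \<and> y $ j \<le> (if j \<in> J then 1 else c $ j)" by blast
    then show "y \<in> - {0}" using j by auto
  qed
  ultimately have "compact (h ` ?K)" using compact_continuous_image by blast
  then have "bounded (h ` ?K)" by (rule compact_imp_bounded)
  then obtain B where B: "\<forall>z\<in>h ` ?K. norm z \<le> B" unfolding bounded_iff by blast
  show ?thesis
  proof (rule that)
    fix u :: "'n \<Rightarrow> real" assume u: "u \<in> cube J"
    have "cube_point J c u \<in> ?K" using u by (auto simp: cube_point_def PiE_iff)
    then show "\<bar>h (cube_point J c u)\<bar> \<le> B" using B by auto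
  qed
qed

lemma cube_measurable:
  fixes h :: "real ^ 'n::finite \<Rightarrow> real"
  assumes h: "continuous_on (- {0}) h" and j: "j \<notin> J" "c $ j \<noteq> 0"
  shows "(\<lambda>u. h (cube_point J c u)) \<in> borel_measurable (lborel_on J)"
proof -
  have "(\<lambda>y. indicator (- {0}) y *\<^sub>R h y) \<in> borel_measurable borel"
    by (rule borel_measurable_continuous_on_indicator[OF _ h]) auto
  from measurable_compose[OF cube_point_measurable this]
  have "(\<lambda>u. indicator (- {0}) (cube_point J c u) *\<^sub>R h (cube_point J c u)) \<in> borel_measurable (lborel_on J)" .
  then show ?thesis by (simp add: cube_point_nz[OF j])
qed

lemma set_integrable_cube:
  fixes h :: "real ^ 'n::finite \<Rightarrow> real"
  assumes h: "continuous_on (- {0}) h" and j: "j \<notin> J" "c $ j \<noteq> 0"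
  shows "set_integrable (lborel_on J) (cube J) (\<lambda>u. h (cube_point J c u))"
proof -
  obtain B where B: "\<And>u. u \<in> cube J \<Longrightarrow> \<bar>h (cube_point J c u)\<bar> \<le> B"
    using continuous_bounded_on_cube[OF assms] by blast
  show ?thesis
    unfolding set_integrable_def
    by (rule integrableI_bounded_set_indicator[OF sets_cube cube_measurable[OF assms], where B = B])
      (auto simp: emeasure_cube B power_less_top_ennreal)
qed

lemma cube_point_fun_upd:
  assumes "l \<noteq> k"
  shows "cube_point (UNIV - {k}) (axis k \<epsilon>) (v(l := t)) = cube_point (UNIV - {k, l}) (axis k \<epsilon> + axis l t) v"
  using assms by (auto simp: cube_point_def vec_eq_iff axis_def)

lemma cube_point_shift:
  assumes "l \<notin> J"
  shows "cube_point J (c + axis l (s + t)) v = cube_point J (c + axis l t) v + s *\<^sub>R axis l 1"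
  using assms by (auto simp: cube_point_def vec_eq_iff axis_def)

text \<open>Fubini's theorem and the fundamental theorem of calculus in the tangential direction \<open>l\<close>.\<close>

lemma integral_partial_over_face:
  fixes F F' :: "real ^ 'n::finite \<Rightarrow> real"
  assumes lk: "l \<noteq> k" and \<epsilon>: "\<epsilon> \<noteq> 0"
    and F: "\<And>y. y \<noteq> 0 \<Longrightarrow> ((\<lambda>t. F (y + t *\<^sub>R axis l 1)) has_real_derivative F' y) (at 0)"
    and F': "continuous_on (- {0}) F'"
  shows "(LINT u : cube (UNIV - {k}) | lborel_on (UNIV - {k}). F' (face_point k \<epsilon> u))
    = (LINT v : cube (UNIV - {k, l}) | lborel_on (UNIV - {k, l}).
         F (cube_point (UNIV - {k, l}) (axis k \<epsilon> + axis l 1) v) - F (cube_point (UNIV - {k, l}) (axis k \<epsilon> + axis l (-1)) v))"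
proof -
  interpret product_sigma_finite "\<lambda>_ :: 'n. lborel :: real measure" ..
  let ?J = "UNIV - {k, l}"
  have ins: "UNIV - {k} = insert l ?J" using lk by auto
  let ?f = "\<lambda>u. indicator (cube (UNIV - {k})) u *\<^sub>R F' (cube_point (UNIV - {k}) (axis k \<epsilon>) u)"
  let ?y = "\<lambda>v t. cube_point ?J (axis k \<epsilon> + axis l t) v"
  have nz: "?y v t \<noteq> 0" for v t
    using \<epsilon> lk by (intro cube_point_nz[of k]) (auto simp: axis_def)
  have int: "integrable (lborel_on (UNIV - {k})) ?f"
    using set_integrable_cube[OF F', of k "UNIV - {k}" "axis k \<epsilon>"] \<epsilon> by (simp add: set_integrable_def)
  have "(LINT u : cube (UNIV - {k}) | lborel_on (UNIV - {k}). F' (face_point k \<epsilon> u)) = integral\<^sup>L (lborel_on (insert l ?J)) ?f"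
    by (simp add: set_lebesgue_integral_def face_point_eq ins)
  also have "\<dots> = (\<integral>v. (\<integral>t. ?f (v(l := t)) \<partial>lborel) \<partial>lborel_on ?J)"
    by (rule product_integral_insert) (use int ins in simp_all)
  also have "\<dots> = (\<integral>v. indicator (cube ?J) v *\<^sub>R (F (?y v 1) - F (?y v (-1))) \<partial>lborel_on ?J)"
  proof (rule Bochner_Integration.integral_cong[OF refl])
    fix v assume "v \<in> space (lborel_on ?J)"
    then have ext: "v \<in> extensional ?J" by (auto simp: space_PiM PiE_def)
    have ind: "indicator (cube (UNIV - {k})) (v(l := t)) = (indicator (cube ?J) v * indicator {-1..1} t :: real)" for t
      using ext lk unfolding ins by (auto simp: indicator_def PiE_iff extensional_def split: if_splits)
    have "(\<integral>t. F' (?y v t) * indicator {-1..1} t \<partial>lborel) = F (?y v 1) - F (?y v (-1))"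
    proof (rule integral_FTC_Icc_real)
      fix t :: real
      have "((\<lambda>s. F (?y v (s + t))) has_real_derivative F' (?y v t)) (at 0)"
        using F[OF nz[of t v]] by (simp add: cube_point_shift)
      then show "((\<lambda>t. F (?y v t)) has_real_derivative F' (?y v t)) (at t)"
        using DERIV_shift[of "\<lambda>t. F (?y v t)" "F' (?y v t)" 0 t] by simp
      have "continuous_on UNIV (\<lambda>t. F' (?y v t))"
      proof (rule continuous_on_compose2[OF F'])
        have "?y v = (\<lambda>t. ?y v 0 + t *\<^sub>R axis l 1)"
          using lk by (auto simp: cube_point_def vec_eq_iff axis_def fun_eq_iff)
        then show "continuous_on UNIV (?y v)"
          by (simp only:) (intro continuous_intros)
      qed (use nz in auto)
      then show "isCont (\<lambda>t. F' (?y v t)) t"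
        by (simp add: continuous_on_eq_continuous_at)
    qed simp
    moreover have "?f (v(l := t)) = indicator (cube ?J) v * (F' (?y v t) * indicator {-1..1} t)" for t
      unfolding ind cube_point_fun_upd[OF lk] by simp
    ultimately show "(\<integral>t. ?f (v(l := t)) \<partial>lborel) = indicator (cube ?J) v *\<^sub>R (F (?y v 1) - F (?y v (-1)))"
      by (simp only: integral_mult_right_zero real_scaleR_def)
  qed
  finally show ?thesis by (simp add: set_lebesgue_integral_def)
qed

text \<open>On the face \<open>y\<^sup>k = \<epsilon>\<close>, Euler's relation expresses the normal derivative of \<open>W\<^sup>k\<close> by tangential ones,
  and the divergence becomes \<open>\<Sum>\<^sub>l \<partial>\<^sub>l (W\<^sup>l - \<epsilon> y\<^sup>l W\<^sup>k)\<close> over \<open>l \<noteq> k\<close>; this is where the degree \<open>1 - n\<close> is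
  needed. Integration along \<open>y\<^sup>l\<close> leaves \<open>\<eta> W\<^sup>l - \<epsilon> W\<^sup>k\<close> on the edge \<open>y\<^sup>k = \<epsilon>, y\<^sup>l = \<eta>\<close>. Each edge lies on two
  faces, whose contributions are opposite.\<close>

theorem homogeneous_divergence_theorem:
  fixes W :: "'n::finite \<Rightarrow> real ^ 'n \<Rightarrow> real" and W' :: "'n \<Rightarrow> 'n \<Rightarrow> real ^ 'n \<Rightarrow> real"
  assumes deriv: "\<And>a l y. y \<noteq> 0 \<Longrightarrow> ((\<lambda>t. W a (y + t *\<^sub>R axis l 1)) has_real_derivative W' a l y) (at 0)"
    and cont: "\<And>a. continuous_on (- {0}) (W a)" "\<And>a l. continuous_on (- {0}) (W' a l)"
    and euler: "\<And>a y. y \<noteq> 0 \<Longrightarrow> (\<Sum>!l. y $ l * W' a l y) = (1 - real CARD('n)) * W a y"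
  shows "(\<Sum>!k. \<Sum>\<epsilon>\<in>{-1, 1}. LINT u : cube (UNIV - {k}) | lborel_on (UNIV - {k}).
            (\<Sum>!a. W' a a (face_point k \<epsilon> u))) = 0"
proof -
  let ?J = "\<lambda>k l. UNIV - {k, l} :: 'n set"
  define edge where "edge k \<epsilon> l \<eta> = (LINT v : cube (?J k l) | lborel_on (?J k l).
     \<eta> * W l (cube_point (?J k l) (axis k \<epsilon> + axis l \<eta>) v) - \<epsilon> * W k (cube_point (?J k l) (axis k \<epsilon> + axis l \<eta>) v))"
    for k l :: 'n and \<epsilon> \<eta> :: real
  have anti: "edge k \<epsilon> l \<eta> = - edge l \<eta> k \<epsilon>" for k l \<epsilon> \<eta>
  proof -
    have c: "axis l \<eta> + axis k \<epsilon> = axis k \<epsilon> + axis l \<eta>" "?J l k = ?J k l" by (auto simp: add.commute)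
    show ?thesis
      unfolding edge_def c set_lebesgue_integral_def
      by (simp only: Bochner_Integration.integral_minus[symmetric]) (simp add: algebra_simps)
  qed
  have face: "(LINT u : cube (UNIV - {k}) | lborel_on (UNIV - {k}). (\<Sum>!a. W' a a (face_point k \<epsilon> u)))
      = (\<Sum>l\<in>UNIV - {k}. \<Sum>\<eta>\<in>{-1, 1}. edge k \<epsilon> l \<eta>)" if \<epsilon>: "\<epsilon> \<in> {-1, 1}" for k \<epsilon>
  proof -
    have \<epsilon>0: "\<epsilon> \<noteq> 0" and \<epsilon>2: "\<epsilon> * \<epsilon> = 1" using \<epsilon> by auto
    define F where "F l y = W l y - \<epsilon> * (y $ l * W k y)" for l y
    define F' where "F' l y = W' l l y - \<epsilon> * (W k y + y $ l * W' k l y)" for l y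
    have F: "((\<lambda>t. F l (y + t *\<^sub>R axis l 1)) has_real_derivative F' l y) (at 0)" if "y \<noteq> 0" for l y
    proof -
      have c: "((\<lambda>t. (y + t *\<^sub>R axis l 1) $ l) has_real_derivative 1) (at 0)"
        by (simp add: axis_def) (auto intro!: derivative_eq_intros)
      show ?thesis
        unfolding F_def F'_def
        using DERIV_diff[OF deriv[OF that, of l l] DERIV_cmult[OF DERIV_mult[OF c deriv[OF that, of k l]], of \<epsilon>]]
        by (simp add: mult.commute)
    qed
    have contF: "continuous_on (- {0}) (F l)" "continuous_on (- {0}) (F' l)" for l
      unfolding F_def F'_def by (intro continuous_intros cont)+
    have sum: "(\<Sum>!a. W' a a (face_point k \<epsilon> u)) = (\<Sum>l\<in>UNIV - {k}. F' l (face_point k \<epsilon> u))" for u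
    proof -
      let ?y = "face_point k \<epsilon> u"
      have y: "?y \<noteq> 0" "?y $ k = \<epsilon>" using \<epsilon>0 by (auto simp: face_point_def vec_eq_iff)
      have "\<epsilon> * W' k k ?y + (\<Sum>l\<in>UNIV - {k}. ?y $ l * W' k l ?y) = (1 - real CARD('n)) * W k ?y"
        using euler[OF y(1), of k] y(2) by (simp add: sum.remove[of UNIV k])
      then have "\<epsilon> * W' k k ?y = (1 - real CARD('n)) * W k ?y - (\<Sum>l\<in>UNIV - {k}. ?y $ l * W' k l ?y)"
        by linarith
      then have "\<epsilon> * (\<epsilon> * W' k k ?y) = \<epsilon> * ((1 - real CARD('n)) * W k ?y - (\<Sum>l\<in>UNIV - {k}. ?y $ l * W' k l ?y))"
        by (rule arg_cong)
      then have "W' k k ?y = \<epsilon> * ((1 - real CARD('n)) * W k ?y - (\<Sum>l\<in>UNIV - {k}. ?y $ l * W' k l ?y))"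
        using \<epsilon>2 by (simp only: mult.assoc[symmetric] mult_1)
      moreover have "(\<Sum>l\<in>UNIV - {k}. F' l ?y) = (\<Sum>l\<in>UNIV - {k}. W' l l ?y)
         - \<epsilon> * ((real CARD('n) - 1) * W k ?y + (\<Sum>l\<in>UNIV - {k}. ?y $ l * W' k l ?y))"
        by (simp add: F'_def sum_subtractf sum.distrib sum_distrib_left[symmetric] of_nat_diff Suc_le_eq)
      ultimately show ?thesis by (simp add: sum.remove[of UNIV k] algebra_simps)
    qed
    have int: "set_integrable (lborel_on (UNIV - {k})) (cube (UNIV - {k})) (\<lambda>u. F' l (face_point k \<epsilon> u))" for l
      unfolding face_point_eq using \<epsilon>0 by (intro set_integrable_cube[OF contF(2), of k]) auto
    have "(LINT u : cube (UNIV - {k}) | lborel_on (UNIV - {k}). (\<Sum>!a. W' a a (face_point k \<epsilon> u)))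
       = (\<Sum>l\<in>UNIV - {k}. LINT u : cube (UNIV - {k}) | lborel_on (UNIV - {k}). F' l (face_point k \<epsilon> u))"
      unfolding sum set_lebesgue_integral_def scaleR_sum_right
      by (rule Bochner_Integration.integral_sum) (use int in \<open>simp add: set_integrable_def\<close>)
    also have "\<dots> = (\<Sum>l\<in>UNIV - {k}. \<Sum>\<eta>\<in>{-1, 1}. edge k \<epsilon> l \<eta>)"
    proof (rule sum.cong[OF refl])
      fix l assume "l \<in> UNIV - {k}"
      then have lk: "l \<noteq> k" by auto
      let ?p = "\<lambda>\<eta> v. cube_point (?J k l) (axis k \<epsilon> + axis l \<eta>) v"
      have comp: "?p \<eta> v $ l = \<eta>" for \<eta> v using lk by (simp add: cube_point_def axis_def)
      have F1: "F l (?p 1 v) - F l (?p (-1) v)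
         = (\<Sum>\<eta>\<in>{-1, 1}. \<eta> * W l (?p \<eta> v) - \<epsilon> * W k (?p \<eta> v))" for v
        by (simp add: F_def comp)
      have nzk: "(axis k \<epsilon> + axis l \<eta>) $ k \<noteq> 0" for \<eta>
        using lk \<epsilon>0 by (simp add: axis_def)
      have inte: "set_integrable (lborel_on (?J k l)) (cube (?J k l)) (\<lambda>v. \<eta> * W l (?p \<eta> v) - \<epsilon> * W k (?p \<eta> v))" for \<eta>
        by (rule set_integrable_cube[of "\<lambda>y. \<eta> * W l y - \<epsilon> * W k y" k, OF _ _ nzk]) (auto intro!: continuous_intros cont)
      have "(LINT u : cube (UNIV - {k}) | lborel_on (UNIV - {k}). F' l (face_point k \<epsilon> u))
        = (LINT v : cube (?J k l) | lborel_on (?J k l). F l (?p 1 v) - F l (?p (-1) v))"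
        by (rule integral_partial_over_face[OF lk \<epsilon>0 F contF(2)])
      also have "\<dots> = (\<Sum>\<eta>\<in>{-1, 1}. edge k \<epsilon> l \<eta>)"
        unfolding F1 edge_def set_lebesgue_integral_def scaleR_sum_right
        by (rule Bochner_Integration.integral_sum) (use inte in \<open>simp add: set_integrable_def\<close>)
      finally show "(LINT u : cube (UNIV - {k}) | lborel_on (UNIV - {k}). F' l (face_point k \<epsilon> u)) = (\<Sum>\<eta>\<in>{-1, 1}. edge k \<epsilon> l \<eta>)" .
    qed
    finally show ?thesis .
  qed
  define e where "e k l = (\<Sum>\<epsilon>\<in>{-1, 1}. \<Sum>\<eta>\<in>{-1, 1}. edge k \<epsilon> l \<eta>)" for k l
  have anti_e: "e k l = - e l k" for k l
    unfolding e_def sum_negf[symmetric] anti[of k _ l] by (rule sum.swap)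
  have "(\<Sum>!k. \<Sum>\<epsilon>\<in>{-1, 1}. LINT u : cube (UNIV - {k}) | lborel_on (UNIV - {k}).
            (\<Sum>!a. W' a a (face_point k \<epsilon> u))) = (\<Sum>!k. \<Sum>\<epsilon>\<in>{-1, 1}. \<Sum>l\<in>UNIV - {k}. \<Sum>\<eta>\<in>{-1, 1}. edge k \<epsilon> l \<eta>)"
    by (intro sum.cong refl face)
  also have "\<dots> = (\<Sum>!k. \<Sum>l\<in>UNIV - {k}. e k l)"
    unfolding e_def by (intro sum.cong refl sum.swap)
  also have "\<dots> = (\<Sum>!k l. e k l)"
  proof (rule sum.cong[OF refl])
    fix k show "(\<Sum>l\<in>UNIV - {k}. e k l) = (\<Sum>!l. e k l)"
      using anti_e[of k k] by (simp add: sum.remove[of UNIV k])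
  qed
  also have "\<dots> = 0"
  proof -
    have "(\<Sum>!k l. e k l) = (\<Sum>!l k. e k l)" by (rule sum.swap)
    also have "\<dots> = - (\<Sum>!l k. e l k)" by (subst anti_e) (simp add: sum_negf)
    finally show ?thesis by simp
  qed
  finally show ?thesis .
qed

section \<open>Integration over the fibers\<close>

context slit_domain
begin

lemma sm_continuous_fiber:
  assumes "sm f" "x \<in> \<Omega>"
  shows "continuous_on (- {0}) (f x)"
proof -
  have "continuous_on (\<Omega> \<times> (UNIV - {0})) (\<lambda>p. f (fst p) (snd p))"
    using assms(1) unfolding sm_iff smooth_on_def by (metis Ck_on.simps(1))
  then have "continuous_on (- {0}) (\<lambda>y. f (fst (x, y)) (snd (x, y)))"
    by (rule continuous_on_compose2) (use assms(2) in \<open>auto intro!: continuous_intros\<close>)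
  then show ?thesis by simp
qed

lemma fiber_divergence_theorem:
  assumes W: "\<And>a. hom (1 - real CARD('n)) (W a)" and x: "x \<in> \<Omega>"
  shows "(\<Sum>!k. \<Sum>\<epsilon>\<in>{-1, 1}. LINT u : cube (UNIV - {k}) | lborel_on (UNIV - {k}).
            (\<Sum>!a. dy a (W a) x (face_point k \<epsilon> u))) = 0"
proof (rule homogeneous_divergence_theorem[where W = "\<lambda>a. W a x" and W' = "\<lambda>a l. dy l (W a) x"])
  have s: "sm (W a)" for a by (rule hom_sm[OF W])
  show "((\<lambda>t. W a x (y + t *\<^sub>R axis l 1)) has_real_derivative dy l (W a) x y) (at 0)" if "y \<noteq> 0" for a l y
    unfolding dy_eq_dir[OF s x that] by (rule dy_has_derivative[OF s x that])
  show "continuous_on (- {0}) (W a x)" "continuous_on (- {0}) (dy l (W a) x)" for a l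
    using s x by (simp_all add: sm_continuous_fiber)
  show "(\<Sum>!l. y $ l * dy l (W a) x y) = (1 - real CARD('n)) * W a x y" if "y \<noteq> 0" for a y
    using hom_euler[OF W x that] by (simp add: euler_def)
qed

end

lemma set_integral_cube_pos:
  fixes h :: "real ^ 'n::finite \<Rightarrow> real"
  assumes h: "continuous_on (- {0}) h" "\<And>y. y \<noteq> 0 \<Longrightarrow> h y > 0" and j: "j \<notin> J" "c $ j \<noteq> 0"
  shows "(LINT u : cube J | lborel_on J. h (cube_point J c u)) > 0"
proof -
  have "continuous_on (- {0}) (\<lambda>y. inverse (h y))"
    using h(2) by (intro continuous_on_inverse h(1)) (auto simp: less_imp_neq[THEN not_sym])
  then obtain B where B: "\<And>u. u \<in> cube J \<Longrightarrow> \<bar>inverse (h (cube_point J c u))\<bar> \<le> B"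
    using continuous_bounded_on_cube[OF _ j] by blast
  \<comment> \<open>A positive lower bound of \<open>h\<close>, from the boundedness of \<open>1 / h\<close>.\<close>
  define b where "b = inverse (max B 1)"
  have b: "b > 0" by (simp add: b_def)
  have "b \<le> h (cube_point J c u)" if "u \<in> cube J" for u
  proof -
    have pos: "h (cube_point J c u) > 0" by (rule h(2)[OF cube_point_nz[OF j]])
    have "inverse (h (cube_point J c u)) \<le> max B 1" using B[OF that] by linarith
    then have "inverse (max B 1) \<le> inverse (inverse (h (cube_point J c u)))"
      using pos by (intro le_imp_inverse_le) auto
    then show ?thesis by (simp add: b_def)
  qed
  then have "(LINT u : cube J | lborel_on J. b) \<le> (LINT u : cube J | lborel_on J. h (cube_point J c u))"
    using set_integrable_cube[of "\<lambda>_. b", OF _ j] set_integrable_cube[OF h(1) j]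
    by (intro set_integral_mono) auto
  moreover have "(LINT u : cube J | lborel_on J. b) > 0"
  proof -
    have "emeasure (lborel_on J) (cube J) \<noteq> \<infinity>"
      using power_less_top_ennreal[of 2 "card J"] by (simp add: emeasure_cube)
    then have "(LINT u : cube J | lborel_on J. b) = measure (lborel_on J) (cube J) *\<^sub>R b"
      by (rule set_integral_const[OF sets_cube])
    moreover have "measure (lborel_on J) (cube J) > 0"

      unfolding measure_def emeasure_cube enn2real_positive_iff by (simp add: power_less_top_ennreal zero_less_iff_neq_zero)
    ultimately show ?thesis using b by simp
  qed
  ultimately show ?thesis by linarith
qed

context einstein_domain
begin

lemma sm_fiber_density: "sm (fiber_density L)"
proof -
  have "sm (\<lambda>x y. gdet x y * Linv CARD('n) x y)" by simp
  then show ?thesis by (rule sm_cong) (simp add: fiber_density_def gdet_def Linv_def divide_inverse)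
qed

lemma fiber_density_pos: "x \<in> \<Omega> \<Longrightarrow> y \<noteq> 0 \<Longrightarrow> fiber_density L x y > 0"
  using gdet_pos[of x y] L_pos[of x y] by (simp add: fiber_density_def gdet_def)

lemma face_point_nz: "\<epsilon> \<in> {-1, 1} \<Longrightarrow> face_point k \<epsilon> u \<noteq> 0"
  unfolding face_point_eq by (rule cube_point_nz[of k]) auto

lemma set_integrable_face:
  assumes "sm f" "x \<in> \<Omega>" "\<epsilon> \<in> {-1, 1}"
  shows "set_integrable (lborel_on (UNIV - {k})) (cube (UNIV - {k})) (\<lambda>u. f x (face_point k \<epsilon> u))"
  unfolding face_point_eq
  by (rule set_integrable_cube[OF sm_continuous_fiber[OF assms(1,2)], of k]) (use assms(3) in auto)

lemma fiber_volume_pos: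
  assumes "x \<in> \<Omega>"
  shows "fiber_integral L x (\<lambda>y. 1) > 0"
  unfolding fiber_integral_def mult_1 face_point_eq
  by (intro sum_pos set_integral_cube_pos[of "fiber_density L x"]
      sm_continuous_fiber[OF sm_fiber_density assms] fiber_density_pos[OF assms]) auto

lemma fiber_integral_identity:
  assumes x: "x \<in> \<Omega>"
  shows "fiber_integral L x (\<lambda>y. L x y powr (- 2) * cov0_0 L (frakP L) x y * p k x y)
    = - (1/2 - 1 / real CARD('n)) * pd k \<rho> x * fiber_integral L x (\<lambda>y. 1)"
proof -
  let ?J = "\<lambda>i. UNIV - {i} :: 'n set"
  let ?c = "(1/2 - 1 / real CARD('n)) * pd k \<rho> x"
  define W where "W a = (\<lambda>x y. gdet x y * flux k a x y)" for a
  have sW: "sm (\<lambda>x y. \<Sum>!a. dy a (W a) x y)" by (simp add: W_def)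
  let ?h = "\<lambda>y. L x y powr (- 2) * cov0_0 L (frakP L) x y * p k x y"
  have face: "(LINT u : cube (?J i) | lborel_on (?J i). ?h (face_point i \<epsilon> u) * fiber_density L x (face_point i \<epsilon> u))
     = (LINT u : cube (?J i) | lborel_on (?J i). \<Sum>!a. dy a (W a) x (face_point i \<epsilon> u))
       - ?c * (LINT u : cube (?J i) | lborel_on (?J i). fiber_density L x (face_point i \<epsilon> u))"
    if \<epsilon>: "\<epsilon> \<in> {-1, 1}" for i \<epsilon>
  proof -
    have "(LINT u : cube (?J i) | lborel_on (?J i). ?h (face_point i \<epsilon> u) * fiber_density L x (face_point i \<epsilon> u))
      = (LINT u : cube (?J i) | lborel_on (?J i). (\<Sum>!a. dy a (W a) x (face_point i \<epsilon> u))
          - ?c * fiber_density L x (face_point i \<epsilon> u))"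
      unfolding W_def by (simp only: fiber_identity[OF x face_point_nz[OF \<epsilon>]])
    then show ?thesis
      using set_integrable_face[OF sW x \<epsilon>, of i] set_integrable_face[OF sm_fiber_density x \<epsilon>, of i] by simp
  qed
  have z: "(\<Sum>!i. \<Sum>\<epsilon>\<in>{-1, 1}. LINT u : cube (?J i) | lborel_on (?J i). \<Sum>!a. dy a (W a) x (face_point i \<epsilon> u)) = 0"
    by (rule fiber_divergence_theorem[OF _ x]) (simp add: W_def hom_weighted_flux)
  have "fiber_integral L x ?h
    = (\<Sum>!i. \<Sum>\<epsilon>\<in>{-1, 1}. (LINT u : cube (?J i) | lborel_on (?J i). \<Sum>!a. dy a (W a) x (face_point i \<epsilon> u))
       - ?c * (LINT u : cube (?J i) | lborel_on (?J i). fiber_density L x (face_point i \<epsilon> u)))"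
    unfolding fiber_integral_def by (intro sum.cong refl face)
  also have "\<dots> = - ?c * fiber_integral L x (\<lambda>y. 1)"
    by (simp only: sum_subtractf z fiber_integral_def mult_1 sum_distrib_left[symmetric]) simp
  finally show ?thesis by (simp only: mult_minus_left)
qed

theorem schur_identity:
  assumes x: "x \<in> \<Omega>"
  shows "(real CARD('n) - 2) * pd k \<rho> x = - 2 * real CARD('n) *
    (fiber_integral L x (\<lambda>y. L x y powr (- 2) * cov0_0 L (frakP L) x y * p k x y) / fiber_integral L x (\<lambda>y. 1))"
  using fiber_volume_pos[OF x] unfolding fiber_integral_identity[OF x] by (simp add: field_simps)

lemma fiber_average_component:
  assumes x: "x \<in> \<Omega>"
  shows "fiber_average L 1 (\<lambda>i x y. cov0_0 L (frakP L) x y * hilbert_form L i x y) x $ k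
    = fiber_integral L x (\<lambda>y. L x y powr (- 2) * cov0_0 L (frakP L) x y * p k x y) / fiber_integral L x (\<lambda>y. 1)"
proof -
  have e: "L x y powr (- 1) * (cov0_0 L (frakP L) x y * hilbert_form L k x y)
     = L x y powr (- 2) * cov0_0 L (frakP L) x y * p k x y" if y: "y \<noteq> 0" for y
    using L_pos[OF x y] by (simp add: hilbert_form_def powr_minus powr_numeral power2_eq_square divide_inverse mult_ac)
  have "fiber_integral L x (\<lambda>y. L x y powr (- 1) * (cov0_0 L (frakP L) x y * hilbert_form L k x y))
     = fiber_integral L x (\<lambda>y. L x y powr (- 2) * cov0_0 L (frakP L) x y * p k x y)"
    unfolding fiber_integral_def by (intro sum.cong refl) (simp only: e[OF face_point_nz])
  then show ?thesis by (simp add: fiber_average_def)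
qed

end

section \<open>Reduction to charts\<close>

text \<open>The next lemmas reduce the theorem to one chart: the coordinate expression of a Finsler metric is
  smooth, positive and homogeneous, and its fundamental tensor is positive definite.\<close>

locale manifold_chart =
  fixes X :: "'m topology" and A :: "('m, 'n::finite) chart set" and c :: "('m, 'n) chart"
  assumes manifold: "smooth_manifold X A" and c: "c \<in> A"
begin

lemma chart_facts:
  assumes "c' \<in> A"
  shows "openin X (fst c')" "open (chart_img c')"
    "homeomorphic_map (subtopology X (fst c')) (top_of_set (chart_img c')) (snd c')"
  using manifold assms unfolding smooth_manifold_def by auto

lemma chart_inj: "c' \<in> A \<Longrightarrow> inj_on (snd c') (fst c')"
  using homeomorphic_imp_injective_map[OF chart_facts(3)] openin_subset[OF chart_facts(1)]
  by (simp add: Int_absorb1)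

lemma chart_inv_point: "c' \<in> A \<Longrightarrow> q \<in> fst c' \<Longrightarrow> chart_inv c' (snd c' q) = q"
  unfolding chart_inv_def by (rule inv_into_f_f[OF chart_inj])

lemma open_chart_image:
  assumes "c' \<in> A" "openin X U" "U \<subseteq> fst c'"
  shows "open (snd c' ` U)"
proof -
  have "openin (subtopology X (fst c')) U"
    using assms by (simp add: openin_subtopology) (metis Int_absorb2)
  then have "openin (top_of_set (chart_img c')) (snd c' ` U)"
    using homeomorphic_imp_open_map[OF chart_facts(3)[OF assms(1)]] by (simp add: open_map_def)
  then show ?thesis using chart_facts(2)[OF assms(1)] openin_open_trans by blast
qed

lemma transition_has_derivative:
  assumes "c1 \<in> A" "c2 \<in> A" "q \<in> fst c1" "q \<in> fst c2"
  shows "(transition c1 c2 has_derivative frechet_derivative (transition c1 c2) (at (snd c1 q))) (at (snd c1 q))"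
  using manifold assms by (intro smooth_on_has_derivative[of _ "snd c1 ` (fst c1 \<inter> fst c2)"])
    (auto simp: smooth_manifold_def)

text \<open>That natural coordinates describe a tangent vector is the chain rule for transition maps.\<close>

lemma coord_vector_tangent:
  assumes x: "x \<in> chart_img c"
  shows "coord_vector A c x y \<in> tangent_space A (chart_inv c x)"
    and "chart_inv c x \<in> topspace X"
    and "coord_vector A c x y c = y"
    and "coord_vector A c x (t *\<^sub>R y) = (\<lambda>c'. t *\<^sub>R coord_vector A c x y c')"
proof -
  obtain q where q: "q \<in> fst c" "x = snd c q" using x by (auto simp: chart_img_def)
  have inv: "chart_inv c x = q" using chart_inv_point[OF c q(1)] q(2) by simp
  have D: "(transition c c' has_derivative frechet_derivative (transition c c') (at x)) (at x)"
    if "c' \<in> A" "q \<in> fst c'" for c'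
    unfolding q(2) by (rule transition_has_derivative[OF c that(1) q(1) that(2)])
  have chain: "frechet_derivative (transition c c2) (at x) y
      = frechet_derivative (transition c1 c2) (at (snd c1 q)) (frechet_derivative (transition c c1) (at x) y)"
    if c12: "c1 \<in> A" "c2 \<in> A" "q \<in> fst c1" "q \<in> fst c2" for c1 c2
  proof -
    let ?U = "fst c \<inter> (fst c1 \<inter> fst c2)"
    have U: "open (snd c ` ?U)"
      by (rule open_chart_image[OF c]) (auto intro: chart_facts(1) c c12)
    have at: "transition c c1 x = snd c1 q" by (simp add: transition_def inv)
    have "((\<lambda>z. transition c1 c2 (transition c c1 z)) has_derivative
       (\<lambda>y. frechet_derivative (transition c1 c2) (at (snd c1 q)) (frechet_derivative (transition c c1) (at x) y))) (at x)"
      by (rule has_derivative_compose[OF D[OF c12(1,3)]]) (simp add: at transition_has_derivative c12)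
    then have "(transition c c2 has_derivative
       (\<lambda>y. frechet_derivative (transition c1 c2) (at (snd c1 q)) (frechet_derivative (transition c c1) (at x) y))) (at x)"
    proof (rule has_derivative_transform_within_open[OF _ U])
      show "x \<in> snd c ` ?U" using q c12 by auto
      fix z assume "z \<in> snd c ` ?U"
      then show "transition c1 c2 (transition c c1 z) = transition c c2 z"
        using c c12 by (auto simp: transition_def chart_inv_point)
    qed
    from frechet_derivative_at[OF this] show ?thesis by metis
  qed
  show "coord_vector A c x y \<in> tangent_space A (chart_inv c x)"
    unfolding tangent_space_def
  proof (intro CollectI conjI ballI impI allI)
    fix c1 c2 assume "c1 \<in> A" "c2 \<in> A" and pq: "chart_inv c x \<in> fst c1 \<and> chart_inv c x \<in> fst c2"
    then show "coord_vector A c x y c2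
        = frechet_derivative (transition c1 c2) (at (snd c1 (chart_inv c x))) (coord_vector A c x y c1)"
      using chain[of c1 c2] by (simp add: coord_vector_def inv)
  next
    fix c' assume "\<not> (c' \<in> A \<and> chart_inv c x \<in> fst c')"
    then show "coord_vector A c x y c' = 0" by (auto simp: coord_vector_def)
  qed
  show "chart_inv c x \<in> topspace X"
    using openin_subset[OF chart_facts(1)[OF c]] q(1) inv by auto
  have "(transition c c has_derivative (\<lambda>y. y)) (at x)"
  proof (rule has_derivative_transform_within_open[OF _ chart_facts(2)[OF c] x])
    fix z assume "z \<in> chart_img c"
    then show "z = transition c c z"
      using c by (auto simp: transition_def chart_img_def chart_inv_point)
  qed (rule has_derivative_ident)
  from frechet_derivative_at[OF this] show "coord_vector A c x y c = y"
    using c q(1) inv by (simp add: coord_vector_def) metis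
  show "coord_vector A c x (t *\<^sub>R y) = (\<lambda>c'. t *\<^sub>R coord_vector A c x y c')"
    unfolding coord_vector_def inv
    by (auto simp: fun_eq_iff linear_cmul[OF has_derivative_linear[OF D]])
qed

lemma finsler_chart:
  assumes F: "finsler_metric X A F"
  shows "finsler_domain (chart_img c) (in_chart A F c)"
proof -
  interpret slit_domain "chart_img c"
    by unfold_locales (rule chart_facts(2)[OF c])
  show ?thesis
  proof unfold_locales
    show "sm (in_chart A F c)" using F c by (simp add: sm_def finsler_metric_def)
  next
    fix x y :: "real ^ 'n" assume x: "x \<in> chart_img c" and y: "y \<noteq> 0"
    have "coord_vector A c x y \<noteq> (\<lambda>_. 0)"
    proof
      assume "coord_vector A c x y = (\<lambda>_. 0)"
      then show False using coord_vector_tangent(3)[OF x, of y] y by simp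
    qed
    then have *: "F (chart_inv c x) (coord_vector A c x y) > 0"
      "\<forall>\<mu>>0. F (chart_inv c x) (\<lambda>c'. \<mu> *\<^sub>R coord_vector A c x y c') = \<mu> * F (chart_inv c x) (coord_vector A c x y)"
      using F coord_vector_tangent(1)[OF x, of y] coord_vector_tangent(2)[OF x] unfolding finsler_metric_def by blast+
    show "in_chart A F c x y > 0" using *(1) by (simp add: in_chart_def)
    show "in_chart A F c x (t *\<^sub>R y) = t * in_chart A F c x y" if "t > 0" for t
      using *(2) that by (simp add: in_chart_def coord_vector_tangent(4)[OF x])
    show "posdef (fund_matrix (in_chart A F c) x y)"
      using F c x y by (simp add: finsler_metric_def posdef_def fund_matrix_def)
  qed
qed

end

theorem theorem4p1:
  fixes X :: "'m topology"
    and A :: "('m, 'n::finite) chart set"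
    and F :: "'m \<Rightarrow> (('m, 'n) chart \<Rightarrow> real ^ 'n) \<Rightarrow> real"
    and \<rho> :: "'m \<Rightarrow> real"
  assumes dim: "CARD('n) \<ge> 2"
    and manifold: "smooth_manifold X A"
    and finsler: "finsler_metric X A F"
    and smooth_rho: "smooth_function A \<rho>"
    and einstein: "\<And>c x y. c \<in> A \<Longrightarrow> x \<in> chart_img c \<Longrightarrow> y \<noteq> 0 \<Longrightarrow>
      Ric (in_chart A F c) x y = \<rho> (chart_inv c x) * (in_chart A F c x y)\<^sup>2"
  shows "\<forall>c\<in>A. \<forall>x\<in>chart_img c. let L = in_chart A F c in
      (real CARD('n) - 2) *\<^sub>R differential \<rho> c x =
        (- 2 * real CARD('n)) *\<^sub>R
          fiber_average L 1 (\<lambda>i x y. cov0_0 L (frakP L) x y * hilbert_form L i x y) x \<and>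
      (\<forall>i. (real CARD('n) - 2) * pd i (\<lambda>x'. \<rho> (chart_inv c x')) x =
        - 2 * real CARD('n) *
          (fiber_integral L x (\<lambda>y. L x y powr (-2) * cov0_0 L (frakP L) x y * y_low L i x y)
            / fiber_integral L x (\<lambda>y. 1)))"
proof (intro ballI, goal_cases)
  case (1 c x)
  interpret manifold_chart X A c by unfold_locales (fact manifold, fact 1(1))
  interpret finsler_domain "chart_img c" "in_chart A F c" by (rule finsler_chart[OF finsler])
  interpret einstein_domain "chart_img c" "in_chart A F c" "\<lambda>x. \<rho> (chart_inv c x)"
    by unfold_locales (rule einstein[OF 1(1)])
  show ?case
    unfolding Let_def using schur_identity[OF 1(2)] fiber_average_component[OF 1(2)]
    by (simp add: vec_eq_iff differential_def)
qed

end
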